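(* For every fixed integer $k\geq 3$, the problem of packing splittable items with a cardinality constraint of $k$ parts of items per bin (as defined in the context) is NP-hard in the strong sense.
   Context: Splittable item packing with cardinality constraint $k$: the input is a finite list of items with positive real sizes (sizes may exceed $1$). Bins have capacity $1$. Each item may be split into any finite number of parts of arbitrary positive sizes summing to the item's size. A packing assigns the parts to bins such that the total size of parts in each bin is at most $1$ and each bin contains at most $k$ parts (of items). The objective is to minimize the number of bins used. (The decision version asks whether the items can be packed into a given number of bins.) *)

theory Defs
  imports Complex_Main "HOL-Computational_Algebra.Polynomial"
begin

section \<open>Deterministic multi-tape Turing machines\<close>

text \<open>
  Tapes are two-way infinite. States and tape symbols are initial segments of the natural
  numbers; state 0 is the start state and state 1 the halting state; symbol 0 is the blank, and
  symbols 1 and 2 represent the bits False and True. A transition maps the current state and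
  the list of scanned symbols to the next state and, for each tape, the symbol to be written and
  the head movement.
\<close>

record tm =
  num_tapes :: nat
  num_states :: nat
  num_syms :: nat
  delta :: "nat \<Rightarrow> nat list \<Rightarrow> nat \<times> (nat \<times> int) list"

definition wf_tm :: "tm \<Rightarrow> bool" where
  "wf_tm M \<longleftrightarrow> num_states M \<ge> 2 \<and> num_syms M \<ge> 3 \<and>
     (\<forall>q ss. q < num_states M \<and> length ss = num_tapes M \<and> set ss \<subseteq> {..<num_syms M} \<longrightarrow>
        (case delta M q ss of (q', acts) \<Rightarrow>
           q' < num_states M \<and> length acts = num_tapes M \<and>
           set acts \<subseteq> {..<num_syms M} \<times> {- 1, 0, 1}))"

type_synonym tape = "(int \<Rightarrow> nat) \<times> int"
type_synonym config = "nat \<times> tape list"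

definition scan :: "tape \<Rightarrow> nat" where
  "scan t = (fst t) (snd t)"

definition act :: "nat \<times> int \<Rightarrow> tape \<Rightarrow> tape" where
  "act a t = ((fst t)(snd t := fst a), snd t + snd a)"

definition tm_step :: "tm \<Rightarrow> config \<Rightarrow> config" where
  "tm_step M c = (case c of (q, ts) \<Rightarrow>
     if q = 1 then (q, ts)
     else (case delta M q (map scan ts) of (q', acts) \<Rightarrow> (q', map2 act acts ts)))"

definition bit_sym :: "bool \<Rightarrow> nat" where
  "bit_sym b = (if b then 2 else 1)"

definition input_tape :: "bool list \<Rightarrow> tape" where
  "input_tape x =
     ((\<lambda>i. if 0 \<le> i \<and> i < int (length x) then bit_sym (x ! nat i) else 0), 0)"

definition tm_init :: "tm \<Rightarrow> bool list list \<Rightarrow> config" where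
  "tm_init M xs = (0, map input_tape xs @ replicate (num_tapes M - length xs) (input_tape []))"

definition holds_string :: "tape \<Rightarrow> bool list \<Rightarrow> bool" where
  "holds_string t y \<longleftrightarrow>
     (\<forall>i < length y. fst t (int i) = bit_sym (y ! i)) \<and> fst t (int (length y)) = 0"

text \<open>
  The inputs are given on the tapes 0, ..., n - 1 and the output is read off tape n. The halting
  state is absorbing, so being halted after T steps means having halted within T steps.
\<close>

definition computes_within :: "tm \<Rightarrow> bool list list \<Rightarrow> bool list \<Rightarrow> nat \<Rightarrow> bool" where
  "computes_within M xs y T \<longleftrightarrow>
     (case (tm_step M ^^ T) (tm_init M xs) of (q, ts) \<Rightarrow>
        q = 1 \<and> holds_string (ts ! length xs) y)"

definition polytime :: "nat \<Rightarrow> (bool list list \<Rightarrow> bool list) \<Rightarrow> bool" where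
  "polytime n f \<longleftrightarrow>
     (\<exists>M (p :: nat poly). wf_tm M \<and> num_tapes M > n \<and>
        (\<forall>xs. length xs = n \<longrightarrow>
           computes_within M xs (f xs) (poly p (sum_list (map length xs)))))"

section \<open>NP and (strong) NP-hardness\<close>

definition NP :: "bool list set set" where
  "NP = {L. \<exists>(p :: nat poly) R.
     polytime 2 (\<lambda>xs. [R (xs ! 0) (xs ! 1)]) \<and>
     (\<forall>x. x \<in> L \<longleftrightarrow> (\<exists>w. length w \<le> poly p (length x) \<and> R x w))}"

text \<open>
  A decision problem is given by an encoding of instances as bit strings, the set of instances
  and the set of yes-instances. Hardness is with respect to polynomial-time many-one reductions.
\<close>

definition np_hard :: "('i \<Rightarrow> bool list) \<Rightarrow> 'i set \<Rightarrow> 'i set \<Rightarrow> bool" where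
  "np_hard enc D Y \<longleftrightarrow>
     (\<forall>L \<in> NP. \<exists>f. polytime 1 f \<and>
        (\<forall>x. \<exists>I \<in> D. f [x] = enc I \<and> (x \<in> L \<longleftrightarrow> I \<in> Y)))"

text \<open>
  Strong NP-hardness in the sense of Garey and Johnson: for some polynomial p, the problem stays
  NP-hard when restricted to the instances whose largest number is at most p of the
  encoding length.
\<close>

definition strongly_np_hard ::
  "('i \<Rightarrow> bool list) \<Rightarrow> ('i \<Rightarrow> nat) \<Rightarrow> 'i set \<Rightarrow> 'i set \<Rightarrow> bool" where
  "strongly_np_hard enc max_num D Y \<longleftrightarrow>
     (\<exists>p :: nat poly. np_hard enc {I \<in> D. max_num I \<le> poly p (length (enc I))} Y)"

section \<open>Packing splittable items with a cardinality constraint\<close>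

text \<open>
  A packing is a finite list of parts; the part (i, j, s) is a piece of item i of size s that is
  placed into bin j. Several parts of one item in the same bin are counted separately.
\<close>

definition is_packing ::
  "nat \<Rightarrow> real list \<Rightarrow> nat \<Rightarrow> (nat \<times> nat \<times> real) list \<Rightarrow> bool" where
  "is_packing k sizes m ps \<longleftrightarrow>
     (\<forall>(i, j, s) \<in> set ps. i < length sizes \<and> j < m \<and> s > 0) \<and>
     (\<forall>i < length sizes. (\<Sum>(i', j, s) \<leftarrow> filter (\<lambda>(i', j, s). i' = i) ps. s) = sizes ! i) \<and>
     (\<forall>j < m. (\<Sum>(i, j', s) \<leftarrow> filter (\<lambda>(i, j', s). j' = j) ps. s) \<le> 1) \<and>
     (\<forall>j < m. length (filter (\<lambda>(i, j', s). j' = j) ps) \<le> k)"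

definition packable :: "nat \<Rightarrow> real list \<Rightarrow> nat \<Rightarrow> bool" where
  "packable k sizes m \<longleftrightarrow> (\<exists>ps. is_packing k sizes m ps)"

text \<open>
  As inputs of an algorithm, item sizes are positive rationals, given as pairs of numerator and
  denominator. An instance consists of the list of these pairs and the number of bins.
\<close>

type_synonym pack_inst = "(nat \<times> nat) list \<times> nat"

definition pack_instances :: "pack_inst set" where
  "pack_instances = {(items, m). \<forall>(a, b) \<in> set items. a > 0 \<and> b > 0}"

definition pack_yes :: "nat \<Rightarrow> pack_inst set" where
  "pack_yes k = {(items, m) \<in> pack_instances.
     packable k (map (\<lambda>(a, b). real a / real b) items) m}"

definition pack_max :: "pack_inst \<Rightarrow> nat" where
  "pack_max I = (case I of (items, m) \<Rightarrow> Max (insert m (fst ` set items \<union> snd ` set items)))"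

fun binary :: "nat \<Rightarrow> bool list" where
  "binary n = (if n = 0 then [] else odd n # binary (n div 2))"

declare binary.simps [simp del]

text \<open>Self-delimiting: each binary digit is preceded by True, and False marks the end.\<close>

definition enc_nat :: "nat \<Rightarrow> bool list" where
  "enc_nat n = concat (map (\<lambda>b. [True, b]) (binary n)) @ [False]"

definition enc_pack :: "pack_inst \<Rightarrow> bool list" where
  "enc_pack I = (case I of (items, m) \<Rightarrow>
     enc_nat m @ concat (map (\<lambda>(a, b). enc_nat a @ enc_nat b) items))"

lemma binary_0: "binary 0 = []"
  by (subst binary.simps) simp

lemma binary_pos: "n > 0 \<Longrightarrow> binary n = odd n # binary (n div 2)"
  by (subst binary.simps) simp

lemma binary_inj: "binary m = binary n \<Longrightarrow> m = n"
proof (induction m arbitrary: n rule: less_induct)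
  case (less m)
  consider "m = 0" "n = 0" | "m = 0" "n > 0" | "m > 0" "n = 0" | "m > 0" "n > 0"
    by blast
  then show ?case
  proof cases
    case 4
    have "odd m # binary (m div 2) = odd n # binary (n div 2)"
      using less.prems unfolding binary_pos[OF 4(1)] binary_pos[OF 4(2)] .
    then have eq: "odd m = odd n" "binary (m div 2) = binary (n div 2)"
      by blast+
    from 4 have "m div 2 < m" by simp
    then have "m div 2 = n div 2" using less.IH eq(2) by blast
    then show ?thesis using eq(1) by presburger
  qed (use less.prems in \<open>simp_all add: binary_0 binary_pos\<close>)
qed

lemma enc_nat_append_inj: "enc_nat m @ u = enc_nat n @ v \<Longrightarrow> m = n \<and> u = v"
proof -
  have "concat (map (\<lambda>b. [True, b]) xs) @ [False] @ u = concat (map (\<lambda>b. [True, b]) ys) @ [False] @ v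
      \<Longrightarrow> xs = ys \<and> u = v" for xs ys
  proof (induction xs arbitrary: ys)
    case Nil then show ?case by (cases ys) auto
  next
    case (Cons x xs) then show ?case by (cases ys) auto
  qed
  note key = this
  assume "enc_nat m @ u = enc_nat n @ v"
  then have "binary m = binary n \<and> u = v"
    by (intro key) (simp add: enc_nat_def)
  then show "m = n \<and> u = v" using binary_inj by blast
qed

lemma enc_pack_inj: "inj enc_pack"
proof -
  have ne: "enc_nat n \<noteq> []" for n by (simp add: enc_nat_def)
  have *: "concat (map (\<lambda>(a, b). enc_nat a @ enc_nat b) xs) =
      concat (map (\<lambda>(a, b). enc_nat a @ enc_nat b) ys) \<Longrightarrow> xs = ys" for xs ys
  proof (induction xs arbitrary: ys)
    case Nil then show ?case by (cases ys) (auto simp: ne)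
  next
    case (Cons x xs)
    from Cons.prems obtain y ys' where ys: "ys = y # ys'"
      by (cases ys) (auto simp: ne split: prod.splits)
    obtain a b c d where xy: "x = (a, b)" "y = (c, d)" by fastforce
    let ?C = "\<lambda>zs. concat (map (\<lambda>(a, b). enc_nat a @ enc_nat b) zs)"
    have "enc_nat a @ (enc_nat b @ ?C xs) = enc_nat c @ (enc_nat d @ ?C ys')"
      using Cons.prems by (simp add: ys xy)
    then have "a = c" and "enc_nat b @ ?C xs = enc_nat d @ ?C ys'"
      using enc_nat_append_inj by blast+
    then have "b = d" and "?C xs = ?C ys'"
      using enc_nat_append_inj by blast+
    with Cons.IH \<open>a = c\<close> show ?case by (simp add: ys xy)
  qed
  show ?thesis
  proof (rule injI)
    fix I J assume "enc_pack I = enc_pack J"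
    moreover obtain xs m ys n where IJ: "I = (xs, m)" "J = (ys, n)" by fastforce
    ultimately have "enc_nat m @ concat (map (\<lambda>(a, b). enc_nat a @ enc_nat b) xs) =
        enc_nat n @ concat (map (\<lambda>(a, b). enc_nat a @ enc_nat b) ys)"
      by (simp add: enc_pack_def)
    from enc_nat_append_inj[OF this] show "I = J" using * by (simp add: IJ)
  qed
qed

end

theory Submission
  imports Defs "HOL-Library.Multiset"
begin

text \<open>
  With k times m items of total size m, none of which can be split because m bins hold at most k times
  m parts, a packing into m bins is a partition of the items into groups of k with equal sums.
  An accepting run of a verifier for a language in NP is described by a tiling of a cylinder whose
  rows are the successive configurations, the bottom row being coloured by the input. To every cell and
  tile belong two triples of elements, and a tiling amounts to a choice of triples that covers every element a prescribed
  number of times. Items of a size with few digits in a polynomially large base force the groups of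
  three proper items and k - 3 dummies to encode such a choice. All numbers are bounded by a polynomial in the number
  of items that depends only on k. The instance is written down by nested loops over rows and
  columns that evaluate arithmetic expressions in unary counters, which multi-tape machines
  simulate step by step.
\<close>

section \<open>Counter programs and their compilation to Turing machines\<close>

text \<open>The reduction starts from the definition of NP itself, so machines occur twice: the
  verifier is simulated by tiles, and the reduction has to be a machine as well. Since numbers must
  stay polynomial, an item size has only a constant number of digits, and a bin can compare only a
  few identities. Nevertheless the selection of a triple must be consistent over its three elements.
  For this purpose every triple has two slots per axis, one for each truth value: the three slots of
  one truth value share a bin, and each of the three others ends up in a bin where a link and a
  token check its element. The tokens are a fixed supply, so they control only how many triples at
  an element are selected. For tilings this says that the numbers of tiles with a given colour agree
  on both sides of an edge, not that a cell holds one tile. That every cell holds exactly one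
  follows upwards from the prescribed bottom row. The cylinder spares the treatment of left and
  right borders.\<close>

datatype test = Always | Zero nat | Scans nat | Neg test
text \<open>Branching without a loop is confined to the guards of \<open>Inc\<close> and to
  \<open>Emit\<close>, which writes the truth value of its test as a bit.\<close>

datatype instr = Inc test nat | Dec nat | Emit test | InR | InL
datatype com = Skip | Do instr | Seq com com (infixr ";;" 60) | While test com

text \<open>A store consists of the registers, the position of the input head and the output.\<close>

type_synonym store = "(nat \<Rightarrow> nat) \<times> int \<times> bool list"

primrec holds :: "bool list \<Rightarrow> test \<Rightarrow> store \<Rightarrow> bool" where
  "holds x Always s = True"
| "holds x (Zero r) s = (fst s r = 0)"
| "holds x (Scans a) s = (fst (input_tape x) (fst (snd s)) = a)"
| "holds x (Neg b) s = (\<not> holds x b s)"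

fun perform :: "bool list \<Rightarrow> instr \<Rightarrow> store \<Rightarrow> store" where
  "perform x (Inc b r) (\<rho>, p, w) = (if holds x b (\<rho>, p, w) then \<rho>(r := Suc (\<rho> r)) else \<rho>, p, w)"
| "perform x (Dec r) (\<rho>, p, w) = (\<rho>(r := \<rho> r - 1), p, w)"
| "perform x (Emit b) (\<rho>, p, w) = (\<rho>, p, w @ [holds x b (\<rho>, p, w)])"
| "perform x InR (\<rho>, p, w) = (\<rho>, p + 1, w)"
| "perform x InL (\<rho>, p, w) = (\<rho>, p - 1, w)"

text \<open>The last argument is the exact number of machine steps of the compiled code: a failing
  loop test costs its branch, an iteration costs its branch and the jump back, and sequencing is
  free.\<close>

inductive exec :: "bool list \<Rightarrow> com \<Rightarrow> store \<Rightarrow> store \<Rightarrow> nat \<Rightarrow> bool" for x where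
  exec_Skip: "exec x Skip s s 0"
| exec_Do: "exec x (Do a) s (perform x a s) 1"
| exec_Seq: "exec x c s s' t \<Longrightarrow> exec x d s' s'' u \<Longrightarrow> exec x (c ;; d) s s'' (t + u)"
| exec_WhileF: "\<not> holds x b s \<Longrightarrow> exec x (While b c) s s 1"
| exec_WhileT: "holds x b s \<Longrightarrow> exec x c s s' t \<Longrightarrow> exec x (While b c) s' s'' u
    \<Longrightarrow> exec x (While b c) s s'' (t + u + 2)"

section \<open>Compilation to jump code and its simulation by a multi-tape machine\<close>

datatype code = Op instr | Jump nat | Branch test nat

primrec code_size :: "com \<Rightarrow> nat" where
  "code_size Skip = 0"
| "code_size (Do a) = 1"
| "code_size (c ;; d) = code_size c + code_size d"
| "code_size (While b c) = code_size c + 2"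

text \<open>The second argument is the address of the first instruction, and all targets are
  absolute. A branch falls through when its test holds and leaves the loop otherwise.\<close>

primrec compile :: "com \<Rightarrow> nat \<Rightarrow> code list" where
  "compile Skip a = []"
| "compile (Do i) a = [Op i]"
| "compile (c ;; d) a = compile c a @ compile d (a + code_size c)"
| "compile (While b c) a = Branch b (a + code_size c + 2) # compile c (a + 1) @ [Jump a]"

lemma length_compile [simp]: "length (compile c a) = code_size c"
  by (induction c arbitrary: a) auto

primrec test_regs :: "test \<Rightarrow> nat set" where
  "test_regs Always = {}"
| "test_regs (Zero r) = {r}"
| "test_regs (Scans a) = {}"
| "test_regs (Neg b) = test_regs b"

fun instr_regs :: "instr \<Rightarrow> nat set" where
  "instr_regs (Inc b r) = insert r (test_regs b)"
| "instr_regs (Dec r) = {r}"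
| "instr_regs (Emit b) = test_regs b"
| "instr_regs _ = {}"

primrec regs :: "com \<Rightarrow> nat set" where
  "regs Skip = {}"
| "regs (Do i) = instr_regs i"
| "regs (c ;; d) = regs c \<union> regs d"
| "regs (While b c) = test_regs b \<union> regs c"

lemma finite_test_regs [simp]: "finite (test_regs b)"
  by (induction b) auto

lemma finite_regs [simp]: "finite (regs c)"
proof (induction c)
  case (Do i)
  then show ?case by (cases i) auto
qed auto

primrec code_ok :: "nat \<Rightarrow> code \<Rightarrow> bool" where
  "code_ok len (Op i) = True"
| "code_ok len (Jump a) = (a \<le> len)"
| "code_ok len (Branch b a) = (a \<le> len)"

text \<open>A target may equal \<open>len\<close>, the address just behind the program: reaching it
  means halting.\<close>

lemma code_ok_compile: "a + code_size c \<le> len \<Longrightarrow> \<forall>i \<in> set (compile c a). code_ok len i"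
proof (induction c arbitrary: a)
  case (Seq c d)
  from Seq.IH(1)[of a] Seq.IH(2)[of "a + code_size c"] Seq.prems show ?case by auto
next
  case (While b c)
  from While.IH[of "a + 1"] While.prems show ?case by auto
qed auto

text \<open>
  Tape 0 is the input and tape 1 the output. Tape r + 2 has symbol 1 in cell 0 only; its head
  position is the value of register r, so that a register is zero iff its head scans 1.
\<close>

primrec syms_test :: "nat list \<Rightarrow> test \<Rightarrow> bool" where
  "syms_test ss Always = True"
| "syms_test ss (Zero r) = (ss ! (r + 2) = 1)"
| "syms_test ss (Scans a) = (ss ! 0 = a)"
| "syms_test ss (Neg b) = (\<not> syms_test ss b)"

fun tape_act :: "nat list \<Rightarrow> instr \<Rightarrow> nat \<Rightarrow> nat \<times> int" where
  "tape_act ss (Inc b r) j = (ss ! j, if j = r + 2 \<and> syms_test ss b then 1 else 0)"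
| "tape_act ss (Dec r) j = (ss ! j, if j = r + 2 \<and> ss ! j \<noteq> 1 then - 1 else 0)"
| "tape_act ss (Emit b) j = (if j = 1 then (bit_sym (syms_test ss b), 1) else (ss ! j, 0))"
| "tape_act ss InR j = (ss ! j, if j = 0 then 1 else 0)"
| "tape_act ss InL j = (ss ! j, if j = 0 then - 1 else 0)"

text \<open>States 0 and 1 are reserved for starting and halting, so addresses are shifted by 2;
  every address behind the program becomes the halting state.\<close>

definition addr :: "nat \<Rightarrow> nat \<Rightarrow> nat" where
  "addr len a = (if a < len then a + 2 else 1)"

text \<open>The start state spends one step on writing the marker 1 into cell 0 of every register
  tape; afterwards each state executes the instruction at its address.\<close>

definition machine :: "nat \<Rightarrow> code list \<Rightarrow> tm" where
  "machine n cs = \<lparr>num_tapes = n, num_states = length cs + 2, num_syms = 3, delta = (\<lambda>q ss.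
     let idle = map (\<lambda>j. (ss ! j, 0)) [0..<n] in
     if q = 0 then (addr (length cs) 0, map (\<lambda>j. (if j < 2 then ss ! j else 1, 0)) [0..<n])
     else if q = 1 then (1, idle)
     else (case cs ! (q - 2) of
         Op i \<Rightarrow> (addr (length cs) (q - 1), map (tape_act ss i) [0..<n])
       | Jump a \<Rightarrow> (addr (length cs) a, idle)
       | Branch b a \<Rightarrow> (addr (length cs) (if syms_test ss b then q - 1 else a), idle)))\<rparr>"

fun store_tape :: "bool list \<Rightarrow> store \<Rightarrow> nat \<Rightarrow> tape" where
  "store_tape x (\<rho>, p, w) j =
     (if j = 0 then (fst (input_tape x), p)
      else if j = 1 then (fst (input_tape w), int (length w))
      else ((\<lambda>i. if i = 0 then 1 else 0), int (\<rho> (j - 2))))"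

definition conf :: "nat \<Rightarrow> nat \<Rightarrow> bool list \<Rightarrow> nat \<Rightarrow> store \<Rightarrow> config" where
  "conf n len x a s = (addr len a, map (store_tape x s) [0..<n])"

lemma tape_act_range:
  assumes "set ss \<subseteq> {..<3}" "length ss = n" "j < n"
  shows "tape_act ss i j \<in> {..<3} \<times> {- 1, 0, 1}"
proof -
  have "ss ! j < 3" using assms nth_mem by fastforce
  then show ?thesis by (cases i) (auto simp: bit_sym_def)
qed

lemma wf_machine:
  assumes "\<forall>i \<in> set cs. code_ok (length cs) i"
  shows "wf_tm (machine n cs)"
proof -
  have *: "case delta (machine n cs) q ss of (q', acts) \<Rightarrow>
      q' < length cs + 2 \<and> length acts = n \<and> set acts \<subseteq> {..<3} \<times> {- 1, 0, 1}"
    if q: "q < length cs + 2" and ss: "length ss = n" "set ss \<subseteq> {..<3}" for q ss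
  proof -
    have lt: "ss ! j < 3" if "j < n" for j using ss that nth_mem by fastforce
    have a: "addr (length cs) a < length cs + 2" for a by (auto simp: addr_def)
    have t: "tape_act ss i ` {0..<n} \<subseteq> {..<3} \<times> {- 1, 0, 1}" for i
      using tape_act_range[OF ss(2,1)] by (auto simp only: image_subset_iff atLeastLessThan_iff)
    show ?thesis using a t lt
      by (auto simp: machine_def Let_def split: code.splits)
  qed
  show ?thesis unfolding wf_tm_def using * by (auto simp: machine_def)
qed

lemma map2_map_upt: "map2 f (map g [0..<n]) (map h [0..<n]) = map (\<lambda>j. f (g j) (h j)) [0..<n]"
  by (simp add: map2_map_map)

lemma syms_test_scan:
  assumes "\<forall>r \<in> test_regs b. r + 2 < n" "0 < n"
  shows "syms_test (map scan (map (store_tape x s) [0..<n])) b = holds x b s"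
  using assms
proof (induction b)
  case (Zero r)
  obtain \<rho> p w where "s = (\<rho>, p, w)" by (cases s)
  with Zero show ?case by (simp add: scan_def)
next
  case (Scans a)
  obtain \<rho> p w where "s = (\<rho>, p, w)" by (cases s)
  with Scans show ?case by (simp add: scan_def)
qed auto

lemma act_idle: "act (scan t, 0) t = t"
  by (simp add: act_def scan_def)

text \<open>A decrement at zero agrees with truncated subtraction because the head does not leave
  the marker. The output head always stands on the blank behind the output, so writing there appends
  a bit.\<close>

lemma act_store_tape:
  assumes "\<forall>r \<in> instr_regs i. r + 2 < n" "2 \<le> n" "j < n"
  shows "act (tape_act (map scan (map (store_tape x s) [0..<n])) i j) (store_tape x s j)
    = store_tape x (perform x i s) j"
proof -
  obtain \<rho> p w where s: "s = (\<rho>, p, w)" by (cases s)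
  have nth: "map scan (map (store_tape x s) [0..<n]) ! j = scan (store_tape x s j)"
    using assms(3) by simp
  show ?thesis
  proof (cases i)
    case (Inc b r)
    have "syms_test (map scan (map (store_tape x s) [0..<n])) b = holds x b s"
      using assms Inc by (intro syms_test_scan) auto
    then show ?thesis using nth unfolding Inc
      by (auto simp: s act_def scan_def simp del: map_map)
  next
    case (Dec r)
    show ?thesis using nth unfolding Dec
      by (auto simp: s act_def scan_def simp del: map_map)
  next
    case (Emit b)
    have "syms_test (map scan (map (store_tape x s) [0..<n])) b = holds x b s"
      using assms Emit by (intro syms_test_scan) auto
    moreover have "(fst (input_tape w))(int (length w) := bit_sym c) = fst (input_tape (w @ [c]))"
      for c by (auto simp: input_tape_def fun_eq_iff nth_append nat_less_iff)
    ultimately show ?thesis using nth unfolding Emit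
      by (auto simp: s act_def scan_def simp del: map_map)
  next
    case InR
    show ?thesis using nth unfolding InR by (auto simp: s act_def scan_def simp del: map_map)
  next
    case InL
    show ?thesis using nth unfolding InL by (auto simp: s act_def scan_def simp del: map_map)
  qed
qed

lemma step_Op:
  assumes "2 \<le> n" "a < length cs" "cs ! a = Op i" "\<forall>r \<in> instr_regs i. r + 2 < n"
  shows "tm_step (machine n cs) (conf n (length cs) x a s) = conf n (length cs) x (a + 1) (perform x i s)"
proof -
  let ?ts = "map (store_tape x s) [0..<n]"
  have "map2 act (map (tape_act (map scan ?ts) i) [0..<n]) ?ts
      = map (store_tape x (perform x i s)) [0..<n]"
    unfolding map2_map_upt using act_store_tape[OF assms(4,1)]
    by (simp del: map_map)
  then show ?thesis using assms
    by (simp add: tm_step_def conf_def addr_def machine_def Let_def del: map_map)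
qed

lemma map2_act_idle:
  "map2 act (map (\<lambda>j. (map scan (map h [0..<n]) ! j, 0)) [0..<n]) (map h [0..<n]) = map h [0..<n]"
  unfolding map2_map_upt by (simp add: act_idle)

lemma step_Jump:
  assumes "a < length cs" "cs ! a = Jump b"
  shows "tm_step (machine n cs) (conf n (length cs) x a s) = conf n (length cs) x b s"
  using assms map2_act_idle[of "store_tape x s" n]
  by (simp add: tm_step_def conf_def addr_def machine_def Let_def del: map_map)

lemma step_Branch:
  assumes "2 \<le> n" "a < length cs" "cs ! a = Branch b d" "\<forall>r \<in> test_regs b. r + 2 < n"
  shows "tm_step (machine n cs) (conf n (length cs) x a s)
    = conf n (length cs) x (if holds x b s then a + 1 else d) s"
  using assms map2_act_idle[of "store_tape x s" n] syms_test_scan[of b n x s]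
  by (simp add: tm_step_def conf_def addr_def machine_def Let_def del: map_map)

text \<open>Induction over the execution with the code in an arbitrary context \<open>pre\<close>,
  \<open>post\<close>: the body of a loop or one half of a sequence is then again a compiled command
  in a larger context.\<close>

lemma exec_machine:
  assumes "exec x c s s' t" "cs = pre @ compile c (length pre) @ post"
    "\<forall>r \<in> regs c. r + 2 < n" "2 \<le> n"
  shows "(tm_step (machine n cs) ^^ t) (conf n (length cs) x (length pre) s)
    = conf n (length cs) x (length pre + code_size c) s'"
  using assms
proof (induction arbitrary: pre post rule: exec.induct)
  case (exec_Skip s)
  then show ?case by simp
next
  case (exec_Do a s)
  then show ?case using step_Op[of n "length pre" cs a x s] by simp
next
  case (exec_Seq c s s' t d s'' u)
  have 1: "(tm_step (machine n cs) ^^ t) (conf n (length cs) x (length pre) s)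
    = conf n (length cs) x (length pre + code_size c) s'"
    using exec_Seq.prems by (intro exec_Seq.IH(1)[where post="compile d (length pre + code_size c) @ post"]) auto
  have 2: "(tm_step (machine n cs) ^^ u) (conf n (length cs) x (length (pre @ compile c (length pre))) s')
    = conf n (length cs) x (length (pre @ compile c (length pre)) + code_size d) s''"
    using exec_Seq.prems by (intro exec_Seq.IH(2)[where post=post]) auto
  show ?case using 1 2 by (subst add.commute) (simp add: funpow_add add.assoc)
next
  case (exec_WhileF b s c)
  then show ?case using step_Branch[of n "length pre" cs b "length pre + code_size c + 2" x s]
    by (simp add: add.assoc)
next
  case (exec_WhileT b s c s' t s'' u)
  let ?M = "machine n cs" and ?len = "length cs"
  have len: "length pre + code_size c + 2 \<le> ?len" using exec_WhileT.prems by simp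
  have a: "tm_step ?M (conf n ?len x (length pre) s) = conf n ?len x (length pre + 1) s"
    using exec_WhileT.prems exec_WhileT.hyps len by (subst step_Branch) auto
  have b: "(tm_step ?M ^^ t) (conf n ?len x (length (pre @ [Branch b (length pre + code_size c + 2)])) s)
    = conf n ?len x (length (pre @ [Branch b (length pre + code_size c + 2)]) + code_size c) s'"
    using exec_WhileT.prems by (intro exec_WhileT.IH(1)[where post="Jump (length pre) # post"]) auto
  have "cs = (pre @ Branch b (length pre + code_size c + 2) # compile c (length pre + 1))
      @ Jump (length pre) # post" using exec_WhileT.prems by simp
  then have "cs ! length (pre @ Branch b (length pre + code_size c + 2) # compile c (length pre + 1))
      = Jump (length pre)" by (simp only: nth_append_length)
  then have nth: "cs ! (length pre + 1 + code_size c) = Jump (length pre)" by simp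
  have c: "tm_step ?M (conf n ?len x (length pre + 1 + code_size c) s') = conf n ?len x (length pre) s'"
    using nth len by (subst step_Jump) auto
  have d: "(tm_step ?M ^^ u) (conf n ?len x (length pre) s')
    = conf n ?len x (length pre + code_size (While b c)) s''"
    using exec_WhileT.prems by (intro exec_WhileT.IH(2)) auto
  have "(tm_step ?M ^^ (u + (1 + (t + 1)))) (conf n ?len x (length pre) s)
    = (tm_step ?M ^^ u) (tm_step ?M ((tm_step ?M ^^ t) (tm_step ?M (conf n ?len x (length pre) s))))"
    by (simp only: funpow_add comp_apply) simp
  also have "\<dots> = conf n ?len x (length pre + code_size (While b c)) s''"
    using a b c d by simp
  finally show ?case by (simp add: ac_simps)
qed

lemma halted_funpow: "fst c = 1 \<Longrightarrow> (tm_step M ^^ t) c = c"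
  by (induction t) (auto simp: tm_step_def split: prod.splits)

lemma holds_string_input_tape: "holds_string (fst (input_tape y), p) y"
  by (simp add: holds_string_def input_tape_def)

text \<open>The machine needs one step more than the program, for the markers; the time left over is
  spent in the absorbing halting state.\<close>

lemma polytime_of_exec:
  fixes p :: "nat poly"
  assumes "\<And>x. \<exists>\<rho> q t. exec x c (\<lambda>_. 0, 0, []) (\<rho>, q, f x) t \<and> t \<le> poly p (length x)"
  shows "polytime 1 (\<lambda>xs. f (xs ! 0))"
proof -
  let ?cs = "compile c 0"
  \<comment> \<open>Register r lives on tape r + 2, so the largest register needs this many tapes;
    the inserted 0 guarantees the output tape 1 even for a program without registers.\<close>
  define n where "n = Max (insert 0 (regs c)) + 3"
  have n: "2 \<le> n" "\<forall>r \<in> regs c. r + 2 < n"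
  proof -
    show "2 \<le> n" by (simp add: n_def)
    have "r \<le> Max (insert 0 (regs c))" if "r \<in> regs c" for r using that by (intro Max_ge) auto
    then have "r + 2 < n" if "r \<in> regs c" for r using that by (fastforce simp: n_def less_Suc_eq_le)
    then show "\<forall>r \<in> regs c. r + 2 < n" by blast
  qed
  let ?M = "machine n ?cs"
  have wf: "wf_tm ?M" by (rule wf_machine) (use code_ok_compile[of 0 c] in simp)
  have run: "computes_within ?M [x] (f x) (poly (p + 1) (length x))" for x
  proof -
    obtain \<rho> q t where e: "exec x c (\<lambda>_. 0, 0, []) (\<rho>, q, f x) t" and t: "t \<le> poly p (length x)"
      using assms by blast
    have ts: "snd (tm_init ?M [x]) = map (\<lambda>j. if j = 0 then input_tape x else input_tape []) [0..<n]"
      using n(1) by (intro nth_equalityI) (auto simp: tm_init_def machine_def nth_Cons' )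
    have init: "tm_step ?M (tm_init ?M [x]) = conf n (length ?cs) x 0 (\<lambda>_. 0, 0, [])"
    proof -
      have "tm_init ?M [x] = (0, map (\<lambda>j. if j = 0 then input_tape x else input_tape []) [0..<n])"
        using ts by (simp add: tm_init_def)
      then have "tm_step ?M (tm_init ?M [x]) = (addr (length ?cs) 0,
         map (\<lambda>j. act (if j < 2 then map scan (map (\<lambda>j. if j = 0 then input_tape x else input_tape []) [0..<n]) ! j else 1, 0)
               (if j = 0 then input_tape x else input_tape [])) [0..<n])"
        by (simp add: tm_step_def machine_def Let_def map2_map_upt del: map_map)
      also have "\<dots> = conf n (length ?cs) x 0 (\<lambda>_. 0, 0, [])"
        by (auto simp: conf_def act_def scan_def input_tape_def fun_eq_iff)
      finally show ?thesis .
    qed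
    have "(tm_step ?M ^^ t) (conf n (length ?cs) x 0 (\<lambda>_. 0, 0, []))
        = conf n (length ?cs) x (code_size c) (\<rho>, q, f x)"
      using exec_machine[OF e, of ?cs "[]" "[]" n] n by simp
    then have fin: "(tm_step ?M ^^ (Suc t)) (tm_init ?M [x]) = conf n (length ?cs) x (code_size c) (\<rho>, q, f x)"
      using init by (simp add: funpow_swap1)
    have "poly (p + 1) (length x) = (poly p (length x) - t) + Suc t" using t by simp
    then have "(tm_step ?M ^^ (poly (p + 1) (length x))) (tm_init ?M [x])
        = (tm_step ?M ^^ (poly p (length x) - t)) ((tm_step ?M ^^ (Suc t)) (tm_init ?M [x]))"
      by (simp only: funpow_add comp_apply)
    also have "\<dots> = conf n (length ?cs) x (code_size c) (\<rho>, q, f x)"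
      unfolding fin by (rule halted_funpow) (simp add: conf_def addr_def)
    finally show ?thesis using n(1)
      by (simp add: computes_within_def conf_def addr_def holds_string_input_tape)
  qed
  show ?thesis unfolding polytime_def
  proof (intro exI conjI allI impI)
    show "wf_tm ?M" by (rule wf)
    show "1 < num_tapes ?M" using n by (simp add: machine_def)
    fix xs :: "bool list list" assume "length xs = 1"
    then obtain x where "xs = [x]" by (cases xs) auto
    then show "computes_within ?M xs (f (xs ! 0)) (poly (p + 1) (sum_list (map length xs)))"
      using run by simp
  qed
qed

section \<open>Arithmetic expressions and generators of number lists\<close>

text \<open>An upper bound in place of the exact step count, so that rounds of a loop with different
  costs can share one estimate.\<close>

definition runs :: "bool list \<Rightarrow> com \<Rightarrow> store \<Rightarrow> store \<Rightarrow> nat \<Rightarrow> bool" where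
  "runs x c s s' T \<longleftrightarrow> (\<exists>t \<le> T. exec x c s s' t)"

lemma runs_mono: "runs x c s s' T \<Longrightarrow> T \<le> U \<Longrightarrow> runs x c s s' U"
  unfolding runs_def by (meson le_trans)

lemma runs_Skip: "runs x Skip s s 0"
  unfolding runs_def using exec_Skip by blast

lemma runs_Do: "runs x (Do i) s (perform x i s) 1"
  unfolding runs_def using exec_Do by blast

lemma runs_Seq: "runs x c s s' T \<Longrightarrow> runs x d s' s'' U \<Longrightarrow> runs x (c ;; d) s s'' (T + U)"
  unfolding runs_def by (meson add_mono exec_Seq)

lemma runs_WhileF: "\<not> holds x b s \<Longrightarrow> runs x (While b c) s s 1"
  unfolding runs_def using exec_WhileF by blast

lemma runs_WhileT:
  assumes "holds x b s" "runs x c s s' T" "runs x (While b c) s' s'' U"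
  shows "runs x (While b c) s s'' (T + U + 2)"
proof -
  from assms obtain t u where "t \<le> T" "u \<le> U" "exec x c s s' t" "exec x (While b c) s' s'' u"
    by (auto simp: runs_def)
  then have "exec x (While b c) s s'' (t + u + 2)" "t + u + 2 \<le> T + U + 2"
    using exec_WhileT[OF assms(1)] by auto
  then show ?thesis unfolding runs_def by blast
qed

lemma runs_loop:
  assumes "\<And>i. i < n \<Longrightarrow> holds x b (S i) \<and> runs x c (S i) (S (Suc i)) T" "\<not> holds x b (S n)"
  shows "runs x (While b c) (S 0) (S n) (n * (T + 2) + 1)"
  using assms
proof (induction n arbitrary: S)
  case 0
  then show ?case using runs_WhileF by simp
next
  case (Suc n)
  have "runs x (While b c) (S (Suc 0)) (S (Suc n)) (n * (T + 2) + 1)"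
    using Suc.IH[of "\<lambda>i. S (Suc i)"] Suc.prems by simp
  moreover have "holds x b (S 0)" "runs x c (S 0) (S (Suc 0)) T" using Suc.prems(1)[of 0] by auto
  ultimately have "runs x (While b c) (S 0) (S (Suc n)) (T + (n * (T + 2) + 1) + 2)"
    using runs_WhileT by blast
  then show ?case by (rule runs_mono) simp
qed

definition block :: "instr list \<Rightarrow> com" where
  "block is = foldr (\<lambda>i c. Do i ;; c) is Skip"

lemma runs_block: "runs x (block is) s (fold (perform x) is s) (length is)"
proof (induction "is" arbitrary: s)
  case Nil
  then show ?case by (simp add: block_def runs_Skip)
next
  case (Cons i "is")
  then show ?case using runs_Seq[OF runs_Do[of x i s]] by (fastforce simp: block_def)
qed

text \<open>Loops are verified by giving the whole trajectory: \<open>S i\<close> is the store after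
  i rounds. Start, end and time are separate equations so that each can be discharged by
  simplification.\<close>

lemma runs_block_loop:
  assumes "s = S 0" "s' = S n" "T = n * (length is + 2) + 1"
    and "\<And>i. i < n \<Longrightarrow> holds x b (S i) \<and> fold (perform x) is (S i) = S (Suc i)" "\<not> holds x b (S n)"
  shows "runs x (While b (block is)) s s' T"
  unfolding assms(1-3) by (rule runs_loop) (use assms(4,5) runs_block in metis)+

datatype expr = Const nat | Var nat | Add expr expr | Mul expr expr | Sub expr expr | In expr | Len

primrec eval :: "bool list \<Rightarrow> (nat \<Rightarrow> nat) \<Rightarrow> expr \<Rightarrow> nat" where
  "eval x \<rho> (Const n) = n"
| "eval x \<rho> (Var v) = \<rho> v"
| "eval x \<rho> (Add e f) = eval x \<rho> e + eval x \<rho> f"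
| "eval x \<rho> (Mul e f) = eval x \<rho> e * eval x \<rho> f"
| "eval x \<rho> (Sub e f) = eval x \<rho> e - eval x \<rho> f"
| "eval x \<rho> (In e) = fst (input_tape x) (int (eval x \<rho> e))"
| "eval x \<rho> Len = length x"

primrec vars :: "expr \<Rightarrow> nat set" where
  "vars (Const n) = {}"
| "vars (Var v) = {v}"
| "vars (Add e f) = vars e \<union> vars f"
| "vars (Mul e f) = vars e \<union> vars f"
| "vars (Sub e f) = vars e \<union> vars f"
| "vars (In e) = vars e"
| "vars Len = {}"

text \<open>Adds the value of an expression to register r; the registers from d on are scratch.\<close>

primrec addto :: "expr \<Rightarrow> nat \<Rightarrow> nat \<Rightarrow> com" where
  "addto (Const n) r d = block (replicate n (Inc Always r))"
| "addto (Var v) r d =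
     While (Neg (Zero v)) (block [Dec v, Inc Always r, Inc Always d]) ;;
     While (Neg (Zero d)) (block [Dec d, Inc Always v])"
| "addto (Add e f) r d = addto e r d ;; addto f r d"
| "addto (Mul e f) r d =
     addto e d (Suc d) ;; While (Neg (Zero d)) (Do (Dec d) ;; addto f r (Suc d))"
| "addto (Sub e f) r d =
     addto e d (d + 2) ;; addto f (Suc d) (d + 2) ;;
     While (Neg (Zero (Suc d))) (block [Dec (Suc d), Dec d]) ;;
     While (Neg (Zero d)) (block [Dec d, Inc Always r])"
| "addto (In e) r d =
     addto e d (d + 2) ;;
     While (Neg (Zero d)) (block [Dec d, Inc Always (Suc d), InR]) ;;
     block [Inc (Scans 1) r, Inc (Scans 2) r, Inc (Scans 2) r] ;;
     While (Neg (Zero (Suc d))) (block [Dec (Suc d), InL])"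
| "addto Len r d =
     While (Neg (Scans 0)) (block [InR, Inc Always d, Inc Always r]) ;;
     While (Neg (Zero d)) (block [Dec d, InL])"

primrec value_bound :: "expr \<Rightarrow> nat poly" where
  "value_bound (Const n) = [:n:]"
| "value_bound (Var v) = [:0, 1:]"
| "value_bound (Add e f) = value_bound e + value_bound f"
| "value_bound (Mul e f) = value_bound e * value_bound f"
| "value_bound (Sub e f) = value_bound e"
| "value_bound (In e) = [:2:]"
| "value_bound Len = [:0, 1:]"

text \<open>A loop of n rounds over a block of l instructions costs n * (l + 2) + 1 steps. Copying a
  variable takes two loops with blocks of lengths 3 and 2, whence 5 + 4 = 9 per unit and 2 for the
  failing tests; the other coefficients arise in the same way.\<close>

primrec time_bound :: "expr \<Rightarrow> nat poly" where
  "time_bound (Const n) = [:n:]"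
| "time_bound (Var v) = [:2, 9:]"
| "time_bound (Add e f) = time_bound e + time_bound f"
| "time_bound (Mul e f) = time_bound e + value_bound e * (time_bound f + [:3:]) + [:1:]"
| "time_bound (Sub e f) = time_bound e + time_bound f + smult 4 (value_bound e + value_bound f) + [:2:]"
| "time_bound (In e) = time_bound e + smult 9 (value_bound e) + [:5:]"
| "time_bound Len = [:2, 9:]"

section \<open>Correctness and running time of the evaluation of expressions\<close>

lemma eval_cong: "(\<And>v. v \<in> vars e \<Longrightarrow> \<rho> v = \<rho>' v) \<Longrightarrow> eval x \<rho> e = eval x \<rho>' e"
  by (induction e) auto

lemma input_tape_le_2: "fst (input_tape x) p \<le> 2"
  by (simp add: input_tape_def bit_sym_def)

lemma eval_le_value_bound:
  assumes "\<forall>v \<in> vars e. \<rho> v \<le> M" "length x \<le> M"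
  shows "eval x \<rho> e \<le> poly (value_bound e) M"
  using assms by (induction e) (auto intro: add_mono mult_mono input_tape_le_2 simp: le_diff_conv trans_le_add1)

lemma fold_Inc: "fold (perform x) (replicate n (Inc Always r)) (\<rho>, p, w) = (\<rho>(r := \<rho> r + n), p, w)"
  by (induction n arbitrary: \<rho>) auto

text \<open>The invariant that makes the programs compose: scratch registers are zero and the input
  head is on cell 0, before and after. The target must not occur in the expression, because it
  already changes while the expression is being evaluated.\<close>

lemma runs_addto:
  assumes "\<forall>i \<ge> d. \<rho> i = 0" "r < d" "vars e \<subseteq> {..<d} - {r}" "\<forall>v \<in> vars e. \<rho> v \<le> M" "length x \<le> M"
  shows "runs x (addto e r d) (\<rho>, 0, w) (\<rho>(r := \<rho> r + eval x \<rho> e), 0, w) (poly (time_bound e) M)"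
  using assms
proof (induction e arbitrary: \<rho> r d)
  case (Const n)
  show ?case using runs_block[of x "replicate n (Inc Always r)" "(\<rho>, 0, w)"]
    by (simp only: fold_Inc length_replicate addto.simps eval.simps time_bound.simps poly_pCons poly_0 mult_zero_right add_0_right)
next
  case (Var v)
  let ?\<rho> = "\<rho>(v := 0, r := \<rho> r + \<rho> v, d := \<rho> v)"
  have 1: "runs x (While (Neg (Zero v)) (block [Dec v, Inc Always r, Inc Always d])) (\<rho>, 0, w) (?\<rho>, 0, w)
      (5 * \<rho> v + 1)"
    by (rule runs_block_loop[where n = "\<rho> v" and S = "\<lambda>i. (\<rho>(v := \<rho> v - i, r := \<rho> r + i, d := i), 0, w)"])
       (use Var.prems in \<open>auto simp: fun_eq_iff\<close>)
  have 2: "runs x (While (Neg (Zero d)) (block [Dec d, Inc Always v])) (?\<rho>, 0, w)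
      (\<rho>(r := \<rho> r + \<rho> v), 0, w) (4 * \<rho> v + 1)"
    by (rule runs_block_loop[where n = "\<rho> v" and S = "\<lambda>i. (\<rho>(v := i, r := \<rho> r + \<rho> v, d := \<rho> v - i), 0, w)"])
       (use Var.prems in \<open>auto simp: fun_eq_iff\<close>)
  have "\<rho> v \<le> M" using Var.prems by auto
  then show ?case unfolding addto.simps eval.simps by (intro runs_mono[OF runs_Seq[OF 1 2]]) simp
next
  case (Add e f)
  let ?\<rho> = "\<rho>(r := \<rho> r + eval x \<rho> e)"
  have 1: "runs x (addto e r d) (\<rho>, 0, w) (?\<rho>, 0, w) (poly (time_bound e) M)"
    using Add.prems by (intro Add.IH(1)) auto
  have 2: "runs x (addto f r d) (?\<rho>, 0, w) (?\<rho>(r := ?\<rho> r + eval x ?\<rho> f), 0, w) (poly (time_bound f) M)"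
    using Add.prems by (intro Add.IH(2)) auto
  have "eval x ?\<rho> f = eval x \<rho> f" using Add.prems by (intro eval_cong) auto
  then have "?\<rho>(r := ?\<rho> r + eval x ?\<rho> f) = \<rho>(r := \<rho> r + eval x \<rho> (Add e f))" by (simp add: add.assoc)
  with 2 have 3: "runs x (addto f r d) (?\<rho>, 0, w) (\<rho>(r := \<rho> r + eval x \<rho> (Add e f)), 0, w)
      (poly (time_bound f) M)" by metis
  show ?case unfolding addto.simps time_bound.simps poly_add by (rule runs_Seq[OF 1 3])
next
  case (Mul e f)
  let ?m = "eval x \<rho> e" and ?n = "eval x \<rho> f"
  define S where "S = (\<lambda>i. (\<rho>(d := ?m - i, r := \<rho> r + i * ?n), 0::int, w))"
  have "runs x (addto e d (Suc d)) (\<rho>, 0, w) (\<rho>(d := \<rho> d + ?m), 0, w) (poly (time_bound e) M)"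
    by (rule Mul.IH(1)) (use Mul.prems in auto)
  moreover have "(\<rho>(d := \<rho> d + ?m), 0, w) = S 0" using Mul.prems by (auto simp: S_def)
  ultimately have 1: "runs x (addto e d (Suc d)) (\<rho>, 0, w) (S 0) (poly (time_bound e) M)" by metis
  have 2: "runs x (While (Neg (Zero d)) (Do (Dec d) ;; addto f r (Suc d))) (S 0) (S ?m)
      (?m * ((1 + poly (time_bound f) M) + 2) + 1)"
  proof (rule runs_loop)
    fix i assume i: "i < ?m"
    let ?\<rho> = "\<rho>(d := ?m - Suc i, r := \<rho> r + i * ?n)"
    have "runs x (Do (Dec d)) (S i) (perform x (Dec d) (S i)) 1" by (rule runs_Do)
    moreover have "perform x (Dec d) (S i) = (?\<rho>, 0, w)"
      using Mul.prems by (auto simp: S_def fun_eq_iff)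
    moreover have "runs x (addto f r (Suc d)) (?\<rho>, 0, w) (?\<rho>(r := ?\<rho> r + eval x ?\<rho> f), 0, w) (poly (time_bound f) M)"
      using Mul.prems by (intro Mul.IH(2)) auto
    moreover have "eval x ?\<rho> f = ?n" using Mul.prems by (intro eval_cong) auto
    moreover have "(?\<rho>(r := ?\<rho> r + ?n), 0, w) = S (Suc i)"
      using Mul.prems by (auto simp: S_def fun_eq_iff)
    ultimately have "runs x (Do (Dec d) ;; addto f r (Suc d)) (S i) (S (Suc i)) (1 + poly (time_bound f) M)"
      by (metis runs_Seq)
    then show "holds x (Neg (Zero d)) (S i) \<and>
        runs x (Do (Dec d) ;; addto f r (Suc d)) (S i) (S (Suc i)) (1 + poly (time_bound f) M)"
      using i Mul.prems by (simp add: S_def)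
  next
    show "\<not> holds x (Neg (Zero d)) (S ?m)" using Mul.prems by (simp add: S_def)
  qed
  have fin: "S ?m = (\<rho>(r := \<rho> r + eval x \<rho> (Mul e f)), 0, w)"
    using Mul.prems by (auto simp: S_def fun_eq_iff)
  have "?m \<le> poly (value_bound e) M" using Mul.prems by (intro eval_le_value_bound) auto
  then have "?m * (poly (time_bound f) M + 3) \<le> poly (value_bound e) M * (poly (time_bound f) M + 3)"
    by (rule mult_le_mono1)
  then have "poly (time_bound e) M + (?m * ((1 + poly (time_bound f) M) + 2) + 1) \<le> poly (time_bound (Mul e f)) M"
    by (simp add: algebra_simps)
  with runs_Seq[OF 1 2] show ?case unfolding fin addto.simps by (rule runs_mono)
next
  case (Sub e f)
  let ?m = "eval x \<rho> e" and ?n = "eval x \<rho> f"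
  let ?\<rho>1 = "\<rho>(d := ?m)"
  let ?\<rho>2 = "\<rho>(d := ?m, Suc d := ?n)"
  let ?\<rho>3 = "\<rho>(d := ?m - ?n)"
  have z: "\<rho> d = 0" "\<rho> (Suc d) = 0" using Sub.prems by auto
  have "runs x (addto e d (d + 2)) (\<rho>, 0, w) (\<rho>(d := \<rho> d + ?m), 0, w) (poly (time_bound e) M)"
    by (rule Sub.IH(1)) (use Sub.prems in auto)
  then have 1: "runs x (addto e d (d + 2)) (\<rho>, 0, w) (?\<rho>1, 0, w) (poly (time_bound e) M)"
    unfolding z add_0 .
  have ev: "eval x ?\<rho>1 f = ?n" "?\<rho>1 (Suc d) = 0" using Sub.prems by (auto intro!: eval_cong)
  have "runs x (addto f (Suc d) (d + 2)) (?\<rho>1, 0, w)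
      (?\<rho>1(Suc d := ?\<rho>1 (Suc d) + eval x ?\<rho>1 f), 0, w) (poly (time_bound f) M)"
    by (rule Sub.IH(2)) (use Sub.prems in auto)
  then have 2: "runs x (addto f (Suc d) (d + 2)) (?\<rho>1, 0, w) (?\<rho>2, 0, w) (poly (time_bound f) M)"
    unfolding ev add_0 .
  have 3: "runs x (While (Neg (Zero (Suc d))) (block [Dec (Suc d), Dec d])) (?\<rho>2, 0, w) (?\<rho>3, 0, w)
      (4 * ?n + 1)"
    by (rule runs_block_loop[where n = "?n" and S = "\<lambda>i. (\<rho>(d := ?m - i, Suc d := ?n - i), 0, w)"])
       (use z in \<open>auto simp: fun_eq_iff\<close>)
  have 4: "runs x (While (Neg (Zero d)) (block [Dec d, Inc Always r])) (?\<rho>3, 0, w)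
      (\<rho>(r := \<rho> r + (?m - ?n)), 0, w) (4 * (?m - ?n) + 1)"
    by (rule runs_block_loop[where n = "?m - ?n" and S = "\<lambda>i. (\<rho>(d := ?m - ?n - i, r := \<rho> r + i), 0, w)"])
       (use z Sub.prems in \<open>auto simp: fun_eq_iff\<close>)
  have "?m \<le> poly (value_bound e) M" "?n \<le> poly (value_bound f) M"
    using Sub.prems by (auto intro!: eval_le_value_bound)
  then show ?case unfolding addto.simps eval.simps
    by (intro runs_mono[OF runs_Seq[OF 1 runs_Seq[OF 2 runs_Seq[OF 3 4]]]]) simp
next
  case (In e)
  let ?n = "eval x \<rho> e"
  let ?a = "fst (input_tape x) (int ?n)"
  have z: "\<rho> d = 0" "\<rho> (Suc d) = 0" using In.prems by auto
  have "runs x (addto e d (d + 2)) (\<rho>, 0, w) (\<rho>(d := \<rho> d + ?n), 0, w) (poly (time_bound e) M)"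
    by (rule In.IH) (use In.prems in auto)
  then have 1: "runs x (addto e d (d + 2)) (\<rho>, 0, w) (\<rho>(d := ?n), 0, w) (poly (time_bound e) M)"
    unfolding z add_0 .
  have 2: "runs x (While (Neg (Zero d)) (block [Dec d, Inc Always (Suc d), InR])) (\<rho>(d := ?n), 0, w)
      (\<rho>(Suc d := ?n), int ?n, w) (5 * ?n + 1)"
    by (rule runs_block_loop[where n = "?n" and S = "\<lambda>i. (\<rho>(d := ?n - i, Suc d := i), int i, w)"])
       (use z in \<open>auto simp: fun_eq_iff\<close>)
  have "fold (perform x) [Inc (Scans 1) r, Inc (Scans 2) r, Inc (Scans 2) r] (\<rho>(Suc d := ?n), int ?n, w)
      = (\<rho>(Suc d := ?n, r := \<rho> r + ?a), int ?n, w)"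
    using input_tape_le_2[of x "int ?n"] In.prems by (auto simp: fun_eq_iff)
  then have 3: "runs x (block [Inc (Scans 1) r, Inc (Scans 2) r, Inc (Scans 2) r])
      (\<rho>(Suc d := ?n), int ?n, w) (\<rho>(Suc d := ?n, r := \<rho> r + ?a), int ?n, w)
      (length [Inc (Scans 1) r, Inc (Scans 2) r, Inc (Scans 2) r])"
    by (metis runs_block)
  have 4: "runs x (While (Neg (Zero (Suc d))) (block [Dec (Suc d), InL]))
      (\<rho>(Suc d := ?n, r := \<rho> r + ?a), int ?n, w) (\<rho>(r := \<rho> r + ?a), 0, w)
      (4 * ?n + 1)"
    by (rule runs_block_loop[where n = "?n" and S = "\<lambda>i. (\<rho>(Suc d := ?n - i, r := \<rho> r + ?a), int ?n - int i, w)"])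
       (use z In.prems in \<open>auto simp: fun_eq_iff\<close>)
  have "?n \<le> poly (value_bound e) M"
    using In.prems by (auto intro!: eval_le_value_bound)
  then show ?case unfolding addto.simps eval.simps
    by (intro runs_mono[OF runs_Seq[OF 1 runs_Seq[OF 2 runs_Seq[OF 3 4]]]]) simp
next
  case Len
  let ?n = "length x"
  have z: "\<rho> d = 0" using Len.prems by auto
  \<comment> \<open>Bits are represented by the symbols 1 and 2, so the first blank is in cell
    \<open>length x\<close>.\<close>
  have 1: "runs x (While (Neg (Scans 0)) (block [InR, Inc Always d, Inc Always r])) (\<rho>, 0, w)
      (\<rho>(r := \<rho> r + ?n, d := ?n), int ?n, w) (5 * ?n + 1)"
    by (rule runs_block_loop[where n = "?n" and S = "\<lambda>i. (\<rho>(r := \<rho> r + i, d := i), int i, w)"])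
       (use z Len.prems in \<open>auto simp: fun_eq_iff input_tape_def bit_sym_def\<close>)
  have 2: "runs x (While (Neg (Zero d)) (block [Dec d, InL])) (\<rho>(r := \<rho> r + ?n, d := ?n), int ?n, w)
      (\<rho>(r := \<rho> r + ?n), 0, w) (4 * ?n + 1)"
    by (rule runs_block_loop[where n = "?n" and S = "\<lambda>i. (\<rho>(r := \<rho> r + ?n, d := ?n - i), int ?n - int i, w)"])
       (use z Len.prems in \<open>auto simp: fun_eq_iff\<close>)
  show ?case unfolding addto.simps eval.simps
    by (intro runs_mono[OF runs_Seq[OF 1 2]]) (use Len.prems in simp)
qed

text \<open>The loop variable of For is register d, and register d + 1 counts the remaining iterations.\<close>

datatype gen = Empty | Num expr | Append gen gen | For expr gen

text \<open>Here d is the first free register. The environment of the body also contains the counter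
  of remaining rounds, so that it is literally the register content at that point of the
  program.\<close>

primrec nums :: "gen \<Rightarrow> bool list \<Rightarrow> nat \<Rightarrow> (nat \<Rightarrow> nat) \<Rightarrow> nat list" where
  "nums Empty x d \<rho> = []"
| "nums (Num e) x d \<rho> = [eval x \<rho> e]"
| "nums (Append g h) x d \<rho> = nums g x d \<rho> @ nums h x d \<rho>"
| "nums (For e g) x d \<rho> =
     concat (map (\<lambda>i. nums g x (d + 2) (\<rho>(d := i, Suc d := eval x \<rho> e - Suc i))) [0..<eval x \<rho> e])"

primrec scoped :: "nat \<Rightarrow> gen \<Rightarrow> bool" where
  "scoped d Empty = True"
| "scoped d (Num e) = (vars e \<subseteq> {..<d})"
| "scoped d (Append g h) = (scoped d g \<and> scoped d h)"
| "scoped d (For e g) = (vars e \<subseteq> {..<d} \<and> scoped (d + 2) g)"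

text \<open>One round removes 2 from register d. If d vanishes already after the first decrement,
  the number was odd and register d + 2 is set; otherwise the quotient in d + 1 grows. The second
  decrement is harmless at zero.\<close>

definition halve :: "nat \<Rightarrow> instr list" where
  "halve d = [Dec d, Inc (Zero d) (d + 2), Inc (Neg (Zero d)) (Suc d), Dec d]"

definition emit_digit :: "nat \<Rightarrow> com" where
  "emit_digit d = Do (Emit Always) ;; While (Neg (Zero d)) (block (halve d)) ;;
     block [Emit (Neg (Zero (d + 2))), Dec (d + 2)] ;;
     While (Neg (Zero (Suc d))) (block [Dec (Suc d), Inc Always d])"

definition emit_num :: "nat \<Rightarrow> com" where
  "emit_num d = While (Neg (Zero d)) (emit_digit d) ;; Do (Emit (Neg Always))"

primrec gen_com :: "gen \<Rightarrow> nat \<Rightarrow> com" where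
  "gen_com Empty d = Skip"
| "gen_com (Num e) d = addto e d (Suc d) ;; emit_num d"
| "gen_com (Append g h) d = gen_com g d ;; gen_com h d"
| "gen_com (For e g) d =
     addto e (Suc d) (d + 2) ;;
     While (Neg (Zero (Suc d))) (Do (Dec (Suc d)) ;; gen_com g (d + 2) ;; Do (Inc Always d)) ;;
     While (Neg (Zero d)) (block [Dec d])"

text \<open>Inside a loop the registers are bounded by the old bound plus the number of rounds,
  hence the composition of polynomials. The 7 per round consists of 4 for the loop itself and 3 for
  resetting the loop variable.\<close>

primrec gen_time :: "gen \<Rightarrow> nat poly" where
  "gen_time Empty = 0"
| "gen_time (Num e) = time_bound e + value_bound e * (smult 10 (value_bound e) + [:7:]) + [:2:]"
| "gen_time (Append g h) = gen_time g + gen_time h"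
| "gen_time (For e g) = time_bound e
     + value_bound e * (pcompose (gen_time g) ([:0, 1:] + value_bound e) + [:7:]) + [:2:]"

text \<open>Each digit costs at most 10 * n + 7 steps including its loop test, and n crudely bounds
  the number of digits, since n div 2 < n.\<close>

lemma emit_loop:
  assumes "\<forall>i > d. \<rho> i = 0"
  shows "runs x (While (Neg (Zero d)) (emit_digit d))
     (\<rho>(d := n), p, w) (\<rho>(d := 0), p, w @ concat (map (\<lambda>b. [True, b]) (binary n)))
     (n * (10 * n + 7) + 1)"
proof (induction n arbitrary: w rule: less_induct)
  case (less n)
  show ?case
  proof (cases "n = 0")
    case True
    have "runs x (While (Neg (Zero d)) c) (\<rho>(d := 0), p, w) (\<rho>(d := 0), p, w) 1" for c
      by (rule runs_WhileF) simp
    then show ?thesis using True by (simp only: binary_0 list.map concat.simps append_Nil2 mult_0 add_0)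
  next
    case False
    let ?h = "n div 2" and ?b = "odd n"
    have z: "\<rho> (Suc d) = 0" "\<rho> (Suc (Suc d)) = 0" using assms by auto
    have 1: "runs x (Do (Emit Always)) (\<rho>(d := n), p, w) (\<rho>(d := n), p, w @ [True]) 1"
      using runs_Do[of x "Emit Always" "(\<rho>(d := n), p, w)"] by simp
    \<comment> \<open>There are n - n div 2 rounds. For odd n the last one finds a single unit left;
      only then 2 * i exceeds n and the parity register becomes 1.\<close>
    define S where "S i = (\<rho>(d := n - 2 * i, Suc d := min i ?h,
        d + 2 := if 2 * i \<le> n then 0 else 1), p, w @ [True])" for i
    have 2: "runs x (While (Neg (Zero d)) (block (halve d)))
        (\<rho>(d := n), p, w @ [True]) (\<rho>(d := 0, Suc d := ?h, d + 2 := of_bool ?b), p, w @ [True])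
        (6 * (n - ?h) + 1)"
    proof (rule runs_block_loop[where n = "n - ?h" and S = S])
      show "(\<rho>(d := n), p, w @ [True]) = S 0" using z by (auto simp: S_def fun_eq_iff)
      show "(\<rho>(d := 0, Suc d := ?h, d + 2 := of_bool ?b), p, w @ [True]) = S (n - ?h)"
        by (cases "odd n") (auto simp: S_def fun_eq_iff elim!: oddE evenE)
      show "6 * (n - ?h) + 1 = (n - ?h) * (length (halve d) + 2) + 1" by (simp add: halve_def)
      show "\<not> holds x (Neg (Zero d)) (S (n - ?h))"
        by (simp add: S_def)
      fix i assume "i < n - ?h"
      then have i: "2 * i < n" by linarith
      then consider "n = Suc (2 * i)" | "Suc (2 * i) < n" by linarith
      then show "holds x (Neg (Zero d)) (S i) \<and>
          fold (perform x) (halve d) (S i) = S (Suc i)"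
        by cases (auto simp: S_def fun_eq_iff min_def halve_def)
    qed
    have 3: "runs x (block [Emit (Neg (Zero (d + 2))), Dec (d + 2)])
        (\<rho>(d := 0, Suc d := ?h, d + 2 := of_bool ?b), p, w @ [True])
        (\<rho>(d := 0, Suc d := ?h), p, w @ [True, ?b]) 2"
      using runs_block[of x "[Emit (Neg (Zero (d + 2))), Dec (d + 2)]"
          "(\<rho>(d := 0, Suc d := ?h, d + 2 := of_bool ?b), p, w @ [True])"] z
      by (auto simp: fun_upd_idem fun_upd_twist numeral_2_eq_2)
    have 4: "runs x (While (Neg (Zero (Suc d))) (block [Dec (Suc d), Inc Always d]))
        (\<rho>(d := 0, Suc d := ?h), p, w @ [True, ?b]) (\<rho>(d := ?h), p, w @ [True, ?b])
        (4 * ?h + 1)"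
      by (rule runs_block_loop[where n = "?h" and S = "\<lambda>i. (\<rho>(d := i, Suc d := ?h - i), p, w @ [True, ?b])"])
         (use z in \<open>auto simp: fun_eq_iff\<close>)
    have "?h < n" using False by simp
    note IH = less.IH[OF this, of "w @ [True, ?b]"]
    have "holds x (Neg (Zero d)) (\<rho>(d := n), p, w)" using False by simp
    note all = runs_WhileT[OF this runs_Seq[OF 1 runs_Seq[OF 2 runs_Seq[OF 3 4]], folded emit_digit_def] IH]
    have "?h * (10 * ?h + 7) \<le> (n - 1) * (10 * n + 7)"
      using False by (intro mult_mono) auto
    moreover have "(n - 1) * (10 * n + 7) + (10 * n + 7) = n * (10 * n + 7)"
      using False by (cases n) auto
    ultimately have "?h * (10 * ?h + 7) + 10 * n + 7 \<le> n * (10 * n + 7)" by linarith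
    moreover have "6 * (n - ?h) + 4 * ?h \<le> 6 * n" by linarith
    ultimately have T: "1 + (6 * (n - ?h) + 1 + (2 + (4 * ?h + 1))) + (?h * (10 * ?h + 7) + 1) + 2
        \<le> n * (10 * n + 7) + 1" using False by linarith
    have out: "(w @ [True, ?b]) @ concat (map (\<lambda>b. [True, b]) (binary ?h))
        = w @ concat (map (\<lambda>b. [True, b]) (binary n))" using False by (simp add: binary_pos)
    show ?thesis using runs_mono[OF all T] unfolding out .
  qed
qed

lemma runs_emit_num:
  assumes "\<forall>i > d. \<rho> i = 0"
  shows "runs x (emit_num d) (\<rho>(d := n), p, w) (\<rho>(d := 0), p, w @ enc_nat n) (n * (10 * n + 7) + 2)"
  unfolding emit_num_def
  using runs_Seq[OF emit_loop[OF assms, of x n p w] runs_Do[of x "Emit (Neg Always)"]]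
  by (simp add: enc_nat_def)

lemma concat_map_concat: "concat (map f (concat xss)) = concat (map (\<lambda>xs. concat (map f xs)) xss)"
  by (induction xss) auto

text \<open>The registers are restored completely, so consecutive generators start from the same
  environment. The bound M varies in the induction because a loop raises it for its body.\<close>

lemma runs_gen_com:
  assumes "\<forall>i \<ge> d. \<rho> i = 0" "scoped d g" "\<forall>v. \<rho> v \<le> M" "length x \<le> M"
  shows "runs x (gen_com g d) (\<rho>, 0, w) (\<rho>, 0, w @ concat (map enc_nat (nums g x d \<rho>)))
    (poly (gen_time g) M)"
  using assms
proof (induction g arbitrary: \<rho> d w M)
  case Empty
  then show ?case by (simp add: runs_Skip)
next
  case (Num e)
  let ?n = "eval x \<rho> e"
  have z: "\<rho> d = 0" using Num.prems by simp
  have "runs x (addto e d (Suc d)) (\<rho>, 0, w) (\<rho>(d := \<rho> d + ?n), 0, w) (poly (time_bound e) M)"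
    by (rule runs_addto) (use Num.prems in auto)
  then have 1: "runs x (addto e d (Suc d)) (\<rho>, 0, w) (\<rho>(d := ?n), 0, w) (poly (time_bound e) M)"
    unfolding z add_0 .
  have 2: "runs x (emit_num d) (\<rho>(d := ?n), 0, w) (\<rho>, 0, w @ enc_nat ?n) (?n * (10 * ?n + 7) + 2)"
    using runs_emit_num[of d \<rho> x ?n 0 w] Num.prems by (simp add: fun_upd_idem)
  have "?n \<le> poly (value_bound e) M" using Num.prems by (auto intro!: eval_le_value_bound)
  then have "?n * (10 * ?n + 7) \<le> poly (value_bound e) M * (10 * poly (value_bound e) M + 7)"
    by (intro mult_mono) auto
  then have T: "poly (time_bound e) M + (?n * (10 * ?n + 7) + 2) \<le> poly (gen_time (Num e)) M" by simp
  show ?case using runs_mono[OF runs_Seq[OF 1 2] T] by simp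
next
  case (Append g h)
  have "runs x (gen_com g d) (\<rho>, 0, w) (\<rho>, 0, w @ concat (map enc_nat (nums g x d \<rho>))) (poly (gen_time g) M)"
    using Append.prems by (intro Append.IH(1)) auto
  moreover have "runs x (gen_com h d) (\<rho>, 0, w @ concat (map enc_nat (nums g x d \<rho>)))
      (\<rho>, 0, (w @ concat (map enc_nat (nums g x d \<rho>))) @ concat (map enc_nat (nums h x d \<rho>))) (poly (gen_time h) M)"
    using Append.prems by (intro Append.IH(2)) auto
  ultimately show ?case using runs_Seq by fastforce
next
  case (For e g)
  let ?n = "eval x \<rho> e"
  let ?T = "poly (gen_time g) (M + poly (value_bound e) M)"
  define out where "out i = concat (map enc_nat (nums g x (d + 2) (\<rho>(d := i, Suc d := ?n - Suc i))))" for i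
  define S where "S i = (\<rho>(d := i, Suc d := ?n - i), 0::int, w @ concat (map out [0..<i]))" for i
  have z: "\<rho> d = 0" "\<rho> (Suc d) = 0" using For.prems by auto
  have n: "?n \<le> poly (value_bound e) M" using For.prems by (auto intro!: eval_le_value_bound)
  have "runs x (addto e (Suc d) (d + 2)) (\<rho>, 0, w) (\<rho>(Suc d := \<rho> (Suc d) + ?n), 0, w) (poly (time_bound e) M)"
    by (rule runs_addto) (use For.prems in auto)
  moreover have "(\<rho>(Suc d := \<rho> (Suc d) + ?n), 0, w) = S 0" using z by (auto simp: S_def fun_eq_iff)
  ultimately have 1: "runs x (addto e (Suc d) (d + 2)) (\<rho>, 0, w) (S 0) (poly (time_bound e) M)" by metis
  have 2: "runs x (While (Neg (Zero (Suc d))) (Do (Dec (Suc d)) ;; gen_com g (d + 2) ;; Do (Inc Always d)))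
      (S 0) (S ?n) (?n * ((1 + (?T + 1)) + 2) + 1)"
  proof (rule runs_loop)
    fix i assume i: "i < ?n"
    let ?\<rho> = "\<rho>(d := i, Suc d := ?n - Suc i)"
    have b: "?\<rho> v \<le> M + poly (value_bound e) M" for v
      using For.prems(3)[rule_format, of v] n i by auto
    have "runs x (Do (Dec (Suc d))) (S i) (perform x (Dec (Suc d)) (S i)) 1" by (rule runs_Do)
    moreover have "perform x (Dec (Suc d)) (S i) = (?\<rho>, 0, w @ concat (map out [0..<i]))"
      by (auto simp: S_def fun_eq_iff)
    moreover have "runs x (gen_com g (d + 2)) (?\<rho>, 0, w @ concat (map out [0..<i]))
        (?\<rho>, 0, (w @ concat (map out [0..<i])) @ concat (map enc_nat (nums g x (d + 2) ?\<rho>))) ?T"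
      by (rule For.IH) (use For.prems b in auto)
    moreover have "(w @ concat (map out [0..<i])) @ concat (map enc_nat (nums g x (d + 2) ?\<rho>))
        = w @ concat (map out [0..<Suc i])"
      by (simp add: out_def)
    moreover have "runs x (Do (Inc Always d)) (?\<rho>, 0, w @ concat (map out [0..<Suc i])) (S (Suc i)) 1"
      using runs_Do[of x "Inc Always d" "(?\<rho>, 0, w @ concat (map out [0..<Suc i]))"]
      by (simp add: S_def fun_upd_twist)
    ultimately have "runs x (Do (Dec (Suc d)) ;; gen_com g (d + 2) ;; Do (Inc Always d)) (S i) (S (Suc i))
        (1 + (?T + 1))" by (metis runs_Seq)
    then show "holds x (Neg (Zero (Suc d))) (S i) \<and>
        runs x (Do (Dec (Suc d)) ;; gen_com g (d + 2) ;; Do (Inc Always d)) (S i) (S (Suc i)) (1 + (?T + 1))"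
      using i by (simp add: S_def)
  qed (simp add: S_def)
  have 3: "runs x (While (Neg (Zero d)) (block [Dec d])) (S ?n) (\<rho>, 0, w @ concat (map out [0..<?n]))
      (3 * ?n + 1)"
    by (rule runs_block_loop[where n = "?n" and S = "\<lambda>i. (\<rho>(d := ?n - i), 0, w @ concat (map out [0..<?n]))"])
       (use z in \<open>auto simp: S_def fun_eq_iff\<close>)
  have "?n * (?T + 7) \<le> poly (value_bound e) M * (?T + 7)" using n by (rule mult_le_mono1)
  then have T: "poly (time_bound e) M + (?n * ((1 + (?T + 1)) + 2) + 1 + (3 * ?n + 1))
      \<le> poly (gen_time (For e g)) M"
    by (simp add: poly_pcompose algebra_simps)
  have out: "concat (map enc_nat (nums (For e g) x d \<rho>)) = concat (map out [0..<?n])"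
    by (simp add: concat_map_concat out_def[abs_def] comp_def)
  show ?case unfolding out using runs_mono[OF runs_Seq[OF 1 runs_Seq[OF 2 3]] T] by simp
qed

theorem polytime_gen:
  assumes "scoped 0 g"
  shows "polytime 1 (\<lambda>xs. concat (map enc_nat (nums g (xs ! 0) 0 (\<lambda>_. 0))))"
proof (rule polytime_of_exec)
  fix x
  show "\<exists>\<rho> q t. exec x (gen_com g 0) (\<lambda>_. 0, 0, []) (\<rho>, q, concat (map enc_nat (nums g x 0 (\<lambda>_. 0)))) t
      \<and> t \<le> poly (gen_time g) (length x)"
    using runs_gen_com[of 0 "\<lambda>_. 0" g "length x" x "[]"] assms by (auto simp: runs_def)
qed

section \<open>Packings without split items\<close>

lemma sum_list_by_bins:
  fixes g :: "'a \<Rightarrow> 'b::comm_monoid_add"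
  assumes "\<And>p. p \<in> set ps \<Longrightarrow> f p < (m::nat)"
  shows "sum_list (map g ps) = (\<Sum>j<m. sum_list (map g (filter (\<lambda>p. f p = j) ps)))"
  using assms
proof (induction ps)
  case (Cons p ps)
  have "(\<Sum>j<m. sum_list (map g (filter (\<lambda>q. f q = j) (p # ps))))
      = (\<Sum>j<m. (if j = f p then g p else 0) + sum_list (map g (filter (\<lambda>q. f q = j) ps)))"
    by (intro sum.cong) auto
  also have "\<dots> = g p + (\<Sum>j<m. sum_list (map g (filter (\<lambda>q. f q = j) ps)))"
    using Cons.prems[of p] by (simp add: sum.distrib)
  finally show ?case using Cons by simp
qed simp

lemma filter_eq_singleton:
  "distinct (map f xs) \<Longrightarrow> x \<in> set xs \<Longrightarrow> filter (\<lambda>y. f y = f x) xs = [x]"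
proof (induction xs)
  case (Cons y ys)
  show ?case
  proof (cases "x = y")
    case True
    with Cons.prems have "f x \<notin> f ` set ys" by simp
    then have "filter (\<lambda>z. f z = f x) ys = []"
      by (intro filter_False ballI notI) (metis image_eqI)
    then show ?thesis using True by simp
  next
    case False
    with Cons.prems have "x \<in> set ys" "f x \<noteq> f y" by (auto simp: image_iff)
    then show ?thesis using Cons by auto
  qed
qed simp

text \<open>Lifts an arrangement of values to an arrangement of preimages. It serves to pass from
  items to item positions, since a packing refers to positions and equal items occur.\<close>

lemma image_mset_eq_mset:
  "image_mset h M = mset xs \<Longrightarrow> \<exists>ys. map h ys = xs \<and> mset ys = M"
proof (induction xs arbitrary: M)
  case (Cons x xs)
  then obtain a M' where "M = add_mset a M'" "h a = x" "image_mset h M' = mset xs"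
    by (metis msed_map_invR mset.simps(2))
  then show ?case using Cons.IH[of M'] by (metis list.simps(9) mset.simps(2))
qed simp

lemma map_eq_concat: "map h ys = concat xss \<Longrightarrow> \<exists>yss. map (map h) yss = xss \<and> concat yss = ys"
proof (induction xss arbitrary: ys)
  case (Cons xs xss)
  then obtain us vs where "ys = us @ vs" "map h us = xs" "map h vs = concat xss"
    by (auto simp: map_eq_append_conv)
  then show ?case using Cons.IH[of vs] by (metis concat.simps(2) list.simps(9))
qed simp

lemma concat_map_single:
  "j < m \<Longrightarrow> concat (map (\<lambda>i. if i = j then f i else []) [0..<m]) = f j"
proof -
  have "concat (map (\<lambda>i. if i = j then f i else []) is) = []" if "j \<notin> set is" for "is"
    using that by (induction "is") auto
  then have "concat (map (\<lambda>i. if i = j then f i else []) [0..<j]) = []"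
    "concat (map (\<lambda>i. if i = j then f i else []) [Suc j..<m]) = []" by simp_all
  moreover assume "j < m"
  then have "[0..<m] = [0..<j] @ j # [Suc j..<m]"
    by (metis le_add_diff_inverse less_imp_le upt_add_eq_append upt_conv_Cons zero_le add_0)
  ultimately show ?thesis by (simp del: concat_eq_Nil_conv)
qed

lemma is_packing_iff:
  "is_packing k sizes m ps \<longleftrightarrow>
     (\<forall>p \<in> set ps. fst p < length sizes \<and> fst (snd p) < m \<and> snd (snd p) > 0) \<and>
     (\<forall>i < length sizes. sum_list (map (\<lambda>p. snd (snd p)) (filter (\<lambda>p. fst p = i) ps)) = sizes ! i) \<and>
     (\<forall>j < m. sum_list (map (\<lambda>p. snd (snd p)) (filter (\<lambda>p. fst (snd p) = j) ps)) \<le> 1) \<and>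
     (\<forall>j < m. length (filter (\<lambda>p. fst (snd p) = j) ps) \<le> k)"
  unfolding is_packing_def case_prod_unfold by (rule refl)

lemma partition_imp_packable:
  fixes sz :: "'a \<Rightarrow> nat"
  assumes B: "B > 0" and pos: "\<And>it. it \<in> set its \<Longrightarrow> sz it > 0"
    and bs: "length bs = m" "mset (concat bs) = mset its"
      "\<And>b. b \<in> set bs \<Longrightarrow> length b = k \<and> sum_list (map sz b) = B"
  shows "packable k (map (\<lambda>it. real (sz it) / real B) its) m" (is "packable k ?sizes m")
proof -
  \<comment> \<open>The groups are lists of items; they are pulled back to lists of positions, each
    position being used once, and every position becomes one unsplit part.\<close>
  have "image_mset (nth its) (mset [0..<length its]) = mset (concat bs)"
    by (metis bs(2) map_nth mset_map)
  then obtain ys where "map (nth its) ys = concat bs" and ys: "mset ys = mset [0..<length its]"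
    using image_mset_eq_mset by blast
  then obtain cs where cs: "map (map (nth its)) cs = bs" "concat cs = ys"
    using map_eq_concat by blast
  have len: "length cs = m" using cs(1) bs(1) by auto
  define part where "part j i = (i, j, real (sz (its ! i)) / real B)" for i j :: nat
  define ps where "ps = concat (map (\<lambda>j. map (part j) (cs ! j)) [0..<m])"
  have "map fst ps = concat (map (\<lambda>j. cs ! j) [0..<m])"
    by (simp add: ps_def map_concat part_def comp_def)
  then have fst_ps: "map fst ps = ys" using len cs(2) by (metis map_nth)
  have dist: "distinct (map fst ps)" unfolding fst_ps
    using mset_eq_imp_distinct_iff[OF ys] by simp
  have set_ys: "set ys = {..<length its}" using mset_eq_setD[OF ys] by (simp add: atLeast0LessThan)
  have bin: "filter (\<lambda>p. fst (snd p) = j) ps = map (part j) (cs ! j)" if "j < m" for j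
  proof -
    have "filter (\<lambda>p. fst (snd p) = j) (map (part i) xs) = (if i = j then map (part i) xs else [])" for i xs
      by (auto simp: part_def filter_map comp_def)
    then show ?thesis using that concat_map_single[of j m "\<lambda>i. map (part i) (cs ! i)"]
      by (simp add: ps_def filter_concat comp_def)
  qed
  have cs_bin: "length (cs ! j) = k" "sum_list (map (\<lambda>i. sz (its ! i)) (cs ! j)) = B" if "j < m" for j
  proof -
    have "map (nth its) (cs ! j) \<in> set bs" using that len cs(1) by (metis length_map nth_map nth_mem)
    from bs(3)[OF this] show "length (cs ! j) = k" "sum_list (map (\<lambda>i. sz (its ! i)) (cs ! j)) = B"
      by (auto simp: comp_def)
  qed
  have "is_packing k ?sizes m ps"
    unfolding is_packing_iff
  proof (intro conjI ballI allI impI)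
    fix p assume p: "p \<in> set ps"
    then obtain j i where ji: "j < m" "i \<in> set (cs ! j)" "p = part j i" by (auto simp: ps_def)
    then have "i \<in> set (concat cs)" using len nth_mem by fastforce
    then have "i \<in> set ys" using cs(2) by simp
    then show "fst p < length ?sizes" "fst (snd p) < m" "0 < snd (snd p)"
      using ji B pos set_ys by (auto simp: part_def)
  next
    fix i assume "i < length ?sizes"
    then have i: "i < length its" by simp
    then have "i \<in> set (map fst ps)" unfolding fst_ps set_ys by simp
    then obtain p where p: "p \<in> set ps" "fst p = i" by auto
    then have f: "filter (\<lambda>q. fst q = i) ps = [p]" using filter_eq_singleton[OF dist p(1)] by simp
    have "snd (snd p) = real (sz (its ! i)) / real B" using p by (auto simp: ps_def part_def)
    then show "sum_list (map (\<lambda>p. snd (snd p)) (filter (\<lambda>p. fst p = i) ps))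
        = ?sizes ! i"
      using f i by simp
  next
    fix j assume j: "j < m"
    have "(\<Sum>i\<leftarrow>xs. real (sz (its ! i)) / real B) = real (sum_list (map (\<lambda>i. sz (its ! i)) xs)) / real B" for xs
      by (induction xs) (auto simp: add_divide_distrib)
    then show "sum_list (map (\<lambda>p. snd (snd p)) (filter (\<lambda>p. fst (snd p) = j) ps)) \<le> 1"
      using bin[OF j] cs_bin[OF j] by (simp add: part_def comp_def)
    show "length (filter (\<lambda>p. fst (snd p) = j) ps) \<le> k"
      using bin[OF j] cs_bin[OF j] by simp
  qed
  then show ?thesis unfolding packable_def by blast
qed

text \<open>There are as many items as parts fit into the bins, so no item can be split.\<close>

lemma packable_imp_partition:
  fixes sz :: "'a \<Rightarrow> nat"
  assumes len: "length its = k * m" and tot: "sum_list (map sz its) = m * B"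
    and B: "B > 0" and pos: "\<And>it. it \<in> set its \<Longrightarrow> sz it > 0"
    and pack: "packable k (map (\<lambda>it. real (sz it) / real B) its) m"
  obtains bs where "length bs = m" "mset (concat bs) = mset its"
    "\<And>b. b \<in> set bs \<Longrightarrow> length b = k \<and> sum_list (map sz b) = B"
proof -
  let ?sizes = "map (\<lambda>it. real (sz it) / real B) its"
  let ?bin = "\<lambda>p :: nat \<times> nat \<times> real. fst (snd p)" and ?s = "\<lambda>p :: nat \<times> nat \<times> real. snd (snd p)"
  obtain ps where ps: "is_packing k ?sizes m ps" using pack by (auto simp: packable_def)
  have part: "fst p < length its" "?bin p < m" if "p \<in> set ps" for p
    using ps that unfolding is_packing_iff by auto
  have item: "sum_list (map ?s (filter (\<lambda>p. fst p = i) ps)) = real (sz (its ! i)) / real B"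
    if "i < length its" for i
    using ps that unfolding is_packing_iff by simp
  have bin_le: "sum_list (map ?s (filter (\<lambda>p. ?bin p = j) ps)) \<le> 1"
    "length (filter (\<lambda>p. ?bin p = j) ps) \<le> k" if "j < m" for j
    using ps that unfolding is_packing_iff by blast+
  have len_ps: "length ps = (\<Sum>j<m. length (filter (\<lambda>p. ?bin p = j) ps))"
    using sum_list_by_bins[of ps ?bin m "\<lambda>_. 1::nat"] part by (simp add: sum_list_triv)
  have set_ps: "set (map fst ps) = {..<length its}"
  proof
    show "{..<length its} \<subseteq> set (map fst ps)"
    proof
      fix i assume "i \<in> {..<length its}"
      then have "sum_list (map ?s (filter (\<lambda>p. fst p = i) ps)) \<noteq> 0"
        using item[of i] B pos[of "its ! i"] by simp
      then have "filter (\<lambda>p. fst p = i) ps \<noteq> []" by auto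
      then show "i \<in> set (map fst ps)" by (auto simp: filter_empty_conv)
    qed
  qed (use part in auto)
  \<comment> \<open>The bins admit at most k * m parts, and each of the k * m items, being of
    positive size, has a part. The two bounds meet, so parts and items correspond one to
    one.\<close>
  have "length ps \<le> k * m" using sum_mono[OF bin_le(2), of "{..<m}"] len_ps by (simp add: mult.commute)
  moreover have "k * m \<le> length ps" using card_length[of "map fst ps"] len set_ps by simp
  ultimately have n: "length ps = k * m" by simp
  then have dist: "distinct (map fst ps)" using set_ps len by (intro card_distinct) simp
  have size_part: "?s p = real (sz (its ! fst p)) / real B" if "p \<in> set ps" for p
    using item[OF part(1)[OF that]] filter_eq_singleton[OF dist that] by simp
  have len_bin: "length (filter (\<lambda>p. ?bin p = j) ps) = k" if "j < m" for j
  proof -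
    have "(\<Sum>j<m. k - length (filter (\<lambda>p. ?bin p = j) ps)) = 0"
      using n len_ps bin_le(2) by (subst sum_subtractf_nat) auto
    then have "k \<le> length (filter (\<lambda>p. ?bin p = j) ps)" using that by simp
    then show ?thesis using bin_le(2)[OF that] by simp
  qed
  have mset_ps: "mset (map fst ps) = mset [0..<length its]"
    using set_eq_iff_mset_eq_distinct[OF dist, of "[0..<length its]"] set_ps
    by (simp add: atLeast0LessThan)
  have mset_its: "mset (map (\<lambda>p. its ! fst p) ps) = mset its"
  proof -
    have "mset (map (\<lambda>p. its ! fst p) ps) = image_mset (nth its) (mset (map fst ps))"
      by (simp add: multiset.map_comp comp_def)
    also have "\<dots> = mset (map (nth its) [0..<length its])" unfolding mset_ps by simp
    finally show ?thesis by (simp add: map_nth)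
  qed
  have "sum_list (map ?s ps) = real m"
  proof -
    have "sum_list (map ?s ps) = sum_list (map (\<lambda>p. real (sz (its ! fst p)) / real B) ps)"
      using size_part by (intro arg_cong[where f = sum_list]) auto
    also have "\<dots> = real (sum_list (map (\<lambda>p. sz (its ! fst p)) ps)) / real B"
      by (induction ps) (auto simp: add_divide_distrib)
    also have "sum_list (map (\<lambda>p. sz (its ! fst p)) ps) = sum_list (map sz its)"
      using arg_cong[OF mset_its, of "\<lambda>M. sum_mset (image_mset sz M)"]
      by (simp add: multiset.map_comp comp_def flip: sum_mset_sum_list)
    finally show ?thesis using tot B by simp
  qed
  then have tot_bins: "(\<Sum>j<m. sum_list (map ?s (filter (\<lambda>p. ?bin p = j) ps))) = real m"
    using sum_list_by_bins[of ps ?bin m ?s] part by simp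
  have sum_bin: "sum_list (map ?s (filter (\<lambda>p. ?bin p = j) ps)) = 1" if "j < m" for j
  proof -
    \<comment> \<open>The loads are at most 1 and add up to m, so no bin has any slack.\<close>
    have "(\<Sum>j<m. 1 - sum_list (map ?s (filter (\<lambda>p. ?bin p = j) ps))) = 0"
      using tot_bins by (simp add: sum_subtractf)
    then have "\<forall>j\<in>{..<m}. 1 - sum_list (map ?s (filter (\<lambda>p. ?bin p = j) ps)) = 0"
      using bin_le(1) by (subst (asm) sum_nonneg_eq_0_iff) auto
    then show ?thesis using that by simp
  qed
  define bs where "bs = map (\<lambda>j. map (\<lambda>p. its ! fst p) (filter (\<lambda>p. ?bin p = j) ps)) [0..<m]"
  show ?thesis
  proof
    show "length bs = m" by (simp add: bs_def)
    have single: "sum_list (map (\<lambda>p. {#its ! fst p#}) xs) = mset (map (\<lambda>p. its ! fst p) xs)"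
      for xs :: "(nat \<times> nat \<times> real) list"
      by (induction xs) auto
    show "mset (concat bs) = mset its"
      using sum_list_by_bins[of ps ?bin m "\<lambda>p. {#its ! fst p#}"] part mset_its
      unfolding single
      by (simp add: bs_def mset_concat comp_def interv_sum_list_conv_sum_set_nat atLeast0LessThan)
    fix b assume "b \<in> set bs"
    then obtain j where j: "j < m" "b = map (\<lambda>p. its ! fst p) (filter (\<lambda>p. ?bin p = j) ps)"
      by (auto simp: bs_def)
    have "1 = sum_list (map (\<lambda>p. real (sz (its ! fst p)) / real B) (filter (\<lambda>p. ?bin p = j) ps))"
      unfolding sum_bin[OF j(1), symmetric]
      using size_part by (intro arg_cong[where f = sum_list]) auto
    also have "\<dots> = real (sum_list (map sz b)) / real B"
      unfolding j(2) by (induction ps) (auto simp: add_divide_distrib)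
    finally have "sum_list (map sz b) = B" using B by simp
    then show "length b = k \<and> sum_list (map sz b) = B" using j len_bin by simp
  qed
qed

section \<open>Covering by triples\<close>

text \<open>
  A triple j consists of one element el s j for every axis s. A set of triples, given by its
  characteristic function, is sought whose elements along every axis, counted with multiplicity,
  are prescribed by tokens: a token (e, True) is used by a selected triple containing e, a token
  (e, False) by an unselected one.
\<close>

datatype axis = Row | Col | Diag

definition covers :: "'j list \<Rightarrow> (axis \<Rightarrow> 'j \<Rightarrow> nat) \<Rightarrow> (axis \<Rightarrow> 'j \<Rightarrow> bool) \<Rightarrow> ('j \<Rightarrow> bool) \<Rightarrow> bool" where
  "covers js el tok sel \<longleftrightarrow>
     (\<forall>s. mset (map (\<lambda>j. (el s j, sel j)) js) = mset (map (\<lambda>j. (el s j, tok s j)) js))"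

text \<open>A slot stands for a triple on one axis together with a truth value. In an intended
  packing the three slots of j with value \<open>sel j\<close> share a bin; the slot of the opposite
  value on axis s meets the link of j on s, which carries the element, and a token of that element
  with value \<open>sel j\<close>.\<close>

datatype 'j item = Slot axis 'j bool | Link axis 'j | Token axis nat bool | Dummy

text \<open>
  The digits of an item size: 2 or 1 to count the proper items, the type of the item, two
  digits for the identity of the triple, one for the element, one for the truth value.
  The weights in the type digit are chosen such that a sum of three of them is 19 only for the
  three slots of a triple and for a slot, a link and a token of the same axis.
\<close>

fun digits :: "nat \<Rightarrow> ('j \<Rightarrow> nat) \<Rightarrow> (axis \<Rightarrow> 'j \<Rightarrow> nat) \<Rightarrow> 'j item \<Rightarrow> nat list" where
  "digits U idx el (Slot Row j a) = [2, 12, idx j, 0, U, of_bool a]"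
| "digits U idx el (Slot Col j a) = [2, 6, U - idx j, idx j, U, of_bool a]"
| "digits U idx el (Slot Diag j a) = [2, 1, 0, U - idx j, 0, 2 - 2 * of_bool a]"
| "digits U idx el (Link Row j) = [2, 5, U - idx j, U, U - el Row j, 1]"
| "digits U idx el (Link Col j) = [2, 3, idx j, U - idx j, U - el Col j, 1]"
| "digits U idx el (Link Diag j) = [2, 0, U, idx j, 2 * U - el Diag j, 0]"
| "digits U idx el (Token Row e v) = [2, 2, 0, 0, e, of_bool v]"
| "digits U idx el (Token Col e v) = [2, 10, 0, 0, e, of_bool v]"
| "digits U idx el (Token Diag e v) = [2, 18, 0, 0, e, 2 - 2 * of_bool v]"
| "digits U idx el Dummy = [1, 0, 0, 0, 0, 0]"

text \<open>The lowest digit k + 3 is reached by k items exactly if three of them are proper. Two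
  identity digits suffice for three slots: one compares \<open>Row\<close> with \<open>Col\<close>,
  the other \<open>Col\<close> with \<open>Diag\<close>, each by adding an index to the complement U
  - index of the other.\<close>

definition target :: "nat \<Rightarrow> nat \<Rightarrow> nat list" where
  "target k U = [k + 3, 19, U, U, 2 * U, 2]"

text \<open>Digits are at most 2 * U + 18, so the sum of k digits stays below the radix and no carry
  arises.\<close>

definition radix :: "nat \<Rightarrow> nat \<Rightarrow> nat" where
  "radix k U = k * (2 * U + 19) + 1"

primrec horner :: "nat \<Rightarrow> nat list \<Rightarrow> nat" where
  "horner Q [] = 0"
| "horner Q (d # ds) = d + Q * horner Q ds"

definition item_size :: "nat \<Rightarrow> nat \<Rightarrow> ('j \<Rightarrow> nat) \<Rightarrow> (axis \<Rightarrow> 'j \<Rightarrow> nat) \<Rightarrow> 'j item \<Rightarrow> nat" where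
  "item_size k U idx el it = horner (radix k U) (digits U idx el it)"

definition bin_size :: "nat \<Rightarrow> nat \<Rightarrow> nat" where
  "bin_size k U = horner (radix k U) (target k U)"

definition triple_items :: "(axis \<Rightarrow> 'j \<Rightarrow> nat) \<Rightarrow> (axis \<Rightarrow> 'j \<Rightarrow> bool) \<Rightarrow> 'j \<Rightarrow> 'j item list" where
  "triple_items el tok j = concat (map (\<lambda>s.
     [Slot s j False, Slot s j True, Link s j, Token s (el s j) (tok s j)]) [Row, Col, Diag])"

text \<open>A triple has twelve proper items, enough for four bins, each of which is filled up with
  k - 3 dummies.\<close>

definition cover_items ::
  "nat \<Rightarrow> 'j list \<Rightarrow> (axis \<Rightarrow> 'j \<Rightarrow> nat) \<Rightarrow> (axis \<Rightarrow> 'j \<Rightarrow> bool) \<Rightarrow> 'j item list" where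
  "cover_items k js el tok =
     concat (map (triple_items el tok) js) @ replicate ((k - 3) * (4 * length js)) Dummy"

section \<open>Digit sums and the possible contents of a bin\<close>

lemma length_digits: "length (digits U idx el it) = 6"
  by (cases "(U, idx, el, it)" rule: digits.cases) auto

lemma horner_inj:
  "horner Q ds = horner Q es \<Longrightarrow> length ds = length es \<Longrightarrow> \<forall>d \<in> set ds \<union> set es. d < Q \<Longrightarrow> ds = es"
proof (induction ds arbitrary: es)
  case (Cons d ds)
  then obtain e es' where es: "es = e # es'" by (cases es) auto
  have lt: "d < Q" "e < Q" using Cons.prems es by auto
  have eq: "d + Q * horner Q ds = e + Q * horner Q es'" using Cons.prems es by simp
  then have "(d + Q * horner Q ds) mod Q = (e + Q * horner Q es') mod Q" by simp
  then have "d = e" using lt by simp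
  with eq lt have "horner Q ds = horner Q es'" by simp
  then show ?case using Cons \<open>d = e\<close> es by simp
qed simp

lemma horner_less: "\<forall>d \<in> set ds. d < Q \<Longrightarrow> horner Q ds < Q ^ length ds"
proof (induction ds)
  case (Cons d ds)
  then have "horner Q ds + 1 \<le> Q ^ length ds" "d < Q" by auto
  then have "Q * (horner Q ds + 1) \<le> Q * Q ^ length ds" by (intro mult_le_mono2)
  then show ?case using \<open>d < Q\<close> by (simp add: algebra_simps)
qed simp

lemma target_less_radix:
  assumes "k \<ge> 1" "d \<in> set (target k U)"
  shows "d < radix k U"
proof -
  define P where "P = k * (2 * U + 19)"
  have "2 * U + 19 \<le> P" "k * 19 \<le> P" using assms by (simp_all add: P_def)
  moreover have "radix k U = P + 1" by (simp add: radix_def P_def)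
  ultimately show ?thesis using assms by (auto simp: target_def)
qed

text \<open>Horner's scheme is additive in the digits whatever their size; the radix matters only
  when digits are to be recovered from the value.\<close>

lemma sum_list_horner:
  assumes "\<And>x. x \<in> set xs \<Longrightarrow> length (f x) = n"
  shows "sum_list (map (\<lambda>x. horner Q (f x)) xs)
    = horner Q (map (\<lambda>i. sum_list (map (\<lambda>x. f x ! i) xs)) [0..<n])"
proof -
  have zero: "horner Q (map (\<lambda>i. 0) is) = 0" for "is" :: "nat list" by (induction "is") auto
  have add: "horner Q (map (\<lambda>i. g i + h i) is) = horner Q (map g is) + horner Q (map h is)"
    for g h and "is" :: "nat list" by (induction "is") (auto simp: algebra_simps)
  show ?thesis using assms
  proof (induction xs)
    case (Cons x xs)
    have "horner Q (f x) = horner Q (map (\<lambda>i. f x ! i) [0..<n])"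
      using Cons.prems[of x] by (metis list.set_intros(1) map_nth)
    then show ?case using Cons by (simp add: add)
  qed (simp add: zero)
qed

definition ids_ok :: "nat \<Rightarrow> ('j \<Rightarrow> nat) \<Rightarrow> (axis \<Rightarrow> 'j \<Rightarrow> nat) \<Rightarrow> 'j list \<Rightarrow> bool" where
  "ids_ok U idx el js \<longleftrightarrow> distinct js \<and> inj_on idx (set js) \<and>
     (\<forall>j \<in> set js. idx j \<le> U \<and> (\<forall>s. el s j \<le> U))"

fun item_ok :: "nat \<Rightarrow> 'j set \<Rightarrow> 'j item \<Rightarrow> bool" where
  "item_ok U J (Slot s j a) = (j \<in> J)"
| "item_ok U J (Link s j) = (j \<in> J)"
| "item_ok U J (Token s e v) = (e \<le> U)"
| "item_ok U J Dummy = True"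

lemma item_ok_cover_items:
  "ids_ok U idx el js \<Longrightarrow> it \<in> set (cover_items k js el tok) \<Longrightarrow> item_ok U (set js) it"
  by (auto simp: cover_items_def triple_items_def ids_ok_def)

lemma digit_le:
  assumes "ids_ok U idx el js" "item_ok U (set js) it" "i < 6"
  shows "digits U idx el it ! i \<le> 2 * U + 18"
proof -
  have "i \<in> {0, 1, 2, 3, 4, 5}" using assms(3) by auto
  then show ?thesis using assms(1,2)
    by (cases "(U, idx, el, it)" rule: digits.cases) (auto simp: ids_ok_def numeral_eq_Suc trans_le_add1 simp del: of_bool_eq_0_iff of_bool_eq_1_iff
        split: if_splits)
qed

text \<open>A finite check. Ordering the weights removes permutations and leaves one triple for the
  three slots and one for each axis: 1 + 6 + 12, 2 + 5 + 12, 3 + 6 + 10 and 0 + 1 + 18.\<close>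

lemma type_weights:
  assumes "w1 \<in> {12, 6, 1, 5, 3, 0, 2, 10, 18 :: nat}" "w2 \<in> {12, 6, 1, 5, 3, 0, 2, 10, 18}"
    "w3 \<in> {12, 6, 1, 5, 3, 0, 2, 10, 18}" "w1 + w2 + w3 = 19" "w1 \<le> w2" "w2 \<le> w3"
  shows "(w1, w2, w3) \<in> {(1, 6, 12), (2, 5, 12), (3, 6, 10), (0, 1, 18)}"
proof -
  let ?W = "{12, 6, 1, 5, 3, 0, 2, 10, 18 :: nat}"
  have "\<forall>u \<in> ?W. \<forall>v \<in> ?W. \<forall>w \<in> ?W. u + v + w = 19 \<longrightarrow> u \<le> v \<longrightarrow> v \<le> w
      \<longrightarrow> (u, v, w) \<in> {(1, 6, 12), (2, 5, 12), (3, 6, 10), (0, 1, 18)}"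
    by code_simp
  from this[rule_format, OF assms] show ?thesis .
qed

lemma sorted_triple:
  fixes w :: "'a \<Rightarrow> nat"
  obtains a b c where "mset [x, y, z] = mset [a, b, c]" "w a \<le> w b" "w b \<le> w c"
proof -
  have "length (sort_key w [x, y, z]) = 3" by simp
  then obtain a b c where abc: "sort_key w [x, y, z] = [a, b, c]"
    unfolding numeral_3_eq_3 length_Suc_conv length_0_conv by blast
  have "sorted (map w [a, b, c])" unfolding abc[symmetric] by (rule sorted_sort_key)
  moreover have "mset [a, b, c] = mset [x, y, z]" unfolding abc[symmetric] by (rule mset_sort)
  ultimately show ?thesis by (intro that[of a b c]) auto
qed

text \<open>The legal bins up to dummies. In an \<open>Occurrence\<close> the truth value is that of
  the slot, so the token has the opposite one.\<close>

datatype 'j kind = Whole 'j bool | Occurrence axis 'j bool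

primrec content :: "(axis \<Rightarrow> 'j \<Rightarrow> nat) \<Rightarrow> 'j kind \<Rightarrow> 'j item multiset" where
  "content el (Whole j a) = {#Slot Row j a, Slot Col j a, Slot Diag j a#}"
| "content el (Occurrence s j a) = {#Slot s j a, Link s j, Token s (el s j) (\<not> a)#}"

text \<open>The type digit leaves four shapes. Within each, an equation a + (U - b) = U with b at
  most U forces a = b: on indices, which are injective, this identifies the triples, and on elements
  it identifies the token. The truth digit 2 then forces equal values for three slots and opposite
  values for a slot and a token.\<close>

lemma content_of_digits:
  assumes ids: "ids_ok U idx el js" and ok: "\<forall>it \<in> {x, y, z}. item_ok U (set js) it \<and> it \<noteq> Dummy"
    and sum: "\<And>i. i \<in> {1, 2, 3, 4, 5} \<Longrightarrow> digits U idx el x ! i + digits U idx el y ! i + digits U idx el z ! i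
      = target k U ! i"
  shows "\<exists>\<kappa>. mset [x, y, z] = content el \<kappa>"
proof -
  let ?D = "digits U idx el"
  obtain a b c where abc: "mset [x, y, z] = mset [a, b, c]" and le: "?D a ! 1 \<le> ?D b ! 1" "?D b ! 1 \<le> ?D c ! 1"
    by (rule sorted_triple[of x y z "\<lambda>it. ?D it ! 1"])
  have "set_mset (mset [x, y, z]) = set_mset (mset [a, b, c])" using abc by simp
  then have ok': "\<forall>it \<in> {a, b, c}. item_ok U (set js) it \<and> it \<noteq> Dummy" using ok by auto
  have sum': "?D a ! i + ?D b ! i + ?D c ! i = target k U ! i" if "i \<in> {1, 2, 3, 4, 5}" for i
    using sum[OF that] arg_cong[OF abc, of "\<lambda>M. \<Sum>it\<in>#M. ?D it ! i"] by (simp add: ac_simps)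
  have w: "?D it ! 1 \<in> {12, 6, 1, 5, 3, 0, 2, 10, 18}" if "it \<noteq> Dummy" for it
    using that by (cases "(U, idx, el, it)" rule: digits.cases) auto
  have nd: "a \<noteq> Dummy" "b \<noteq> Dummy" "c \<noteq> Dummy" using ok' by auto
  have "(?D a ! 1, ?D b ! 1, ?D c ! 1) \<in> {(1, 6, 12), (2, 5, 12), (3, 6, 10), (0, 1, 18)}"
    by (rule type_weights[OF w[OF nd(1)] w[OF nd(2)] w[OF nd(3)] _ le])
       (use sum'[of 1] in \<open>simp add: target_def\<close>)
  moreover have inv: "?D it ! 1 = 12 \<Longrightarrow> \<exists>j a. it = Slot Row j a"
    "?D it ! 1 = 6 \<Longrightarrow> \<exists>j a. it = Slot Col j a"
    "?D it ! 1 = 1 \<Longrightarrow> \<exists>j a. it = Slot Diag j a"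
    "?D it ! 1 = 5 \<Longrightarrow> \<exists>j. it = Link Row j"
    "?D it ! 1 = 3 \<Longrightarrow> \<exists>j. it = Link Col j"
    "?D it ! 1 = 0 \<Longrightarrow> \<exists>j. it = Link Diag j"
    "?D it ! 1 = 2 \<Longrightarrow> \<exists>e v. it = Token Row e v"
    "?D it ! 1 = 10 \<Longrightarrow> \<exists>e v. it = Token Col e v"
    "?D it ! 1 = 18 \<Longrightarrow> \<exists>e v. it = Token Diag e v" if "it \<noteq> Dummy" for it
    using that by (cases "(U, idx, el, it)" rule: digits.cases; simp)+
  note s = sum'[of 2] sum'[of 3] sum'[of 4] sum'[of 5]
  have inj: "idx j = idx j' \<Longrightarrow> j = j'" if "j \<in> set js" "j' \<in> set js" for j j'
    using ids that by (auto simp: ids_ok_def inj_on_def)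
  have bnd: "idx j \<le> U" "el s j \<le> U" if "j \<in> set js" for j s using ids that by (auto simp: ids_ok_def)
  ultimately consider
      (whole) i j l p q r where "a = Slot Diag i p" "b = Slot Col j q" "c = Slot Row l r"
    | (row) e v j l q where "a = Token Row e v" "b = Link Row j" "c = Slot Row l q"
    | (col) e v j l q where "a = Link Col j" "b = Slot Col l q" "c = Token Col e v"
    | (diag) e v j l q where "a = Link Diag j" "b = Slot Diag l q" "c = Token Diag e v"
    using inv[OF nd(1)] inv[OF nd(2)] inv[OF nd(3)] by auto
  then show ?thesis
  proof cases
    case whole
    with ok' have J: "i \<in> set js" "j \<in> set js" "l \<in> set js" by auto
    have "idx l + (U - idx j) = U" "idx j + (U - idx i) = U"
      using s(1,2) whole by (auto simp: target_def numeral_eq_Suc)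
    then have "l = j" "j = i" using J inj bnd by (metis add_diff_cancel_right' diff_diff_cancel)+
    moreover have "p = q" "q = r" using s(4) whole by (auto simp: target_def numeral_eq_Suc of_bool_def split: if_splits)
    ultimately show ?thesis using abc whole by (intro exI[of _ "Whole i p"]) simp
  next
    case row
    with ok' have J: "j \<in> set js" "l \<in> set js" by auto
    have "idx l + (U - idx j) = U" "e + (U - el Row j) = U"
      using s(1,3) row by (auto simp: target_def numeral_eq_Suc)
    then have "l = j" "e = el Row j" using J inj bnd by (metis add_diff_cancel_right' diff_diff_cancel)+
    moreover have "v = (\<not> q)" using s(4) row by (auto simp: target_def numeral_eq_Suc of_bool_def split: if_splits)
    ultimately show ?thesis using abc row by (intro exI[of _ "Occurrence Row j q"]) simp
  next
    case col
    with ok' have J: "j \<in> set js" "l \<in> set js" by auto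
    have "idx j + (U - idx l) = U" "e + (U - el Col j) = U"
      using s(1,3) col by (auto simp: target_def numeral_eq_Suc)
    then have "l = j" "e = el Col j" using J inj bnd by (metis add_diff_cancel_right' diff_diff_cancel)+
    moreover have "v = (\<not> q)" using s(4) col by (auto simp: target_def numeral_eq_Suc of_bool_def split: if_splits)
    ultimately show ?thesis using abc col by (intro exI[of _ "Occurrence Col j q"]) simp
  next
    case diag
    with ok' have J: "j \<in> set js" "l \<in> set js" by auto
    have "idx j + (U - idx l) = U" "e + (2 * U - el Diag j) = 2 * U"
      using s(2,3) diag by (auto simp: target_def numeral_eq_Suc)
    then have "idx j = idx l" "e = el Diag j" using J bnd(1)[of l] bnd(2)[of j Diag] by linarith+
    then have "l = j" using J inj by metis
    moreover have "v = (\<not> q)" using s(4) diag by (auto simp: target_def numeral_eq_Suc of_bool_def split: if_splits)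
    ultimately show ?thesis using abc diag \<open>e = el Diag j\<close> by (intro exI[of _ "Occurrence Diag j q"]) simp
  qed
qed

text \<open>Without carries the size equation holds digit by digit. Proper items count 2 and dummies
  1 in the lowest digit, so a sum of k + 3 over k items leaves exactly three proper ones; dummies
  contribute nothing to the other digits.\<close>

lemma bin_content:
  assumes ids: "ids_ok U idx el js" and ok: "\<And>it. it \<in> set b \<Longrightarrow> item_ok U (set js) it"
    and k: "k \<ge> 1" and len: "length b = k"
    and sum: "sum_list (map (item_size k U idx el) b) = bin_size k U"
  shows "\<exists>\<kappa>. mset (filter (\<lambda>it. it \<noteq> Dummy) b) = content el \<kappa>"
proof -
  let ?D = "digits U idx el" and ?Q = "radix k U"
  let ?ds = "map (\<lambda>i. sum_list (map (\<lambda>it. ?D it ! i) b)) [0..<6]"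
  have "horner ?Q ?ds = horner ?Q (target k U)"
    using sum sum_list_horner[of b ?D 6 ?Q]
    by (simp add: item_size_def[abs_def] bin_size_def length_digits)
  moreover have "\<forall>d \<in> set ?ds \<union> set (target k U). d < ?Q"
  proof -
    have "d < ?Q" if "d \<in> set (target k U)" for d using target_less_radix[OF k that] .
    moreover have "d < ?Q" if d: "d \<in> set ?ds" for d
    proof -
      obtain i where i: "i < 6" "d = sum_list (map (\<lambda>it. ?D it ! i) b)" using d by auto
      have "sum_list (map (\<lambda>it. ?D it ! i) b) \<le> sum_list (map (\<lambda>it. 2 * U + 18) b)"
        using digit_le[OF ids ok i(1)] by (intro sum_list_mono) blast
      also have "\<dots> = k * (2 * U + 18)" using len by (simp add: sum_list_triv)
      also have "\<dots> < ?Q" by (simp add: radix_def less_Suc_eq_le)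
      finally show ?thesis using i by simp
    qed
    ultimately show ?thesis by blast
  qed
  ultimately have ds: "?ds = target k U"
    by (intro horner_inj) (simp_all add: target_def)
  have dig: "sum_list (map (\<lambda>it. ?D it ! i) b) = target k U ! i" if "i < 6" for i
    using arg_cong[OF ds, of "\<lambda>xs. xs ! i"] that by simp
  have "?D it ! 0 = 1 + of_bool (it \<noteq> Dummy)" for it
    by (cases "(U, idx, el, it)" rule: digits.cases) auto
  then have "sum_list (map (\<lambda>it. 1 + of_bool (it \<noteq> Dummy)) b) = k + 3"
    using dig[of 0] by (simp add: target_def)
  moreover have "sum_list (map (\<lambda>it. 1 + of_bool (it \<noteq> Dummy)) b)
      = length b + length (filter (\<lambda>it. it \<noteq> Dummy) b)"
    by (induction b) auto
  ultimately have "length (filter (\<lambda>it. it \<noteq> Dummy) b) = 3" using len by simp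
  then obtain x y z where xyz: "filter (\<lambda>it. it \<noteq> Dummy) b = [x, y, z]"
    unfolding numeral_3_eq_3 length_Suc_conv length_0_conv by blast
  have "\<exists>\<kappa>. mset [x, y, z] = content el \<kappa>"
  proof (rule content_of_digits[OF ids])
    have "set (filter (\<lambda>it. it \<noteq> Dummy) b) = {x, y, z}" unfolding xyz by simp
    then show "\<forall>it\<in>{x, y, z}. item_ok U (set js) it \<and> it \<noteq> Dummy" using ok by auto
    fix i :: nat assume i: "i \<in> {1, 2, 3, 4, 5}"
    have "sum_list (map (\<lambda>it. ?D it ! i) (filter (\<lambda>it. it \<noteq> Dummy) b)) = sum_list (map (\<lambda>it. ?D it ! i) b)"
      using i by (intro sum_list_map_filter) (auto simp: numeral_eq_Suc)
    then show "?D x ! i + ?D y ! i + ?D z ! i = target k U ! i"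
      using dig[of i] i unfolding xyz by auto
  qed
  then show ?thesis unfolding xyz .
qed

section \<open>Multiplicities of items and the selection read off a partition\<close>

lemma count_Slot: "count (\<Sum>\<kappa>\<leftarrow>ks. content el \<kappa>) (Slot s j a)
    = count (mset ks) (Whole j a) + count (mset ks) (Occurrence s j a)"
proof (induction ks)
  case (Cons \<kappa> ks)
  then show ?case by (cases \<kappa>; cases s) auto
qed simp

lemma count_Link: "count (\<Sum>\<kappa>\<leftarrow>ks. content el \<kappa>) (Link s j)
    = count (mset ks) (Occurrence s j False) + count (mset ks) (Occurrence s j True)"
proof (induction ks)
  case (Cons \<kappa> ks)
  then show ?case by (cases \<kappa>; cases s) auto
qed simp

lemma count_Token: "count (\<Sum>\<kappa>\<leftarrow>ks. content el \<kappa>) (Token s e v)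
    = size (filter_mset (\<lambda>\<kappa>. \<exists>j. \<kappa> = Occurrence s j (\<not> v) \<and> el s j = e) (mset ks))"
proof (induction ks)
  case (Cons \<kappa> ks)
  then show ?case by (cases \<kappa>; cases s) auto
qed simp

lemma count_triple_Slot: "distinct js \<Longrightarrow>
    count (\<Sum>j\<leftarrow>js. mset (triple_items el tok j)) (Slot s j a) = of_bool (j \<in> set js)"
  by (induction js; cases s; cases a) (auto simp: triple_items_def)

lemma count_triple_Link: "distinct js \<Longrightarrow>
    count (\<Sum>j\<leftarrow>js. mset (triple_items el tok j)) (Link s j) = of_bool (j \<in> set js)"
  by (induction js; cases s) (auto simp: triple_items_def)

lemma count_triple_Token: "count (\<Sum>j\<leftarrow>js. mset (triple_items el tok j)) (Token s e v)
    = length (filter (\<lambda>j. el s j = e \<and> tok s j = v) js)"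
  by (induction js; cases s) (auto simp: triple_items_def)

lemma count_mset_map: "count (mset (map f xs)) y = length (filter (\<lambda>x. f x = y) xs)"
  by (induction xs) auto

lemma count_map_inj:
  assumes "inj f" "distinct xs"
  shows "count (mset (map f xs)) (f x) = of_bool (x \<in> set xs)"
  using assms distinct_map[of f xs] by (auto simp: distinct_count_atmost_1 inj_def inj_on_def image_iff count_eq_zero_iff)

text \<open>The multiplicity of \<open>Whole j a\<close> does not depend on the axis; this is what
  makes the three axes agree on whether j is selected. On each axis the slot outside the whole bin
  determines the value of the token used by j, and since the tokens are exhausted, the used ones are
  the prescribed ones.\<close>

lemma cover_of_kinds:
  assumes dist: "distinct js"
    and eq: "(\<Sum>\<kappa>\<leftarrow>ks. content el \<kappa>) = (\<Sum>j\<leftarrow>js. mset (triple_items el tok j))"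
  shows "covers js el tok (\<lambda>j. Whole j True \<in> set ks)"
  unfolding covers_def
proof (intro allI multiset_eqI)
  fix s :: axis and y :: "nat \<times> bool"
  obtain e v where y: "y = (e, v)" by (cases y)
  let ?sel = "\<lambda>j. Whole j True \<in> set ks"
  let ?g = "\<lambda>j a. count (mset ks) (Whole j a)" and ?f = "\<lambda>j a. count (mset ks) (Occurrence s j a)"
  have slot: "?g j a + ?f j a = of_bool (j \<in> set js)" for j a
    unfolding count_Slot[of el, symmetric] eq by (rule count_triple_Slot[OF dist])
  have link: "?f j False + ?f j True = of_bool (j \<in> set js)" for j
    unfolding count_Link[of el, symmetric] eq by (rule count_triple_Link[OF dist])
  have f: "?f j (\<not> v) = of_bool (j \<in> set js \<and> ?sel j = v)" for j
  proof -
    have "?sel j \<longleftrightarrow> ?g j True \<noteq> 0" by (simp add: count_eq_zero_iff)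
    \<comment> \<open>For a triple of the list all three sums are 1, hence fF = 1 - fT = gT: the
      slot with value False goes with a token exactly if the whole bin has value True.\<close>
    moreover have "fF = of_bool (P \<and> gT \<noteq> 0)" "fT = of_bool (P \<and> gT = 0)"
      if "gT + fT = of_bool P" "gF + fF = of_bool P" "fF + fT = of_bool P" for gT gF fT fF :: nat and P
      using that by (cases P; cases "gT = 0"; auto)+
    note this[OF slot[of j True] slot[of j False] link[of j]]
    ultimately show ?thesis by (cases v) simp_all
  qed
  have "filter_mset (\<lambda>\<kappa>. \<exists>j. \<kappa> = Occurrence s j (\<not> v) \<and> el s j = e) (mset ks)
      = mset (map (\<lambda>j. Occurrence s j (\<not> v)) (filter (\<lambda>j. el s j = e \<and> ?sel j = v) js))"
  proof (rule multiset_eqI)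
    fix \<kappa>
    show "count (filter_mset (\<lambda>\<kappa>. \<exists>j. \<kappa> = Occurrence s j (\<not> v) \<and> el s j = e) (mset ks)) \<kappa>
      = count (mset (map (\<lambda>j. Occurrence s j (\<not> v)) (filter (\<lambda>j. el s j = e \<and> ?sel j = v) js))) \<kappa>"
    proof (cases "\<exists>j. \<kappa> = Occurrence s j (\<not> v)")
      case True
      then obtain j where j: "\<kappa> = Occurrence s j (\<not> v)" by blast
      have "count (mset (map (\<lambda>j. Occurrence s j (\<not> v)) (filter (\<lambda>j. el s j = e \<and> ?sel j = v) js))) \<kappa>
          = of_bool (j \<in> set (filter (\<lambda>j. el s j = e \<and> ?sel j = v) js))"
        unfolding j using dist by (intro count_map_inj) (auto simp: inj_def)
      then show ?thesis using f[of j] j by auto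
    next
      case False
      then show ?thesis by (auto simp: count_eq_zero_iff image_iff)
    qed
  qed
  from arg_cong[OF this, of size]
  have "count (\<Sum>\<kappa>\<leftarrow>ks. content el \<kappa>) (Token s e v) = length (filter (\<lambda>j. el s j = e \<and> ?sel j = v) js)"
    unfolding count_Token by (simp only: size_mset length_map)
  then have "length (filter (\<lambda>j. el s j = e \<and> ?sel j = v) js) = length (filter (\<lambda>j. el s j = e \<and> tok s j = v) js)"
    unfolding eq count_triple_Token by simp
  then show "count (mset (map (\<lambda>j. (el s j, ?sel j)) js)) y = count (mset (map (\<lambda>j. (el s j, tok s j)) js)) y"
    unfolding count_mset_map y by simp
qed

lemma cover_of_partition:
  assumes ids: "ids_ok U idx el js" and k: "k \<ge> 1"
    and mset: "mset (concat bs) = mset (cover_items k js el tok)"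
    and bin: "\<And>b. b \<in> set bs \<Longrightarrow> length b = k \<and> sum_list (map (item_size k U idx el) b) = bin_size k U"
  shows "\<exists>sel. covers js el tok sel"
proof -
  have ok: "item_ok U (set js) it" if "b \<in> set bs" "it \<in> set b" for b it
  proof (rule item_ok_cover_items[OF ids])
    have "it \<in> set (concat bs)" using that by auto
    then show "it \<in> set (cover_items k js el tok)" by (simp only: mset_eq_setD[OF mset])
  qed
  have "\<exists>\<kappa>. mset (filter (\<lambda>it. it \<noteq> Dummy) b) = content el \<kappa>" if "b \<in> set bs" for b
    using bin_content[OF ids ok[OF that] k] bin[OF that] by blast
  then obtain \<kappa> where \<kappa>: "\<And>b. b \<in> set bs \<Longrightarrow> mset (filter (\<lambda>it. it \<noteq> Dummy) b) = content el (\<kappa> b)"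
    by metis
  have "(\<Sum>k\<leftarrow>map \<kappa> bs. content el k) = (\<Sum>b\<leftarrow>bs. mset (filter (\<lambda>it. it \<noteq> Dummy) b))"
    using \<kappa> by (intro arg_cong[where f = sum_list]) (simp add: comp_def)
  also have "\<dots> = filter_mset (\<lambda>it. it \<noteq> Dummy) (mset (concat bs))"
    by (induction bs) auto
  also have "\<dots> = (\<Sum>j\<leftarrow>js. mset (triple_items el tok j))"
  proof -
    have "filter (\<lambda>it. it \<noteq> Dummy) (triple_items el tok j) = triple_items el tok j" for j
      by (simp add: triple_items_def)
    then have "filter (\<lambda>it. it \<noteq> Dummy) (concat (map (triple_items el tok) js)) = concat (map (triple_items el tok) js)"
      by (induction js) auto
    then have nd: "filter (\<lambda>it. it \<noteq> Dummy) (cover_items k js el tok) = concat (map (triple_items el tok) js)"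
      by (simp add: cover_items_def)
    show ?thesis unfolding mset mset_filter[symmetric] nd by (simp add: mset_concat comp_def)
  qed
  finally have "covers js el tok (\<lambda>j. Whole j True \<in> set (map \<kappa> bs))"
    using ids by (intro cover_of_kinds) (auto simp: ids_ok_def)
  then show ?thesis by blast
qed

text \<open>The four bins of a triple are first formed with tokens of value \<open>sel j\<close>.
  The covering condition says that on each axis these tokens are a rearrangement of the supplied
  ones, so the multiset of all items is the right one.\<close>

lemma partition_of_cover:
  assumes ids: "ids_ok U idx el js" and k: "k \<ge> 3" and cov: "covers js el tok sel"
  obtains bs where "length bs = 4 * length js" "mset (concat bs) = mset (cover_items k js el tok)"
    "\<And>b. b \<in> set bs \<Longrightarrow> length b = k \<and> sum_list (map (item_size k U idx el) b) = bin_size k U"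
proof
  define pad :: "'a item list" where "pad = replicate (k - 3) Dummy"
  define occ where "occ s j = [Slot s j (\<not> sel j), Link s j, Token s (el s j) (sel j)]" for s j
  define bins where "bins j = [[Slot Row j (sel j), Slot Col j (sel j), Slot Diag j (sel j)] @ pad,
      occ Row j @ pad, occ Col j @ pad, occ Diag j @ pad]" for j
  let ?bs = "concat (map bins js)"
  show "length ?bs = 4 * length js"
    by (simp add: length_concat comp_def bins_def sum_list_triv)
  have pads: "mset (replicate ((k - 3) * 4) Dummy) = mset pad + mset pad + mset pad + mset pad"
    by (simp add: pad_def multiset_eq_iff)
  have "mset (concat ?bs) = (\<Sum>j\<leftarrow>js. mset (triple_items el (\<lambda>_. sel) j) + mset (replicate ((k - 3) * 4) Dummy))"
  proof (induction js)
    case (Cons j js)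
    have "mset (concat (bins j)) = mset (triple_items el (\<lambda>_. sel) j) + mset (replicate ((k - 3) * 4) Dummy)"
      unfolding pads by (cases "sel j") (simp_all add: bins_def occ_def triple_items_def)
    then show ?case using Cons by simp
  qed simp
  also have "\<dots> = (\<Sum>j\<leftarrow>js. mset (triple_items el tok j) + mset (replicate ((k - 3) * 4) Dummy))"
  proof -
    have tr: "mset (triple_items el t j) = mset (concat (map (\<lambda>s. [Slot s j False, Slot s j True, Link s j]) [Row, Col, Diag]))
        + {#Token Row (el Row j) (t Row j)#} + {#Token Col (el Col j) (t Col j)#} + {#Token Diag (el Diag j) (t Diag j)#}" for t j
      by (simp add: triple_items_def)
    have tk: "(\<Sum>j\<leftarrow>js. {#Token s (el s j) (t s j)#})
        = image_mset (\<lambda>(e, v). Token s e v) (mset (map (\<lambda>j. (el s j, t s j)) js))" for s t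
      by (induction js) auto
    \<comment> \<open>The only use of the covering condition: it is carried over from pairs of
      element and truth value to tokens.\<close>
    have tke: "(\<Sum>j\<leftarrow>js. {#Token s (el s j) (sel j)#}) = (\<Sum>j\<leftarrow>js. {#Token s (el s j) (tok s j)#})" for s
      by (rule trans[OF tk[of s "\<lambda>_. sel"] trans[OF arg_cong[OF cov[unfolded covers_def, rule_format, of s],
            of "image_mset (\<lambda>(e, v). Token s e v)"] tk[of s tok, symmetric]]])
    show ?thesis unfolding tr sum_list_addf tke ..
  qed
  also have "\<dots> = mset (cover_items k js el tok)"
  proof -
    have "(\<Sum>j\<leftarrow>js. mset (replicate n (Dummy :: 'a item))) = mset (replicate (n * length js) Dummy)" for n
      by (induction js) (auto simp: replicate_add)
    then show ?thesis
      by (simp add: cover_items_def mset_concat comp_def sum_list_addf mult.assoc)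
  qed
  finally show "mset (concat ?bs) = mset (cover_items k js el tok)" .
  fix b assume "b \<in> set ?bs"
  then obtain j where j: "j \<in> set js" and b: "b \<in> set (bins j)" by auto
  have bnd: "idx j \<le> U" "el s j \<le> U" for s using ids j by (auto simp: ids_ok_def)
  have pad: "sum_list (map (item_size k U idx el) pad) = k - 3"
    by (simp add: pad_def item_size_def sum_list_replicate)
  have hs: "horner Q [a0, a1, a2, a3, a4, a5] + horner Q [b0, b1, b2, b3, b4, b5] + horner Q [c0, c1, c2, c3, c4, c5] + (k - 3)
      = horner Q [a0 + b0 + c0 + (k - 3), a1 + b1 + c1, a2 + b2 + c2, a3 + b3 + c3, a4 + b4 + c4, a5 + b5 + c5]"
    for Q a0 a1 a2 a3 a4 a5 b0 b1 b2 b3 b4 b5 c0 c1 c2 c3 c4 c5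
    by (simp add: algebra_simps)
  have whole: "item_size k U idx el (Slot Row j a) + item_size k U idx el (Slot Col j a)
      + item_size k U idx el (Slot Diag j a) + (k - 3) = bin_size k U" for a
    unfolding item_size_def bin_size_def digits.simps hs target_def
    using bnd(1) k by (intro arg_cong[where f = "horner _"]) (cases a; simp)
  have occurs: "item_size k U idx el (Slot s j (\<not> a)) + item_size k U idx el (Link s j)
      + item_size k U idx el (Token s (el s j) a) + (k - 3) = bin_size k U" for s a
    using bnd(1) bnd(2)[of s] k
    by (cases s) (simp_all only: item_size_def bin_size_def digits.simps hs target_def,
       (rule arg_cong[where f = "horner _"], cases a; simp)+)
  have "sum_list (map (item_size k U idx el) ([Slot Row j (sel j), Slot Col j (sel j), Slot Diag j (sel j)] @ pad))
      = bin_size k U"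
    using whole[of "sel j"] unfolding map_append sum_list_append pad by (simp only: list.map sum_list_simps add.assoc add_0_right)
  moreover have "sum_list (map (item_size k U idx el) (occ s j @ pad)) = bin_size k U" for s
    using occurs[of s "sel j"] unfolding map_append sum_list_append pad occ_def
    by (simp only: list.map sum_list_simps add.assoc add_0_right)
  ultimately show "length b = k \<and> sum_list (map (item_size k U idx el) b) = bin_size k U"
    using b k unfolding bins_def by (auto simp: pad_def occ_def simp del: map_append sum_list_append)
qed

lemma length_cover_items: "k \<ge> 3 \<Longrightarrow> length (cover_items k js el tok) = k * (4 * length js)"
proof -
  assume "k \<ge> 3"
  then obtain n where "k = n + 3" using le_Suc_ex by (metis add.commute)
  then show ?thesis
    by (simp add: cover_items_def length_concat comp_def triple_items_def sum_list_triv algebra_simps)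
qed

lemma item_size_pos: "0 < item_size k U idx el it"
  unfolding item_size_def by (cases "(U, idx, el, it)" rule: digits.cases) simp_all

lemma bin_size_pos: "0 < bin_size k U"
  by (simp add: bin_size_def target_def)

text \<open>The total size must be the number of bins times the bin size. All digits but the last
  balance within each triple. In the last one four bins need 8, slots and links give 6, so the
  tokens must give 2 per triple on average, where \<open>Diag\<close> contributes 2 for a token of
  value False.\<close>

definition balanced :: "'j list \<Rightarrow> (axis \<Rightarrow> 'j \<Rightarrow> bool) \<Rightarrow> bool" where
  "balanced js tok \<longleftrightarrow>
     (\<Sum>j\<leftarrow>js. of_bool (tok Row j) + of_bool (tok Col j) + (2 - 2 * of_bool (tok Diag j))) = 2 * length js"

lemma sum_cover_items:
  assumes ids: "ids_ok U idx el js" and k: "k \<ge> 3"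
    and bal: "balanced js tok"
  shows "sum_list (map (item_size k U idx el) (cover_items k js el tok)) = 4 * length js * bin_size k U"
proof -
  define Q where "Q = radix k U"
  \<comment> \<open>The digits of a bin without dummies and truth values, with 6 for three proper
    items. A triple makes up four of these; its truth digits are 6 from slots and links and
    \<open>t j\<close> from tokens.\<close>
  define B where "B = horner Q [6, 19, U, U, 2 * U, 0]"
  define t :: "'a \<Rightarrow> nat" where "t j = of_bool (tok Row j) + of_bool (tok Col j) + (2 - 2 * of_bool (tok Diag j))" for j
  have triple: "sum_list (map (item_size k U idx el) (triple_items el tok j)) = 4 * B + Q ^ 5 * (6 + t j)"
    if "j \<in> set js" for j
  proof -
    have bnd: "idx j \<le> U" "el Row j \<le> U" "el Col j \<le> U" "el Diag j \<le> U"
      using ids that by (auto simp: ids_ok_def)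
    \<comment> \<open>Naming the complements by additive equations turns the claim into a polynomial
      identity free of truncated subtraction.\<close>
    obtain i where i: "U = idx j + i" using bnd(1) le_Suc_ex by blast
    obtain r where r: "U = el Row j + r" using bnd(2) le_Suc_ex by blast
    obtain c where c: "U = el Col j + c" using bnd(3) le_Suc_ex by blast
    obtain d where d: "2 * U = el Diag j + d" using bnd(4) le_Suc_ex[of "el Diag j" "2 * U"] by auto
    have sub: "U - idx j = i" "U - el Row j = r" "U - el Col j = c" "2 * U - el Diag j = d"
      using i r c d by auto
    have B: "4 * B = 24 + Q * (76 + Q * (4 * U + Q * (4 * U + Q * (8 * U))))"
      by (simp add: B_def algebra_simps)
    have U: "4 * U = 2 * idx j + 2 * i + (i + idx j + U)" 
      "8 * U = 4 * U + r + el Row j + c + el Col j + (d + el Diag j)" using i r c d by auto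
    have "sum_list (map (item_size k U idx el) (triple_items el tok j))
      = 24 + Q * (76 + Q * ((2 * idx j + 2 * i + (i + idx j + U)) + Q * ((2 * idx j + 2 * i + (i + idx j + U))
         + Q * ((4 * U + r + el Row j + c + el Col j + (d + el Diag j)) + Q * (6 + t j)))))"
      unfolding triple_items_def item_size_def Q_def[symmetric]
      by (simp add: sub t_def distrib_left)
    then show ?thesis unfolding U(1)[symmetric] U(2)[symmetric] B by (simp add: distrib_left power_numeral_reduce)
  qed
  have "sum_list (map (item_size k U idx el) (concat (map (triple_items el tok) js)))
      = (\<Sum>j\<leftarrow>js. sum_list (map (item_size k U idx el) (triple_items el tok j)))"
    by (induction js) auto
  also have "\<dots> = (\<Sum>j\<leftarrow>js. 4 * B + Q ^ 5 * (6 + t j))"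
    using triple by (intro arg_cong[where f = sum_list]) auto
  also have "\<dots> = (4 * B + Q ^ 5 * 6) * length js + Q ^ 5 * (\<Sum>j\<leftarrow>js. t j)"
    by (induction js) (auto simp: algebra_simps)
  also have "(\<Sum>j\<leftarrow>js. t j) = 2 * length js" using bal unfolding balanced_def t_def .
  finally have "sum_list (map (item_size k U idx el) (cover_items k js el tok))
      = (4 * B + Q ^ 5 * 6) * length js + Q ^ 5 * (2 * length js) + (k - 3) * (4 * length js)"
    by (simp add: cover_items_def sum_list_replicate item_size_def[of k U idx el Dummy])
  also have "\<dots> = 4 * length js * (B + 2 * Q ^ 5 + (k - 3))" by (simp add: algebra_simps)
  also have "B + 2 * Q ^ 5 + (k - 3) = bin_size k U"
    using k by (simp add: B_def bin_size_def target_def Q_def algebra_simps power_numeral_reduce)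
  finally show ?thesis .
qed

theorem packable_iff_cover:
  assumes ids: "ids_ok U idx el js" and k: "k \<ge> 3"
    and bal: "balanced js tok"
  shows "packable k (map (\<lambda>it. real (item_size k U idx el it) / real (bin_size k U)) (cover_items k js el tok))
      (4 * length js) \<longleftrightarrow> (\<exists>sel. covers js el tok sel)" (is "?P \<longleftrightarrow> ?C")
proof
  assume ?P
  from packable_imp_partition[OF length_cover_items[OF k] sum_cover_items[OF ids k bal] bin_size_pos item_size_pos this]
  obtain bs where "mset (concat bs) = mset (cover_items k js el tok)"
    "\<And>b. b \<in> set bs \<Longrightarrow> length b = k \<and> sum_list (map (item_size k U idx el) b) = bin_size k U"
    by metis
  then show ?C using k by (intro cover_of_partition[OF ids, of k]) auto
next
  assume ?C
  then obtain sel where "covers js el tok sel" ..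
  from partition_of_cover[OF ids k this] obtain bs where
    "length bs = 4 * length js" "mset (concat bs) = mset (cover_items k js el tok)"
    "\<And>b. b \<in> set bs \<Longrightarrow> length b = k \<and> sum_list (map (item_size k U idx el) b) = bin_size k U"
    by metis
  then show ?P
    by (intro partition_imp_packable[OF bin_size_pos item_size_pos])
qed

section \<open>Tilings of a cylinder\<close>

type_synonym tile = "nat \<times> nat \<times> nat \<times> nat"

abbreviation lcol :: "tile \<Rightarrow> nat" where "lcol \<equiv> fst"
abbreviation bcol :: "tile \<Rightarrow> nat" where "bcol x \<equiv> fst (snd x)"
abbreviation rcol :: "tile \<Rightarrow> nat" where "rcol x \<equiv> fst (snd (snd x))"
abbreviation tcol :: "tile \<Rightarrow> nat" where "tcol x \<equiv> snd (snd (snd x))"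

definition tiling :: "tile set \<Rightarrow> nat \<Rightarrow> nat \<Rightarrow> (nat \<Rightarrow> nat) \<Rightarrow> nat \<Rightarrow> (nat \<Rightarrow> nat \<Rightarrow> tile) \<Rightarrow> bool" where
  "tiling X W H bc tc \<theta> \<longleftrightarrow>
     (\<forall>t < H. \<forall>i < W. \<theta> t i \<in> X \<and> rcol (\<theta> t i) = lcol (\<theta> t (Suc i mod W))) \<and>
     (\<forall>i < W. bcol (\<theta> 0 i) = bc i \<and> tcol (\<theta> (H - 1) i) = tc) \<and>
     (\<forall>t i. Suc t < H \<longrightarrow> i < W \<longrightarrow> tcol (\<theta> t i) = bcol (\<theta> (Suc t) i))"

text \<open>
  Every tile at every cell is represented by two triples that share an element on the
  diagonal axis: the lower one covers its left and bottom edge, the upper one its right and top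
  edge. Using the tile means to select the lower and not to select the upper triple. By the choice
  of the tokens, every edge then has the same number of used tiles with a given colour on either side.
\<close>

datatype key = Low nat nat nat | Up nat nat nat | Bot nat | Top nat

lemma distinct_concat_map:
  assumes "distinct xs" "\<And>x. x \<in> set xs \<Longrightarrow> distinct (f x)"
    "\<And>x y. x \<in> set xs \<Longrightarrow> y \<in> set xs \<Longrightarrow> x \<noteq> y \<Longrightarrow> set (f x) \<inter> set (f y) = {}"
  shows "distinct (concat (map f xs))"
  using assms
proof (induction xs)
  case (Cons x xs)
  have "distinct (concat (map f xs))" by (rule Cons.IH) (use Cons.prems in auto)
  moreover have "set (f x) \<inter> set (f y) = {}" if "y \<in> set xs" for y
    using Cons.prems(1,3) that by (metis distinct.simps(2) list.set_intros)
  ultimately show ?case using Cons.prems(2)[of x] by auto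
qed simp

text \<open>Colours below the number of tiles allow one numbering \<open>cell\<close> for both the
  colours at edges and the tiles in cells.\<close>

locale tile_cover =
  fixes ts :: "tile list" and W H :: nat and bc :: "nat \<Rightarrow> nat" and tc :: nat
  assumes W: "W > 0" and H: "H > 0"
    and colours: "\<And>x. x \<in> set ts \<Longrightarrow> lcol x < length ts \<and> bcol x < length ts \<and> rcol x < length ts \<and> tcol x < length ts"
    and bc: "\<And>i. i < W \<Longrightarrow> bc i < length ts" and tc: "tc < length ts"
begin

abbreviation "D \<equiv> length ts"

definition cell :: "nat \<Rightarrow> nat \<Rightarrow> nat \<Rightarrow> nat" where
  "cell t i c = (t * W + i) * D + c"

text \<open>A cell owns its left and bottom edge; its right edge is the left edge of the next column
  and its top edge the bottom edge of the next row. Off the vertical axis the border triples receive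
  private elements in the rows H and H + 1, so that their tokens alone decide whether they are
  selected.\<close>

fun place :: "axis \<Rightarrow> key \<Rightarrow> nat \<times> nat \<times> nat" where
  "place Row (Low t i n) = (t, i, lcol (ts ! n))"
| "place Row (Up t i n) = (t, Suc i mod W, rcol (ts ! n))"
| "place Col (Low t i n) = (t, i, bcol (ts ! n))"
| "place Col (Up t i n) = (Suc t, i, tcol (ts ! n))"
| "place Diag (Low t i n) = (t, i, n)"
| "place Diag (Up t i n) = (t, i, n)"
| "place Col (Bot i) = (0, i, bc i)"
| "place Col (Top i) = (H, i, tc)"
| "place _ (Bot i) = (H, i, 0)"
| "place _ (Top i) = (Suc H, i, 0)"

definition el :: "axis \<Rightarrow> key \<Rightarrow> nat" where
  "el s j = (case place s j of (t, i, c) \<Rightarrow> cell t i c)"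

fun idx :: "key \<Rightarrow> nat" where
  "idx (Low t i n) = 2 * cell t i n"
| "idx (Up t i n) = 2 * cell t i n + 1"
| "idx (Bot i) = 2 * cell H i 0"
| "idx (Top i) = 2 * cell H i 0 + 1"

text \<open>At an inner edge the counts say that selected lower and selected upper triples together
  are as many as all upper ones: as many lower triples are selected as upper ones are not. On the
  diagonal exactly one of the two triples is selected. The private tokens keep \<open>Bot i\<close>
  unselected and \<open>Top i\<close> selected; vertically, \<open>Bot i\<close> thus adds one
  selection of colour \<open>bc i\<close> in row 0, and \<open>Top i\<close> takes one away at the
  upper end.\<close>

fun tok :: "axis \<Rightarrow> key \<Rightarrow> bool" where
  "tok s (Low t i n) = False"
| "tok s (Up t i n) = True"
| "tok s (Bot i) = (s = Col)"
| "tok s (Top i) = (s \<noteq> Col)"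

definition keys :: "key list" where
  "keys = concat (map (\<lambda>t. concat (map (\<lambda>i. concat (map (\<lambda>n. [Low t i n, Up t i n]) [0..<D])) [0..<W])) [0..<H])
     @ concat (map (\<lambda>i. [Bot i, Top i]) [0..<W])"

text \<open>The rows 0 to H + 1 occur in places, and indices are twice a cell number plus 0 or
  1.\<close>

definition bound :: nat where
  "bound = 2 * (H + 2) * W * D"

section \<open>Range and injectivity of the numbering\<close>

lemma D: "D > 0"
  by (rule le_less_trans[OF le0 tc])

lemma set_keys: "j \<in> set keys \<longleftrightarrow> (case j of
    Low t i n \<Rightarrow> t < H \<and> i < W \<and> n < D | Up t i n \<Rightarrow> t < H \<and> i < W \<and> n < D
  | Bot i \<Rightarrow> i < W | Top i \<Rightarrow> i < W)"
  by (cases j) (auto simp: keys_def)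

lemma length_keys: "length keys = 2 * (H * W * D) + 2 * W"
  by (simp add: keys_def length_concat comp_def sum_list_triv)

lemma mult_add_inj: "a * n + b = a' * n + b' \<Longrightarrow> b < n \<Longrightarrow> b' < n \<Longrightarrow> a = a' \<and> b = (b'::nat)"
  by (metis add.commute div_mult_self1 div_less add_0 add_left_cancel less_nat_zero_code mult.commute)

lemma cell_eq_iff:
  assumes "i < W" "i' < W" "c < D" "c' < D"
  shows "cell t i c = cell t' i' c' \<longleftrightarrow> t = t' \<and> i = i' \<and> c = c'"
proof
  assume "cell t i c = cell t' i' c'"
  from mult_add_inj[OF this[unfolded cell_def] assms(3,4)]
  show "t = t' \<and> i = i' \<and> c = c'" using mult_add_inj assms(1,2) by blast
qed simp

lemma cell_less: "i < W \<Longrightarrow> c < D \<Longrightarrow> t < n \<Longrightarrow> cell t i c < n * W * D"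
proof -
  assume a: "i < W" "c < D" "t < n"
  have "t * W + i < Suc t * W" using a by simp
  also have "\<dots> \<le> n * W" using a by (intro mult_le_mono1) simp
  finally have "Suc (t * W + i) * D \<le> n * W * D" by (intro mult_le_mono1) simp
  then show ?thesis using a by (simp add: cell_def)
qed

lemma place_range:
  assumes "j \<in> set keys" "place s j = (t, i, c)"
  shows "t \<le> Suc H" "i < W" "c < D"
proof -
  have n: "lcol (ts ! n) < D" "bcol (ts ! n) < D" "rcol (ts ! n) < D" "tcol (ts ! n) < D" if "n < D" for n
    using colours[OF nth_mem[OF that]] by auto
  have "t \<le> Suc H \<and> i < W \<and> c < D"
  proof (cases j)
    case (Low t' i' n')
    then show ?thesis using assms n[of n'] by (cases s) (auto simp: set_keys)
  next
    case (Up t' i' n')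
    then show ?thesis using assms n[of n'] W by (cases s) (auto simp: set_keys)
  next
    case (Bot i')
    then show ?thesis using assms bc[of i'] D H by (cases s) (auto simp: set_keys)
  next
    case (Top i')
    then show ?thesis using assms tc D by (cases s) (auto simp: set_keys)
  qed
  then show "t \<le> Suc H" "i < W" "c < D" by auto
qed

lemma el_eq_iff:
  assumes "j \<in> set keys" "j' \<in> set keys"
  shows "el s j = el s j' \<longleftrightarrow> place s j = place s j'"
proof
  assume eq: "el s j = el s j'"
  obtain t i c t' i' c' where p: "place s j = (t, i, c)" "place s j' = (t', i', c')"
    by (metis prod_cases3)
  show "place s j = place s j'"
    using eq cell_eq_iff[of i i' c c' t t'] place_range(2,3)[OF assms(1) p(1)] place_range(2,3)[OF assms(2) p(2)]
    by (simp add: el_def p)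
qed (simp add: el_def)

lemma ids_ok_keys: "ids_ok bound idx el keys"
proof -
  have "inj_on idx (set keys)"
  proof (rule inj_onI)
    fix j j' assume j: "j \<in> set keys" "j' \<in> set keys" "idx j = idx j'"
    have par: "2 * a \<noteq> Suc (2 * b)" "Suc (2 * b) \<noteq> 2 * a" for a b :: nat by presburger+
    show "j = j'"
      by (cases j; cases j'; use j D W in \<open>simp add: set_keys par cell_eq_iff\<close>)
  qed
  moreover have "distinct keys"
    unfolding keys_def distinct_append by (intro conjI distinct_concat_map) auto
  moreover have "idx j \<le> bound" if "j \<in> set keys" for j
  proof -
    have lt: "cell t i c < (H + 2) * W * D" if "t \<le> H" "i < W" "c < D" for t i c
      using that by (intro cell_less) auto
    have b: "2 * cell t i c + 1 \<le> bound" if "t \<le> H" "i < W" "c < D" for t i c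
    proof -
      have "Suc (cell t i c) \<le> (H + 2) * W * D" using lt[OF that] by simp
      moreover have "bound = 2 * ((H + 2) * W * D)" by (simp only: bound_def mult.assoc)
      ultimately show ?thesis by linarith
    qed
    show ?thesis
    proof (cases j)
      case (Low t i n)
      then show ?thesis using that b[of t i n] by (simp add: set_keys)
    next
      case (Up t i n)
      then show ?thesis using that b[of t i n] by (simp add: set_keys)
    next
      case (Bot i)
      then show ?thesis using that b[of H i 0] D by (simp add: set_keys)
    next
      case (Top i)
      then show ?thesis using that b[of H i 0] D by (simp add: set_keys)
    qed
  qed
  moreover have "el s j \<le> bound" if "j \<in> set keys" for j s
  proof -
    obtain t i c where p: "place s j = (t, i, c)" by (metis prod_cases3)
    have "cell t i c < (H + 2) * W * D" using place_range[OF that p] by (intro cell_less) auto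
    moreover have "bound = 2 * ((H + 2) * W * D)" by (simp only: bound_def mult.assoc)
    ultimately show ?thesis by (simp add: el_def p)
  qed
  ultimately show ?thesis unfolding ids_ok_def by blast
qed

lemma balance_keys: "balanced keys tok"
proof -
  let ?f = "\<lambda>j. of_bool (tok Row j) + of_bool (tok Col j) + (2 - 2 * of_bool (tok Diag j)) :: nat"
  have sc: "sum_list (map ?f (concat (map g xs))) = (\<Sum>x\<leftarrow>xs. sum_list (map ?f (g x)))" for g and xs :: "nat list"
    by (induction xs) auto
  show ?thesis unfolding balanced_def length_keys
    unfolding keys_def map_append sum_list_append sc by (simp add: sum_list_triv)
qed

abbreviation keys_at :: "axis \<Rightarrow> nat \<times> nat \<times> nat \<Rightarrow> (key \<Rightarrow> bool) \<Rightarrow> key set" where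
  "keys_at s c P \<equiv> {j \<in> set keys. place s j = c \<and> P j}"

text \<open>The keys are distinct, so multiplicities are cardinalities. It suffices to count truth
  value True, as both sides have the same total at each element; elements may be replaced by places
  since the numbering is injective.\<close>

lemma covers_iff_card:
  "covers keys el tok sel \<longleftrightarrow>
     (\<forall>s. \<forall>p. card (keys_at s p sel) = card (keys_at s p (tok s)))"
proof -
  have dist: "distinct keys" using ids_ok_keys by (simp add: ids_ok_def)
  have len: "length (filter P keys) = card {j \<in> set keys. P j}" for P
    using distinct_card[OF distinct_filter[OF dist, of P]] by simp
  have compl: "card {j \<in> set keys. P j \<and> Q j} + card {j \<in> set keys. P j \<and> \<not> Q j} = card {j \<in> set keys. P j}" for P Q
    by (subst card_Un_disjoint[symmetric]) (auto intro: arg_cong[where f = card])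
  have "covers keys el tok sel \<longleftrightarrow> (\<forall>s e v. card {j \<in> set keys. el s j = e \<and> sel j = v}
      = card {j \<in> set keys. el s j = e \<and> tok s j = v})"
    unfolding covers_def multiset_eq_iff count_mset_map len by simp
  also have "\<dots> \<longleftrightarrow> (\<forall>s e. card {j \<in> set keys. el s j = e \<and> sel j} = card {j \<in> set keys. el s j = e \<and> tok s j})"
  proof safe
    fix s e assume "\<forall>s e v. card {j \<in> set keys. el s j = e \<and> sel j = v} = card {j \<in> set keys. el s j = e \<and> tok s j = v}"
    from this[rule_format, of s e True]
    show "card {j \<in> set keys. el s j = e \<and> sel j} = card {j \<in> set keys. el s j = e \<and> tok s j}" by simp
  next
    fix s e v assume "\<forall>s e. card {j \<in> set keys. el s j = e \<and> sel j} = card {j \<in> set keys. el s j = e \<and> tok s j}"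
    from this[rule_format, of s e]
    show "card {j \<in> set keys. el s j = e \<and> sel j = v} = card {j \<in> set keys. el s j = e \<and> tok s j = v}"
      using compl[of "\<lambda>j. el s j = e" sel] compl[of "\<lambda>j. el s j = e" "tok s"] by (cases v) simp_all
  qed
  also have "\<dots> \<longleftrightarrow> (\<forall>s p. card (keys_at s p sel) = card (keys_at s p (tok s)))"
  proof -
    have same: "{j \<in> set keys. el s j = el s j0 \<and> P j} = (keys_at s (place s j0) P)"
      if "j0 \<in> set keys" for s j0 P using el_eq_iff that by blast
    have none: "{j \<in> set keys. f j = y \<and> P j} = {}" if "y \<notin> f ` set keys" for f :: "key \<Rightarrow> 'z" and y P
      using that by auto
    show ?thesis
    proof (intro all_cong1 iffI allI)
      fix s p assume a: "\<forall>e. card {j \<in> set keys. el s j = e \<and> sel j} = card {j \<in> set keys. el s j = e \<and> tok s j}"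
      show "card (keys_at s p sel) = card (keys_at s p (tok s))"
      proof (cases "p \<in> place s ` set keys")
        case True
        then obtain j0 where "j0 \<in> set keys" "p = place s j0" by blast
        then show ?thesis using a[rule_format, of "el s j0"] by (simp add: same)
      qed (simp add: none)
    next
      fix s e assume a: "\<forall>p. card (keys_at s p sel) = card (keys_at s p (tok s))"
      show "card {j \<in> set keys. el s j = e \<and> sel j} = card {j \<in> set keys. el s j = e \<and> tok s j}"
      proof (cases "e \<in> el s ` set keys")
        case True
        then obtain j0 where "j0 \<in> set keys" "e = el s j0" by blast
        then show ?thesis using a[rule_format, of "place s j0"] by (simp add: same)
      qed (simp add: none)
    qed
  qed
  finally show ?thesis .
qed

section \<open>Counting the triples at an edge and in a cell\<close>

lemma Suc_mod_inj: "Suc i mod W = Suc i' mod W \<Longrightarrow> i < W \<Longrightarrow> i' < W \<Longrightarrow> i = i'"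
  by (auto simp: mod_Suc split: if_splits)

lemma card_place_Row:
  assumes "t < H" "i < W"
  shows "card (keys_at Row (t, Suc i mod W, c) P)
    = card {n. n < D \<and> lcol (ts ! n) = c \<and> P (Low t (Suc i mod W) n)}
    + card {n. n < D \<and> rcol (ts ! n) = c \<and> P (Up t i n)}"
proof -
  have "(keys_at Row (t, Suc i mod W, c) P)
      = Low t (Suc i mod W) ` {n. n < D \<and> lcol (ts ! n) = c \<and> P (Low t (Suc i mod W) n)}
      \<union> Up t i ` {n. n < D \<and> rcol (ts ! n) = c \<and> P (Up t i n)}" (is "?A = ?B")
  proof (rule set_eqI)
    fix j show "j \<in> ?A \<longleftrightarrow> j \<in> ?B"
      using assms W by (cases j) (auto simp: set_keys dest: Suc_mod_inj)
  qed
  then show ?thesis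
    by (simp only:) (subst card_Un_disjoint, auto simp: card_image inj_on_def)
qed

lemma card_place_Col:
  assumes "i < W"
  shows "card (keys_at Col (t, i, c) P)
    = (if t < H then card {n. n < D \<and> bcol (ts ! n) = c \<and> P (Low t i n)} else 0)
    + (if 0 < t \<and> t \<le> H then card {n. n < D \<and> tcol (ts ! n) = c \<and> P (Up (t - 1) i n)} else 0)
    + of_bool (t = 0 \<and> bc i = c \<and> P (Bot i)) + of_bool (t = H \<and> tc = c \<and> P (Top i))"
proof -
  let ?L = "if t < H then Low t i ` {n. n < D \<and> bcol (ts ! n) = c \<and> P (Low t i n)} else {}"
  let ?U = "if 0 < t \<and> t \<le> H then Up (t - 1) i ` {n. n < D \<and> tcol (ts ! n) = c \<and> P (Up (t - 1) i n)} else {}"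
  let ?X = "if t = 0 \<and> bc i = c \<and> P (Bot i) then {Bot i} else {}"
  let ?Y = "if t = H \<and> tc = c \<and> P (Top i) then {Top i} else {}"
  have eq: "(keys_at Col (t, i, c) P) = ?L \<union> ?U \<union> ?X \<union> ?Y" (is "?A = ?B")
  proof (rule set_eqI)
    fix j show "j \<in> ?A \<longleftrightarrow> j \<in> ?B"
      using assms H by (cases j; cases t) (auto simp: set_keys)
  qed
  have "card (?L \<union> ?U \<union> ?X \<union> ?Y) = card ?L + card ?U + card ?X + card ?Y"
    by (subst card_Un_disjoint; (auto; fail)?)+
  then show ?thesis unfolding eq by (simp add: card_image inj_on_def)
qed

lemma card_place_Diag:
  assumes "t < H" "i < W" "n < D"
  shows "card (keys_at Diag (t, i, n) P) = of_bool (P (Low t i n)) + of_bool (P (Up t i n))"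
proof -
  have "(keys_at Diag (t, i, n) P)
      = (if P (Low t i n) then {Low t i n} else {}) \<union> (if P (Up t i n) then {Up t i n} else {})" (is "?A = ?B")
  proof (rule set_eqI)
    fix j show "j \<in> ?A \<longleftrightarrow> j \<in> ?B"
      using assms by (cases j) (auto simp: set_keys)
  qed
  then show ?thesis by simp
qed

lemma card_place_Bot_Top:
  assumes "i < W" "s \<noteq> Col"
  shows "card (keys_at s (H, i, 0) P) = of_bool (P (Bot i))"
    and "card (keys_at s (Suc H, i, 0) P) = of_bool (P (Top i))"
proof -
  have 1: "(keys_at s (H, i, 0) P) = (if P (Bot i) then {Bot i} else {})" (is "?A = ?B")
  proof (rule set_eqI)
    fix j show "j \<in> ?A \<longleftrightarrow> j \<in> ?B"
      using assms by (cases j; cases s) (auto simp: set_keys)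
  qed
  have 2: "(keys_at s (Suc H, i, 0) P) = (if P (Top i) then {Top i} else {})" (is "?A = ?B")
  proof (rule set_eqI)
    fix j show "j \<in> ?A \<longleftrightarrow> j \<in> ?B"
      using assms by (cases j; cases s) (auto simp: set_keys)
  qed
  show "card (keys_at s (H, i, 0) P) = of_bool (P (Bot i))"
    "card (keys_at s (Suc H, i, 0) P) = of_bool (P (Top i))"
    unfolding 1 2 by simp_all
qed

text \<open>Counting by colour cannot tell tiles of the same colour apart, but a single one in class
  \<open>c0\<close> and none in all other classes leave exactly one tile.\<close>

lemma card_unique_iff:
  "(\<forall>c. card {n. n < N \<and> f n = c \<and> S n} = of_bool (c = c0)) \<longleftrightarrow> (\<exists>m < N. f m = c0 \<and> (\<forall>n < N. S n \<longleftrightarrow> n = m))"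
  for N :: nat
proof
  assume a: "\<forall>c. card {n. n < N \<and> f n = c \<and> S n} = of_bool (c = c0)"
  then have "card {n. n < N \<and> f n = c0 \<and> S n} = 1" by simp
  then obtain m where m: "{n. n < N \<and> f n = c0 \<and> S n} = {m}" by (rule card_1_singletonE)
  have "f n = c0" if "n < N" "S n" for n
  proof (rule ccontr)
    assume "f n \<noteq> c0"
    then have "{k. k < N \<and> f k = f n \<and> S k} = {}" using a[rule_format, of "f n"] by simp
    then show False using that by auto
  qed
  then show "\<exists>m < N. f m = c0 \<and> (\<forall>n < N. S n \<longleftrightarrow> n = m)" using m by blast
next
  assume "\<exists>m < N. f m = c0 \<and> (\<forall>n < N. S n \<longleftrightarrow> n = m)"
  then obtain m where m: "m < N" "f m = c0" "\<And>n. n < N \<Longrightarrow> S n \<longleftrightarrow> n = m" by blast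
  then have "{n. n < N \<and> f n = c \<and> S n} = (if c = c0 then {m} else {})" for c by auto
  then show "\<forall>c. card {n. n < N \<and> f n = c \<and> S n} = of_bool (c = c0)" by simp
qed

lemma card_compl: "card {n. n < N \<and> f n = c \<and> S n} + card {n. n < N \<and> f n = c \<and> \<not> S n} = card {n. n < N \<and> f n = c}"
  for N :: nat
  by (subst card_Un_disjoint[symmetric]) (auto intro: arg_cong[where f = card])

abbreviation cnt :: "(tile \<Rightarrow> nat) \<Rightarrow> nat \<Rightarrow> (nat \<Rightarrow> bool) \<Rightarrow> nat" where
  "cnt f c S \<equiv> card {n. n < D \<and> f (ts ! n) = c \<and> S n}"

text \<open>Nothing local forces one used tile per cell. In row 0 the prescribed bottom colour does;
  its top colour then gives the counts of bottom colours in the row above, and so on upwards. Once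
  cells hold single tiles, equal counts at an edge mean equal colours.\<close>

lemma tiling_of_cover:
  assumes "covers keys el tok sel"
  shows "\<exists>\<theta>. tiling (set ts) W H bc tc \<theta>"
proof -
  note cov = assms[unfolded covers_iff_card, rule_format]
  let ?S = "\<lambda>t i n. sel (Low t i n)"
  have up: "sel (Up t i n) \<longleftrightarrow> \<not> ?S t i n" if "t < H" "i < W" "n < D" for t i n
    using cov[of Diag "(t, i, n)"] unfolding card_place_Diag[OF that] by (auto simp: of_bool_def split: if_splits)
  have bot: "\<not> sel (Bot i)" and top: "sel (Top i)" if "i < W" for i
    using cov[of Row "(H, i, 0)"] cov[of Row "(Suc H, i, 0)"] that
    by (simp_all add: card_place_Bot_Top of_bool_def split: if_splits)
  have upc: "{n. n < D \<and> f n = c \<and> sel (Up t i n)} = {n. n < D \<and> f n = c \<and> \<not> ?S t i n}"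
    if "t < H" "i < W" for f :: "nat \<Rightarrow> nat" and c t i using up[OF that] by auto
  have row: "cnt lcol c (?S t (Suc i mod W)) = cnt rcol c (?S t i)"
    if "t < H" "i < W" for t i c
    using cov[of Row "(t, Suc i mod W, c)"] card_compl[of D "\<lambda>n. rcol (ts ! n)" c "?S t i"]
    unfolding card_place_Row[OF that] upc[OF that, of "\<lambda>n. rcol (ts ! n)"] by simp
  have first: "cnt bcol c (?S 0 i) = of_bool (c = bc i)" if "i < W" for i c
    using cov[of Col "(0, i, c)"] H bot[OF that] unfolding card_place_Col[OF that] by auto
  have step: "cnt bcol c (?S (Suc t) i) = cnt tcol c (?S t i)"
    if "Suc t < H" "i < W" for t i c
    using cov[of Col "(Suc t, i, c)"] card_compl[of D "\<lambda>n. tcol (ts ! n)" c "?S t i"] that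
      upc[OF Suc_lessD[OF that(1)] that(2), of "\<lambda>n. tcol (ts ! n)" c]
    unfolding card_place_Col[OF that(2)] by simp
  have last: "cnt tcol c (?S (H - 1) i) = of_bool (c = tc)" if "i < W" for i c
    using cov[of Col "(H, i, c)"] card_compl[of D "\<lambda>n. tcol (ts ! n)" c "?S (H - 1) i"] H top[OF that]
      upc[of "H - 1" i "\<lambda>n. tcol (ts ! n)" c] that
    unfolding card_place_Col[OF that] by (auto simp: of_bool_def split: if_splits)
  have "\<exists>m < D. \<forall>n < D. ?S t i n \<longleftrightarrow> n = m" if "t < H" "i < W" for t i
    using that(1)
  proof (induction t)
    case 0
    show ?case using card_unique_iff[of D "\<lambda>n. bcol (ts ! n)" "?S 0 i" "bc i"] first[OF that(2)] by auto
  next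
    case (Suc t)
    then obtain m where m: "m < D" "\<forall>n < D. ?S t i n \<longleftrightarrow> n = m" by auto
    then have "cnt tcol c (?S t i) = of_bool (c = tcol (ts ! m))" for c
      using card_unique_iff[of D "\<lambda>n. tcol (ts ! n)" "?S t i" "tcol (ts ! m)"] by blast
    then have "cnt bcol c (?S (Suc t) i) = of_bool (c = tcol (ts ! m))" for c
      using step[OF Suc.prems that(2)] by simp
    then show ?case using card_unique_iff[of D "\<lambda>n. bcol (ts ! n)" "?S (Suc t) i" "tcol (ts ! m)"] by auto
  qed
  then obtain m where m: "m t i < D" "\<forall>n < D. ?S t i n \<longleftrightarrow> n = m t i" if "t < H" "i < W" for t i
    by metis
  have one: "card {n. n < D \<and> f n = c \<and> ?S t i n} = of_bool (c = f (m t i))" if "t < H" "i < W"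
    for f :: "nat \<Rightarrow> nat" and c t i
    using card_unique_iff[of D f "?S t i" "f (m t i)"] m[OF that] by blast
  have eqI: "x = y" if "\<And>c. of_bool (c = x) = (of_bool (c = y) :: nat)" for x y :: nat
    using that[of x] by (simp add: of_bool_def split: if_splits)
  have "tiling (set ts) W H bc tc (\<lambda>t i. ts ! m t i)"
    unfolding tiling_def
  proof (intro conjI allI impI)
    fix t i assume ti: "t < H" "i < W"
    then show "ts ! m t i \<in> set ts" using m by simp
    have "Suc i mod W < W" using W by simp
    then show "rcol (ts ! m t i) = lcol (ts ! m t (Suc i mod W))"
      using row[OF ti] one[OF ti, of "\<lambda>n. rcol (ts ! n)"] one[OF ti(1), of "Suc i mod W" "\<lambda>n. lcol (ts ! n)"]
      by (intro eqI[of "rcol (ts ! m t i)"]) simp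
  next
    fix i assume i: "i < W"
    show "bcol (ts ! m 0 i) = bc i"
      using first[OF i] one[OF H i, of "\<lambda>n. bcol (ts ! n)"] by (intro eqI[of "bcol (ts ! m 0 i)"]) simp
    show "tcol (ts ! m (H - 1) i) = tc"
      using last[OF i] one[OF _ i, of "H - 1" "\<lambda>n. tcol (ts ! n)"] H
      by (intro eqI[of "tcol (ts ! m (H - 1) i)"]) simp
  next
    fix t i assume ti: "Suc t < H" "i < W"
    show "tcol (ts ! m t i) = bcol (ts ! m (Suc t) i)"
      using step[OF ti] one[OF ti, of "\<lambda>n. bcol (ts ! n)"] one[OF Suc_lessD[OF ti(1)] ti(2), of "\<lambda>n. tcol (ts ! n)"]
      by (intro eqI[of "tcol (ts ! m t i)"]) simp
  qed
  then show ?thesis by blast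
qed

text \<open>The lower triple of the used tile and the upper triples of all other tiles are selected.
  The counts need checking only at places of keys, all other places having no triples at
  all.\<close>

lemma cover_of_tiling:
  assumes "tiling (set ts) W H bc tc \<theta>"
  shows "\<exists>sel. covers keys el tok sel"
proof -
  have til: "\<theta> t i \<in> set ts" "rcol (\<theta> t i) = lcol (\<theta> t (Suc i mod W))"
      "bcol (\<theta> 0 i) = bc i" "tcol (\<theta> (H - 1) i) = tc" if "t < H" "i < W" for t i
    using assms that by (auto simp: tiling_def)
  have til_step: "tcol (\<theta> t i) = bcol (\<theta> (Suc t) i)" if "Suc t < H" "i < W" for t i
    using assms that by (auto simp: tiling_def)
  have "\<exists>m < D. ts ! m = \<theta> t i" if "t < H" "i < W" for t i
    using til(1)[OF that] by (metis in_set_conv_nth)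
  then obtain m where m: "m t i < D" "ts ! m t i = \<theta> t i" if "t < H" "i < W" for t i
    by metis
  define sel where "sel j = (case j of Low t i n \<Rightarrow> n = m t i | Up t i n \<Rightarrow> n \<noteq> m t i | Bot i \<Rightarrow> False | Top i \<Rightarrow> True)" for j
  have one: "card {n. n < D \<and> f (ts ! n) = c \<and> n = m t i} = of_bool (c = f (\<theta> t i))" if "t < H" "i < W"
    for f :: "tile \<Rightarrow> nat" and c t i
    using card_unique_iff[of D "\<lambda>n. f (ts ! n)" "\<lambda>n. n = m t i" "f (\<theta> t i)"] m[OF that] by auto
  have two: "of_bool (c = f (\<theta> t i)) + card {n. n < D \<and> f (ts ! n) = c \<and> n \<noteq> m t i} = card {n. n < D \<and> f (ts ! n) = c}"
    if "t < H" "i < W" for f :: "tile \<Rightarrow> nat" and c t i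
    using card_compl[of D "\<lambda>n. f (ts ! n)" c "\<lambda>n. n = m t i"] one[OF that] by simp
  have row: "card (keys_at Row (t, Suc i mod W, c) sel)
      = card (keys_at Row (t, Suc i mod W, c) (tok Row))" if "t < H" "i < W" for t i c
  proof -
    have "Suc i mod W < W" using W by simp
    then show ?thesis unfolding card_place_Row[OF that]
      using one[OF that(1), of "Suc i mod W" lcol c] two[OF that, of c rcol] til(2)[OF that] by (simp add: sel_def)
  qed
  have col: "card (keys_at Col (t, i, c) sel)
      = card (keys_at Col (t, i, c) (tok Col))" if "t \<le> H" "i < W" for t i c
  proof -
    have "t = 0 \<or> 0 < t \<and> t < H \<or> 0 < t \<and> t = H" using that(1) by linarith
    then consider "t = 0" | "0 < t" "t < H" | "0 < t" "t = H" by blast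
    then show ?thesis
    proof cases
      case 1
      then show ?thesis unfolding card_place_Col[OF that(2)]
        using one[OF H that(2), of bcol c] til(3)[OF H that(2)] H by (auto simp: sel_def)
    next
      case 2
      then have t: "t - 1 < H" "Suc (t - 1) = t" by auto
      show ?thesis unfolding card_place_Col[OF that(2)]
        using one[OF 2(2) that(2), of bcol c] two[OF t(1) that(2), of c tcol]
          til_step[of "t - 1" i] that(2) 2 t(2) by (simp add: sel_def)
    next
      case 3
      then have "H - 1 < H" by simp
      then show ?thesis unfolding card_place_Col[OF that(2)]
        using two[OF _ that(2), of "H - 1" c tcol] til(4)[OF H that(2)] 3 by (auto simp: sel_def)
    qed
  qed
  have "card (keys_at s (place s j0) sel) = card (keys_at s (place s j0) (tok s))"
    if j0: "j0 \<in> set keys" for s j0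
  proof (cases s)
    case Row
    show ?thesis
    proof (cases j0)
      case (Low t i n)
      then have ti: "t < H" "i < W" using j0 by (auto simp: set_keys)
      define i' where "i' = (if i = 0 then W - 1 else i - 1)"
      have "i' < W" "i = Suc i' mod W" using ti W by (auto simp: i'_def mod_Suc)
      then show ?thesis using row[OF ti(1), of i' "lcol (ts ! n)"] Low Row by simp
    next
      case (Up t i n)
      then have "t < H" "i < W" using j0 by (simp_all add: set_keys)
      then show ?thesis using row[of t i "rcol (ts ! n)"] Up Row by simp
    next
      case (Bot i)
      then have "i < W" using j0 by (simp add: set_keys)
      then show ?thesis using Bot Row by (simp add: card_place_Bot_Top) (simp add: sel_def)
    next
      case (Top i)
      then have "i < W" using j0 by (simp add: set_keys)
      then show ?thesis using Top Row by (simp add: card_place_Bot_Top) (simp add: sel_def)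
    qed
  next
    case Col
    obtain t i c where p: "place Col j0 = (t, i, c)" by (metis prod_cases3)
    have "t \<le> H" by (cases j0; use j0 p in \<open>auto simp: set_keys\<close>)
    then show ?thesis using col[of t i c] place_range[OF j0 p] p Col by simp
  next
    case Diag
    show ?thesis
    proof (cases j0)
      case (Low t i n)
      then have "t < H" "i < W" "n < D" using j0 by (simp_all add: set_keys)
      then show ?thesis using Low Diag by (simp add: card_place_Diag) (simp add: sel_def)
    next
      case (Up t i n)
      then have "t < H" "i < W" "n < D" using j0 by (simp_all add: set_keys)
      then show ?thesis using Up Diag by (simp add: card_place_Diag) (simp add: sel_def)
    next
      case (Bot i)
      then have "i < W" using j0 by (simp add: set_keys)
      then show ?thesis using Bot Diag by (simp add: card_place_Bot_Top) (simp add: sel_def)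
    next
      case (Top i)
      then have "i < W" using j0 by (simp add: set_keys)
      then show ?thesis using Top Diag by (simp add: card_place_Bot_Top) (simp add: sel_def)
    qed
  qed
  then have "card (keys_at s p sel) = card (keys_at s p (tok s))" for s p
  proof (cases "p \<in> place s ` set keys")
    case False
    then have none: "(keys_at s p P) = {}" for P by auto
    show ?thesis unfolding none ..
  qed auto
  then show ?thesis unfolding covers_iff_card by blast
qed

theorem packable_iff_tiling:
  assumes "k \<ge> 3"
  shows "packable k (map (\<lambda>it. real (item_size k bound idx el it) / real (bin_size k bound)) (cover_items k keys el tok))
      (4 * length keys) \<longleftrightarrow> (\<exists>\<theta>. tiling (set ts) W H bc tc \<theta>)"
  using packable_iff_cover[OF ids_ok_keys assms balance_keys] tiling_of_cover cover_of_tiling by blast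

end

section \<open>Tilings from local rules\<close>

text \<open>
  A row of a cylinder evolves by a local rule that also depends on a value common to the whole row.
  The horizontal colours of a tile consist of two neighbouring cells and this value.
\<close>

definition evolution ::
  "('g \<Rightarrow> 'v \<Rightarrow> 'v \<Rightarrow> 'v \<Rightarrow> 'v \<Rightarrow> bool) \<Rightarrow> 'g set \<Rightarrow> 'v set \<Rightarrow> nat \<Rightarrow> nat \<Rightarrow> (nat \<Rightarrow> nat \<Rightarrow> 'v) \<Rightarrow> bool" where
  "evolution rule G V W H \<rho> \<longleftrightarrow> (\<forall>t < H. \<exists>g \<in> G. \<forall>i < W. \<rho> t i \<in> V \<and> \<rho> (Suc t) i \<in> V \<and>
     rule g (\<rho> t i) (\<rho> t (Suc i mod W)) (\<rho> t (Suc (Suc i) mod W)) (\<rho> (Suc t) (Suc i mod W)))"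

text \<open>The tile of a cell v with neighbours a and b. Adjacent tiles match iff their windows
  overlap consistently, and g is handed on along the row; h and n are arbitrary numberings of the
  colours.\<close>

definition rule_tiles ::
  "('g \<Rightarrow> 'v \<Rightarrow> 'v \<Rightarrow> 'v \<Rightarrow> 'v \<Rightarrow> bool) \<Rightarrow> 'g set \<Rightarrow> 'v set \<Rightarrow> ('v \<times> 'v \<times> 'g \<Rightarrow> nat) \<Rightarrow> ('v \<Rightarrow> nat) \<Rightarrow> tile set" where
  "rule_tiles rule G V h n = {(h (a, v, g), n v, h (v, b, g), n v') | a v b v' g.
     a \<in> V \<and> v \<in> V \<and> b \<in> V \<and> v' \<in> V \<and> g \<in> G \<and> rule g a v b v'}"

lemma finite_rule_tiles:
  assumes "finite V" "finite G"
  shows "finite (rule_tiles rule G V h n)"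
proof -
  have "rule_tiles rule G V h n \<subseteq> (h ` (V \<times> V \<times> G)) \<times> (n ` V) \<times> (h ` (V \<times> V \<times> G)) \<times> (n ` V)"
    by (auto simp: rule_tiles_def)
  then show ?thesis using assms by (meson finite_SigmaI finite_imageI finite_subset)
qed

text \<open>Injectivity of h and n recovers windows and cells from the colours. Matching sideways
  identifies each cell with the neighbour recorded next to it and propagates g from column 0 through
  the row.\<close>

lemma evolution_of_tiling:
  assumes til: "tiling (rule_tiles rule G V h n) W H (\<lambda>i. n (\<beta> i)) (n \<tau>) \<theta>"
    and inj: "inj_on h (V \<times> V \<times> G)" "inj_on n V" and WH: "W > 0" "H > 0"
    and in_V: "\<And>i. i < W \<Longrightarrow> \<beta> i \<in> V" "\<tau> \<in> V"
  obtains \<rho> where "evolution rule G V W H \<rho>" "\<And>i. i < W \<Longrightarrow> \<rho> 0 i = \<beta> i" "\<And>i. i < W \<Longrightarrow> \<rho> H i = \<tau>"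
proof -
  have "\<exists>a v b v' g. \<theta> t i = (h (a, v, g), n v, h (v, b, g), n v') \<and>
      a \<in> V \<and> v \<in> V \<and> b \<in> V \<and> v' \<in> V \<and> g \<in> G \<and> rule g a v b v'" if "t < H" "i < W" for t i
    using til that by (auto simp: tiling_def rule_tiles_def)
  then obtain a v b v' g where \<theta>: "\<And>t i. t < H \<Longrightarrow> i < W \<Longrightarrow>
      \<theta> t i = (h (a t i, v t i, g t i), n (v t i), h (v t i, b t i, g t i), n (v' t i))"
    and mem: "\<And>t i. t < H \<Longrightarrow> i < W \<Longrightarrow> a t i \<in> V \<and> v t i \<in> V \<and> b t i \<in> V \<and> v' t i \<in> V \<and> g t i \<in> G"
    and rule: "\<And>t i. t < H \<Longrightarrow> i < W \<Longrightarrow> rule (g t i) (a t i) (v t i) (b t i) (v' t i)"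
    by metis
  have mod: "Suc i mod W < W" for i using WH by simp
  have hor: "v t i = a t (Suc i mod W) \<and> b t i = v t (Suc i mod W) \<and> g t i = g t (Suc i mod W)"
    if "t < H" "i < W" for t i
  proof -
    have "rcol (\<theta> t i) = lcol (\<theta> t (Suc i mod W))" using til that by (auto simp: tiling_def)
    then have "h (v t i, b t i, g t i) = h (a t (Suc i mod W), v t (Suc i mod W), g t (Suc i mod W))"
      unfolding \<theta>[OF that] \<theta>[OF that(1) mod] by simp
    then have "(v t i, b t i, g t i) = (a t (Suc i mod W), v t (Suc i mod W), g t (Suc i mod W))"
      using mem[OF that] mem[OF that(1) mod] by (intro inj_onD[OF inj(1)]) auto
    then show ?thesis by simp
  qed
  have ver: "v' t i = v (Suc t) i" if "Suc t < H" "i < W" for t i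
  proof -
    have "tcol (\<theta> t i) = bcol (\<theta> (Suc t) i)" using til that by (auto simp: tiling_def)
    then have "n (v' t i) = n (v (Suc t) i)"
      unfolding \<theta>[OF that] \<theta>[OF Suc_lessD[OF that(1)] that(2)] by simp
    then show ?thesis using mem[OF that] mem[OF Suc_lessD[OF that(1)] that(2)]
      by (intro inj_onD[OF inj(2)]) auto
  qed
  have first: "v 0 i = \<beta> i" if "i < W" for i
  proof -
    have "bcol (\<theta> 0 i) = n (\<beta> i)" using til that by (auto simp: tiling_def)
    then have "n (v 0 i) = n (\<beta> i)" unfolding \<theta>[OF WH(2) that] by simp
    then show ?thesis using mem[OF WH(2) that] in_V that by (intro inj_onD[OF inj(2)]) auto
  qed
  have last: "v' (H - 1) i = \<tau>" if "i < W" for i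
  proof -
    have "H - 1 < H" using WH by simp
    have "tcol (\<theta> (H - 1) i) = n \<tau>" using til that by (auto simp: tiling_def)
    then have "n (v' (H - 1) i) = n \<tau>" unfolding \<theta>[OF \<open>H - 1 < H\<close> that] by simp
    then show ?thesis using mem[OF \<open>H - 1 < H\<close> that] in_V that by (intro inj_onD[OF inj(2)]) auto
  qed
  have const: "g t i = g t 0" if "t < H" "i < W" for t i
    using that(2)
  proof (induction i)
    case (Suc i)
    then show ?case using hor[OF that(1), of i] by simp
  qed simp
  \<comment> \<open>An evolution over H steps has H + 1 rows; the last is no tile's bottom and
    consists of the prescribed top value.\<close>
  define \<rho> where "\<rho> t i = (if t < H then v t i else \<tau>)" for t i
  have next_row: "\<rho> (Suc t) i = v' t i" if "t < H" "i < W" for t i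
  proof (cases "Suc t < H")
    case True
    then show ?thesis using ver that by (simp add: \<rho>_def)
  next
    case False
    with that(1) have "t = H - 1" by simp
    then show ?thesis using last that False by (simp add: \<rho>_def)
  qed
  show ?thesis
  proof
    show "evolution rule G V W H \<rho>"
      unfolding evolution_def
    proof (intro allI impI)
      fix t assume t: "t < H"
      show "\<exists>g \<in> G. \<forall>i < W. \<rho> t i \<in> V \<and> \<rho> (Suc t) i \<in> V \<and>
         rule g (\<rho> t i) (\<rho> t (Suc i mod W)) (\<rho> t (Suc (Suc i) mod W)) (\<rho> (Suc t) (Suc i mod W))"
      proof (intro bexI allI impI conjI)
        fix i assume i: "i < W"
        show "\<rho> t i \<in> V" "\<rho> (Suc t) i \<in> V"
          using mem[OF t i] t next_row[OF t i] by (auto simp: \<rho>_def)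
        have "rule (g t (Suc i mod W)) (a t (Suc i mod W)) (v t (Suc i mod W)) (b t (Suc i mod W)) (v' t (Suc i mod W))"
          by (rule rule[OF t mod])
        then show "rule (g t 0) (\<rho> t i) (\<rho> t (Suc i mod W)) (\<rho> t (Suc (Suc i) mod W)) (\<rho> (Suc t) (Suc i mod W))"
          using hor[OF t i] hor[OF t mod, of i] const[OF t mod, of i] t next_row[OF t mod, of i]
          by (simp add: \<rho>_def mod_Suc_eq)
      qed (use mem[OF t WH(1)] in auto)
    qed
  qed (use first WH in \<open>auto simp: \<rho>_def\<close>)
qed

lemma tiling_of_evolution:
  assumes ev: "evolution rule G V W H \<rho>" and W: "W > 0" and H: "H > 0"
    and ends: "\<And>i. i < W \<Longrightarrow> \<rho> 0 i = \<beta> i" "\<And>i. i < W \<Longrightarrow> \<rho> H i = \<tau>"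
  shows "\<exists>\<theta>. tiling (rule_tiles rule G V h n) W H (\<lambda>i. n (\<beta> i)) (n \<tau>) \<theta>"
proof -
  obtain g where g: "\<And>t. t < H \<Longrightarrow> g t \<in> G" and in_V: "\<And>t i. t < H \<Longrightarrow> i < W \<Longrightarrow> \<rho> t i \<in> V \<and> \<rho> (Suc t) i \<in> V"
    and rule: "\<And>t i. t < H \<Longrightarrow> i < W \<Longrightarrow>
      rule (g t) (\<rho> t i) (\<rho> t (Suc i mod W)) (\<rho> t (Suc (Suc i) mod W)) (\<rho> (Suc t) (Suc i mod W))"
    using ev unfolding evolution_def by metis
  define pr where "pr i = (if i = 0 then W - 1 else i - 1)" for i
  have pr: "pr i < W" "Suc (pr i) mod W = i" if "i < W" for i
    using that by (auto simp: pr_def)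
  have pr_Suc: "pr (Suc i mod W) = i" if "i < W" for i
    using that by (auto simp: pr_def mod_Suc)
  define \<theta> where "\<theta> t i = (h (\<rho> t (pr i), \<rho> t i, g t), n (\<rho> t i), h (\<rho> t i, \<rho> t (Suc i mod W), g t), n (\<rho> (Suc t) i))"
    for t i
  have "tiling (rule_tiles rule G V h n) W H (\<lambda>i. n (\<beta> i)) (n \<tau>) \<theta>"
    unfolding tiling_def
  proof (intro conjI allI impI)
    fix t i assume ti: "t < H" "i < W"
    have mod: "Suc i mod W < W" using W by simp
    have "Suc (Suc (pr i)) mod W = Suc i mod W" using pr(2)[OF ti(2)] by (metis mod_Suc_eq)
    then have "rule (g t) (\<rho> t (pr i)) (\<rho> t i) (\<rho> t (Suc i mod W)) (\<rho> (Suc t) i)"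
      using rule[OF ti(1) pr(1)[OF ti(2)]] pr(2)[OF ti(2)] by simp
    then show "\<theta> t i \<in> rule_tiles rule G V h n"
      using in_V[OF ti] in_V[OF ti(1) mod] in_V[OF ti(1) pr(1)[OF ti(2)]] g[OF ti(1)]
      unfolding rule_tiles_def \<theta>_def by blast
    show "rcol (\<theta> t i) = lcol (\<theta> t (Suc i mod W))"
      using pr_Suc[OF ti(2)] by (simp add: \<theta>_def)
  next
    fix i assume "i < W"
    then show "bcol (\<theta> 0 i) = n (\<beta> i)" "tcol (\<theta> (H - 1) i) = n \<tau>"
      using ends H by (simp_all add: \<theta>_def)
  next
    fix t i assume "Suc t < H" "i < W"
    then show "tcol (\<theta> t i) = bcol (\<theta> (Suc t) i)" by (simp add: \<theta>_def)
  qed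
  then show ?thesis by blast
qed

section \<open>Verifying computations as evolutions\<close>

text \<open>
  A cell records the machine state, whether its column is the one of the input start, and for every
  tape the symbol and the presence of the head. The common value of a row is the guessed list of
  scanned symbols; it is checked at the heads.
\<close>

type_synonym tcell = "nat \<times> bool \<times> nat list \<times> bool list"

abbreviation syms :: "tcell \<Rightarrow> nat list" where "syms c \<equiv> fst (snd (snd c))"
abbreviation heads :: "tcell \<Rightarrow> bool list" where "heads c \<equiv> snd (snd (snd c))"

text \<open>
  Class s w a is the colour below the first row at a column with start flag s and input symbol a;
  w tells whether a witness symbol may be guessed there.
\<close>

datatype colour = Class bool bool nat | Guess tcell | Run tcell | Accept

text \<open>Expresses the absorbing halting state as a transition: the scanned symbols are written
  back and no head moves.\<close>

definition move :: "tm \<Rightarrow> nat \<Rightarrow> nat list \<Rightarrow> nat \<times> (nat \<times> int) list" where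
  "move M q g = (if q = 1 then (1, map (\<lambda>a. (a, 0)) g) else delta M q g)"

definition next_cell :: "tm \<Rightarrow> nat list \<Rightarrow> tcell \<Rightarrow> tcell \<Rightarrow> tcell \<Rightarrow> tcell" where
  "next_cell M g b c d = (case move M (fst c) g of (q, acts) \<Rightarrow>
     (q, fst (snd c),
      map (\<lambda>j. if heads c ! j then fst (acts ! j) else syms c ! j) [0..<num_tapes M],
      map (\<lambda>j. heads c ! j \<and> snd (acts ! j) = 0 \<or> heads b ! j \<and> snd (acts ! j) = 1 \<or>
        heads d ! j \<and> snd (acts ! j) = - 1) [0..<num_tapes M]))"

definition start_cell :: "tm \<Rightarrow> bool \<Rightarrow> nat \<Rightarrow> nat \<Rightarrow> tcell" where
  "start_cell M s a u = (0, s, map (\<lambda>j. if j = 0 then a else if j = 1 then u else 0) [0..<num_tapes M], map (\<lambda>j. s) [0..<num_tapes M])"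

text \<open>The phases of the evolution: guessing a witness on tape 1; checking that it extends
  without gaps from the start column to the right, a separate row because the check must see the
  left neighbour's guess; simulating one step; accepting. Acceptance is tested only at the start
  column, where tape 2, the output of a machine with two inputs, must show the symbol 2 for
  True.\<close>

definition rule :: "tm \<Rightarrow> nat list \<Rightarrow> colour \<Rightarrow> colour \<Rightarrow> colour \<Rightarrow> colour \<Rightarrow> bool" where
  "rule M g y v z v' \<longleftrightarrow>
     (\<exists>s w a u. v = Class s w a \<and> u \<le> 2 \<and> (u \<noteq> 0 \<longrightarrow> w) \<and> v' = Guess (start_cell M s a u)) \<or>
     (\<exists>b c. y = Guess b \<and> v = Guess c \<and> v' = Run c \<and>
        (syms c ! 1 \<noteq> 0 \<longrightarrow> fst (snd c) \<or> syms b ! 1 \<noteq> 0)) \<or>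
     (\<exists>b c d. y = Run b \<and> v = Run c \<and> z = Run d \<and> v' = Run (next_cell M g b c d) \<and>
        (\<forall>j < num_tapes M. heads c ! j \<longrightarrow> syms c ! j = g ! j)) \<or>
     (\<exists>c. v = Run c \<and> v' = Accept \<and> (fst (snd c) \<longrightarrow> fst c = 1 \<and> syms c ! 2 = 2))"

definition scans :: "tm \<Rightarrow> nat list set" where
  "scans M = {g. set g \<subseteq> {..<num_syms M} \<and> length g = num_tapes M}"

definition cells :: "tm \<Rightarrow> tcell set" where
  "cells M = {..<num_states M} \<times> UNIV \<times> scans M \<times> {h. set h \<subseteq> UNIV \<and> length h = num_tapes M}"

definition colours_of :: "tm \<Rightarrow> colour set" where
  "colours_of M = {Class s w a | s w a. a \<le> 2} \<union> Guess ` cells M \<union> Run ` cells M \<union> {Accept}"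

lemma finite_scans: "finite (scans M)"
  unfolding scans_def by (intro finite_lists_length_eq) simp

lemma finite_colours_of: "finite (colours_of M)"
proof -
  have "finite {h :: bool list. set h \<subseteq> UNIV \<and> length h = num_tapes M}"
    by (intro finite_lists_length_eq) simp
  then have "finite (cells M)" unfolding cells_def by (simp add: finite_scans)
  moreover have "{Class s w a | s w a. a \<le> 2} = (\<lambda>(s, w, a). Class s w a) ` (UNIV \<times> UNIV \<times> {..2})"
    by (force simp: image_def)
  ultimately show ?thesis unfolding colours_of_def by simp
qed

text \<open>Column \<open>off\<close> shows tape cell 0.\<close>

definition view :: "tm \<Rightarrow> nat \<Rightarrow> config \<Rightarrow> nat \<Rightarrow> tcell" where
  "view M off c i = (fst c, i = off,
     map (\<lambda>j. fst (snd c ! j) (int i - int off)) [0..<num_tapes M],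
     map (\<lambda>j. snd (snd c ! j) = int i - int off) [0..<num_tapes M])"

text \<open>The bound r on the distance of the heads from cell 0 grows by one per step and keeps
  them inside the window.\<close>

definition config_ok :: "tm \<Rightarrow> nat \<Rightarrow> config \<Rightarrow> bool" where
  "config_ok M r c \<longleftrightarrow> fst c < num_states M \<and> length (snd c) = num_tapes M \<and>
     (\<forall>j < num_tapes M. (\<forall>p. fst (snd c ! j) p < num_syms M) \<and> \<bar>snd (snd c ! j)\<bar> \<le> int r)"

section \<open>Configurations along a run and their views\<close>

lemma scan_list_in:
  assumes "config_ok M r c"
  shows "map scan (snd c) \<in> scans M"
proof -
  have "scan (snd c ! j) < num_syms M" if "j < length (snd c)" for j
    using assms that by (simp add: config_ok_def scan_def)
  then show ?thesis using assms by (auto simp: config_ok_def scans_def set_conv_nth)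
qed

lemma view_in: "config_ok M r c \<Longrightarrow> view M off c i \<in> cells M"
  by (auto simp: config_ok_def scans_def view_def cells_def)

lemma move_ok:
  assumes wf: "wf_tm M" and g: "g \<in> scans M" and q: "q < num_states M" and m: "move M q g = (q', acts)"
  shows "q' < num_states M" "length acts = num_tapes M"
    "\<And>j. j < num_tapes M \<Longrightarrow> fst (acts ! j) < num_syms M \<and> snd (acts ! j) \<in> {- 1, 0, 1}"
proof -
  have "q' < num_states M \<and> length acts = num_tapes M \<and> set acts \<subseteq> {..<num_syms M} \<times> {- 1, 0, 1}"
  proof (cases "q = 1")
    case True
    then show ?thesis using m g wf by (auto simp: move_def scans_def wf_tm_def)
  next
    case False
    then show ?thesis using m g wf q by (auto simp: move_def scans_def wf_tm_def split: prod.splits)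
  qed
  then show "q' < num_states M" "length acts = num_tapes M"
    "\<And>j. j < num_tapes M \<Longrightarrow> fst (acts ! j) < num_syms M \<and> snd (acts ! j) \<in> {- 1, 0, 1}"
    by (auto dest!: subsetD[OF _ nth_mem])
qed

lemma tm_step_move:
  assumes "config_ok M r c" "move M (fst c) (map scan (snd c)) = (q', acts)"
  shows "fst (tm_step M c) = q'" "length acts = num_tapes M \<Longrightarrow> length (snd (tm_step M c)) = num_tapes M"
    "length acts = num_tapes M \<Longrightarrow> j < num_tapes M \<Longrightarrow> snd (tm_step M c) ! j = act (acts ! j) (snd c ! j)"
proof -
  obtain q ts where c: "c = (q, ts)" by (cases c)
  have l: "length ts = num_tapes M" using assms(1) by (simp add: c config_ok_def)
  show "fst (tm_step M c) = q'" "length acts = num_tapes M \<Longrightarrow> length (snd (tm_step M c)) = num_tapes M"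
    "length acts = num_tapes M \<Longrightarrow> j < num_tapes M \<Longrightarrow> snd (tm_step M c) ! j = act (acts ! j) (snd c ! j)"
    using assms(2) l
    by (auto simp: c tm_step_def move_def act_def scan_def split: if_splits prod.splits)
qed

lemma config_ok_step:
  assumes wf: "wf_tm M" and c: "config_ok M r c"
  shows "config_ok M (Suc r) (tm_step M c)"
proof -
  obtain q' acts where m: "move M (fst c) (map scan (snd c)) = (q', acts)" by fastforce
  have q: "fst c < num_states M" using c by (simp add: config_ok_def)
  note ok = move_ok[OF wf scan_list_in[OF c] q m] and st = tm_step_move[OF c m]
  show ?thesis unfolding config_ok_def
  proof (intro conjI allI impI)
    fix j assume j: "j < num_tapes M"
    have old: "\<forall>p. fst (snd c ! j) p < num_syms M" "\<bar>snd (snd c ! j)\<bar> \<le> int r"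
      using c j by (auto simp: config_ok_def)
    show "fst (snd (tm_step M c) ! j) p < num_syms M" for p
      using st(3)[OF ok(2) j] ok(3)[OF j] old by (simp add: act_def)
    show "\<bar>snd (snd (tm_step M c) ! j)\<bar> \<le> int (Suc r)"
      using st(3)[OF ok(2) j] ok(3)[OF j] old by (auto simp: act_def)
  qed (use ok st in auto)
qed

lemma config_ok_init:
  assumes "wf_tm M" "num_tapes M > 2"
  shows "config_ok M 0 (tm_init M [x, w])"
proof -
  have "fst (input_tape y) p < num_syms M" "snd (input_tape y) = 0" for y p
    using assms(1) by (auto simp: input_tape_def bit_sym_def wf_tm_def)
  then show ?thesis using assms
    by (auto simp: config_ok_def tm_init_def nth_append nth_Cons' wf_tm_def)
qed

lemma config_ok_iterate:
  "wf_tm M \<Longrightarrow> config_ok M 0 c \<Longrightarrow> config_ok M r ((tm_step M ^^ r) c)"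
  by (induction r) (auto intro: config_ok_step)

text \<open>By the assumptions on \<open>off\<close> no head is in column 0 or W - 1, so no head
  crosses the seam, although the cyclic neighbourhood would permit it. Away from the heads nothing
  changes, hence the window determines its successor.\<close>

lemma next_cell_view:
  assumes wf: "wf_tm M" and c: "config_ok M r c" and off: "r < off" "off + r + 1 < W" and i: "i < W"
  shows "next_cell M (map scan (snd c)) (view M off c i) (view M off c (Suc i mod W))
      (view M off c (Suc (Suc i) mod W)) = view M off (tm_step M c) (Suc i mod W)"
proof -
  let ?v = "view M off c"
  define i' where "i' = Suc i mod W"
  define i'' where "i'' = Suc (Suc i) mod W"
  obtain q' acts where m: "move M (fst c) (map scan (snd c)) = (q', acts)" by fastforce
  have q: "fst c < num_states M" using c by (simp add: config_ok_def)
  note ok = move_ok[OF wf scan_list_in[OF c] q m] and st = tm_step_move[OF c m]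
  have i'_cases: "i' = Suc i \<and> Suc i < W \<or> i' = 0 \<and> Suc i = W" using i unfolding i'_def by (cases "Suc i = W") auto
  have i''_cases: "i'' = Suc i' \<and> Suc i' < W \<or> i'' = 0 \<and> Suc i' = W"
    using i'_cases unfolding i''_def by (cases "Suc i = W") (auto simp: mod_Suc)
  have sym: "(if heads (?v i') ! j then fst (acts ! j) else syms (?v i') ! j)
      = fst (snd (tm_step M c) ! j) (int i' - int off)" if "j < num_tapes M" for j
    using that st(3)[OF ok(2) that] by (auto simp: view_def act_def)
  have head: "(heads (?v i') ! j \<and> snd (acts ! j) = 0 \<or> heads (?v i) ! j \<and> snd (acts ! j) = 1 \<or>
        heads (?v i'') ! j \<and> snd (acts ! j) = - 1) \<longleftrightarrow> snd (snd (tm_step M c) ! j) = int i' - int off"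
    if j: "j < num_tapes M" for j
  proof -
    let ?h = "snd (snd c ! j)"
    have "\<bar>?h\<bar> \<le> int r" using c j by (simp add: config_ok_def)
    then have h: "0 < ?h + int off" "?h + int off + 1 < int W" using off by linarith+
    have l: "?h = int i - int off \<longleftrightarrow> ?h + 1 = int i' - int off" using i'_cases h by auto
    have r: "?h = int i'' - int off \<longleftrightarrow> ?h - 1 = int i' - int off" using i''_cases h by auto
    have "snd (acts ! j) = - 1 \<or> snd (acts ! j) = 0 \<or> snd (acts ! j) = 1" using ok(3)[OF j] by auto
    then show ?thesis using j l r st(3)[OF ok(2) j] by (elim disjE) (simp_all add: view_def act_def)
  qed
  have "next_cell M (map scan (snd c)) (?v i) (?v i') (?v i'') =
      (q', fst (snd (?v i')),
       map (\<lambda>j. if heads (?v i') ! j then fst (acts ! j) else syms (?v i') ! j) [0..<num_tapes M],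
       map (\<lambda>j. heads (?v i') ! j \<and> snd (acts ! j) = 0 \<or> heads (?v i) ! j \<and> snd (acts ! j) = 1 \<or>
        heads (?v i'') ! j \<and> snd (acts ! j) = - 1) [0..<num_tapes M])"
    using m by (simp add: next_cell_def view_def)
  also have "\<dots> = view M off (tm_step M c) i'"
    unfolding view_def[of M off "tm_step M c" i'] st(1) using sym head
    by (simp add: view_def)
  finally show ?thesis unfolding i'_def i''_def .
qed

definition start_colour :: "nat \<Rightarrow> nat \<Rightarrow> bool list \<Rightarrow> nat \<Rightarrow> colour" where
  "start_colour off P x i = Class (i = off) (off \<le> i \<and> i < off + P) (fst (input_tape x) (int i - int off))"

lemma view_init:
  assumes "num_tapes M > 2"
  shows "view M off (tm_init M [x, w]) i
    = start_cell M (i = off) (fst (input_tape x) (int i - int off)) (fst (input_tape w) (int i - int off))"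
proof -
  let ?ts = "snd (tm_init M [x, w])"
  have nth: "?ts ! j = (if j = 0 then input_tape x else if j = 1 then input_tape w else input_tape [])"
    if "j < num_tapes M" for j
    using that assms by (auto simp: tm_init_def nth_append nth_Cons')
  show ?thesis unfolding view_def start_cell_def using nth
    by (auto simp: tm_init_def input_tape_def)
qed

locale verification =
  fixes M :: tm and x :: "bool list" and T P :: nat and R :: "bool list \<Rightarrow> bool list \<Rightarrow> bool"
  assumes wf: "wf_tm M" and tapes: "num_tapes M > 2"
    and computes: "\<And>w. length w \<le> P \<Longrightarrow> computes_within M [x, w] [R x w] T"
begin

text \<open>In T steps the heads reach at most the cells from -T to T; one spare column on either
  side separates them from the seam. Besides the T simulated steps there are three transitions, for
  guessing, checking and accepting.\<close>

abbreviation "off \<equiv> T + 1"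
abbreviation "W \<equiv> 2 * T + 3"
abbreviation "H \<equiv> T + 3"
abbreviation "conf_at w r \<equiv> (tm_step M ^^ r) (tm_init M [x, w])"
abbreviation "cell_at w r \<equiv> view M off (conf_at w r)"

lemma ok: "config_ok M r (conf_at w r)"
  using config_ok_iterate[OF wf config_ok_init[OF wf tapes]] .

lemma final:
  assumes "length w \<le> P"
  shows "fst (conf_at w T) = 1" "fst (snd (conf_at w T) ! 2) 0 = bit_sym (R x w)"
  using computes[OF assms] by (auto simp: computes_within_def holds_string_def numeral_2_eq_2 split: prod.splits)

lemma evolution_of_witness:
  assumes w: "length w \<le> P" and R: "R x w"
  shows "\<exists>\<rho>. evolution (rule M) (scans M) (colours_of M) W H \<rho> \<and>
    (\<forall>i < W. \<rho> 0 i = start_colour off P x i \<and> \<rho> H i = Accept)"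
proof -
  \<comment> \<open>The rows 2 to T + 2 show the configurations 0 to T.\<close>
  define \<rho> where "\<rho> t i = (if t = 0 then start_colour off P x i else if t = 1 then Guess (cell_at w 0 i)
      else if t < H then Run (cell_at w (t - 2) i) else Accept)" for t i
  have in_V: "\<rho> t i \<in> colours_of M" for t i
    using view_in[OF ok] view_in[OF ok[of 0 w]] input_tape_le_2 by (auto simp: \<rho>_def colours_of_def start_colour_def)
  have "\<exists>g \<in> scans M. \<forall>i < W. rule M g (\<rho> t i) (\<rho> t (Suc i mod W)) (\<rho> t (Suc (Suc i) mod W)) (\<rho> (Suc t) (Suc i mod W))"
    if t: "t < H" for t
  proof -
    consider "t = 0" | "t = 1" | r where "t = r + 2" "r < T" | "t = T + 2"
    proof -
      have "t = 0 \<or> t = 1 \<or> t = (t - 2) + 2 \<and> t - 2 < T \<or> t = T + 2" using t by linarith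
      then show ?thesis using that by blast
    qed
    then show ?thesis
    proof cases
      case 1
      have "rule M g a (\<rho> t i) b (\<rho> (Suc t) i)" for g a b i
      proof -
        have "fst (input_tape w) (int i - int off) \<le> 2" by (rule input_tape_le_2)
        moreover have "fst (input_tape w) (int i - int off) \<noteq> 0 \<Longrightarrow> off \<le> i \<and> i < off + P"
          using w by (auto simp: input_tape_def split: if_splits)
        ultimately show ?thesis using 1
          by (auto simp: rule_def \<rho>_def start_colour_def view_init[OF tapes])
      qed
      then show ?thesis using scan_list_in[OF ok[of 0 w]] by blast
    next
      case 2
      have "rule M g (\<rho> t i) (\<rho> t (Suc i mod W)) b (\<rho> (Suc t) (Suc i mod W))" if i: "i < W" for g b i
      proof -
        have tape: "syms (cell_at w 0 k) ! 1 = fst (input_tape w) (int k - int off)" for k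
          using tapes by (simp add: view_init start_cell_def)
        have flag: "fst (snd (cell_at w 0 k)) = (k = off)" for k by (simp add: view_def)
        have "fst (input_tape w) (int i - int off) \<noteq> 0" if "fst (input_tape w) (int (Suc i mod W) - int off) \<noteq> 0"
          "Suc i mod W \<noteq> off"
          using that i by (cases "Suc i = W") (auto simp: input_tape_def bit_sym_def split: if_splits)
        then have "syms (cell_at w 0 (Suc i mod W)) ! 1 \<noteq> 0 \<longrightarrow>
            fst (snd (cell_at w 0 (Suc i mod W))) \<or> syms (cell_at w 0 i) ! 1 \<noteq> 0"
          unfolding tape flag by blast
        then show ?thesis using 2 by (simp add: rule_def \<rho>_def)
      qed
      then show ?thesis using scan_list_in[OF ok[of 0 w]] by blast
    next
      case 3
      let ?g = "map scan (snd (conf_at w r))"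
      have "rule M ?g (\<rho> t i) (\<rho> t (Suc i mod W)) (\<rho> t (Suc (Suc i) mod W)) (\<rho> (Suc t) (Suc i mod W))"
        if i: "i < W" for i
      proof -
        have "next_cell M ?g (cell_at w r i) (cell_at w r (Suc i mod W)) (cell_at w r (Suc (Suc i) mod W))
            = cell_at w (Suc r) (Suc i mod W)"
          using next_cell_view[OF wf ok[of r w], of off W i] 3 i by simp
        moreover have "\<forall>j < num_tapes M. heads (cell_at w r (Suc i mod W)) ! j \<longrightarrow>
            syms (cell_at w r (Suc i mod W)) ! j = ?g ! j"
          using ok[of r w] by (auto simp: view_def scan_def config_ok_def)
        ultimately show ?thesis using 3 by (auto simp: rule_def \<rho>_def)
      qed
      then show ?thesis using scan_list_in[OF ok[of r w]] by blast
    next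
      case 4
      have "rule M g a (\<rho> t i) b (\<rho> (Suc t) i)" for g a b i
        using 4 final[OF w] R tapes by (auto simp: rule_def \<rho>_def view_def bit_sym_def numeral_2_eq_2)
      then show ?thesis using scan_list_in[OF ok[of 0 w]] by blast
    qed
  qed
  then have "evolution (rule M) (scans M) (colours_of M) W H \<rho>"
    using in_V by (simp add: evolution_def)
  then show ?thesis by (intro exI[of _ \<rho>]) (simp add: \<rho>_def)
qed

text \<open>The witness is read off row 1; induction over the rows then shows that row r + 2 is the
  view of configuration r on this witness, so acceptance at the end is acceptance by the
  machine.\<close>

lemma witness_of_evolution:
  assumes ev: "evolution (rule M) (scans M) (colours_of M) W H \<rho>"
    and start: "\<And>i. i < W \<Longrightarrow> \<rho> 0 i = start_colour off P x i"
    and accept: "\<And>i. i < W \<Longrightarrow> \<rho> H i = Accept"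
  shows "\<exists>w. length w \<le> P \<and> R x w"
proof -
  obtain g where g: "\<And>t. t < H \<Longrightarrow> g t \<in> scans M" and
    rule: "\<And>t i. t < H \<Longrightarrow> i < W \<Longrightarrow>
      rule M (g t) (\<rho> t i) (\<rho> t (Suc i mod W)) (\<rho> t (Suc (Suc i) mod W)) (\<rho> (Suc t) (Suc i mod W))"
    using ev unfolding evolution_def by metis
  have mod: "Suc i mod W < W" for i by simp
  have surj: "\<exists>i' < W. Suc i' mod W = i" if "i < W" for i
  proof (cases i)
    case 0
    have "Suc (2 * T + 2) = W" by simp
    then have "Suc (2 * T + 2) mod W = 0" by (simp only: mod_self)
    then show ?thesis using 0 by (intro exI[of _ "2 * T + 2"]) simp
  next
    case (Suc k)
    then show ?thesis using that by (intro exI[of _ k]) simp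
  qed
  have rule': "\<exists>y z. rule M (g t) y (\<rho> t i) z (\<rho> (Suc t) i)" if "t < H" "i < W" for t i
    using rule[OF that(1)] surj[OF that(2)] by metis
  have "\<exists>u. u \<le> 2 \<and> (u \<noteq> 0 \<longrightarrow> off \<le> i \<and> i < off + P) \<and>
      \<rho> 1 i = Guess (start_cell M (i = off) (fst (input_tape x) (int i - int off)) u)"
    if "i < W" for i
    using rule'[of 0 i] start[OF that] that by (auto simp: rule_def start_colour_def)
  then obtain u where u: "\<And>i. i < W \<Longrightarrow> u i \<le> 2 \<and> (u i \<noteq> 0 \<longrightarrow> off \<le> i \<and> i < off + P)"
    and row1: "\<And>i. i < W \<Longrightarrow> \<rho> 1 i = Guess (start_cell M (i = off) (fst (input_tape x) (int i - int off)) (u i))"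
    by metis
  have syms_u: "syms (start_cell M s a v) ! Suc 0 = v" for s a v
    using tapes by (simp add: start_cell_def)
  have flag_u: "fst (snd (start_cell M s a v)) = s" for s a v
    by (simp add: start_cell_def)
  have contig: "u (Suc i mod W) \<noteq> 0 \<longrightarrow> Suc i mod W = off \<or> u i \<noteq> 0"
    and row2: "\<rho> 2 (Suc i mod W) = Run (start_cell M (Suc i mod W = off)
      (fst (input_tape x) (int (Suc i mod W) - int off)) (u (Suc i mod W)))" if "i < W" for i
  proof -
    have "rule M (g 1) (\<rho> 1 i) (\<rho> 1 (Suc i mod W)) (\<rho> 1 (Suc (Suc i) mod W)) (\<rho> 2 (Suc i mod W))"
      using rule[of 1 i] that unfolding Suc_1 by simp
    then have "\<rho> 2 (Suc i mod W) = Run (start_cell M (Suc i mod W = off)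
        (fst (input_tape x) (int (Suc i mod W) - int off)) (u (Suc i mod W))) \<and>
      (u (Suc i mod W) \<noteq> 0 \<longrightarrow> Suc i mod W = off \<or> u i \<noteq> 0)"
      unfolding row1[OF that] row1[OF mod] rule_def by (simp add: syms_u flag_u)
    then show "u (Suc i mod W) \<noteq> 0 \<longrightarrow> Suc i mod W = off \<or> u i \<noteq> 0"
      "\<rho> 2 (Suc i mod W) = Run (start_cell M (Suc i mod W = off)
        (fst (input_tape x) (int (Suc i mod W) - int off)) (u (Suc i mod W)))" by auto
  qed
  \<comment> \<open>The witness ends at the first blank guess or at the end of the window. What a
    longer witness would contain lies outside the view.\<close>
  define L where "L = (LEAST l. off + l \<ge> W \<or> u (off + l) = 0)"
  define w where "w = map (\<lambda>l. u (off + l) = 2) [0..<L]"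
  have L: "off + L \<ge> W \<or> u (off + L) = 0"
    unfolding L_def by (rule LeastI[of _ W]) simp
  have below: "off + l < W \<and> u (off + l) \<noteq> 0" if "l < L" for l
    using not_less_Least[of l "\<lambda>l. off + l \<ge> W \<or> u (off + l) = 0"] that unfolding L_def by auto
  have above: "u (off + l) = 0" if "L \<le> l" "off + l < W" for l
    using that
  proof (induction l)
    case 0
    then show ?case using L by auto
  next
    case (Suc l)
    show ?case
    proof (cases "L = Suc l")
      case True
      then show ?thesis using L Suc.prems by auto
    next
      case False
      then have "u (off + l) = 0" using Suc by auto
      then show ?thesis using contig[of "off + l"] Suc.prems by auto
    qed
  qed
  have w_len: "length w \<le> P"
  proof (cases L)
    case (Suc l)
    then show ?thesis using below[of l] u[of "off + l"] by (simp add: w_def)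
  qed (simp add: w_def)
  have u_tape: "u i = fst (input_tape w) (int i - int off)" if i: "i < W" for i
  proof -
    consider "i < off" | l where "i = off + l" "l < L" | l where "i = off + l" "L \<le> l"
      by (metis le_add_diff_inverse not_less)
    then show ?thesis
    proof cases
      case 1
      then show ?thesis using u[OF i] by (auto simp: input_tape_def)
    next
      case 2
      then have "u i = 1 \<or> u i = 2" using below[of l] u[OF i] by auto
      then show ?thesis using 2 by (auto simp: input_tape_def w_def bit_sym_def)
    next
      case 3
      then show ?thesis using above[of l] i by (auto simp: input_tape_def w_def)
    qed
  qed
  have run: "\<forall>i < W. \<rho> (r + 2) i = Run (cell_at w r i)" if "r \<le> T" for r
    using that
  proof (induction r)
    case 0
    show ?case
    proof (intro allI impI)
      fix i assume i: "i < W"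
      then obtain i' where "i' < W" "Suc i' mod W = i" using surj by blast
      then show "\<rho> (0 + 2) i = Run (cell_at w 0 i)"
        using row2[of i'] u_tape[OF i] unfolding add_0 by (simp add: view_init[OF tapes])
    qed
  next
    case (Suc r)
    then have IH: "\<rho> (r + 2) i = Run (cell_at w r i)" if "i < W" for i using that by auto
    have r: "r + 2 < H" using Suc.prems by simp
    note okr = ok[of r w]
    \<comment> \<open>No clause of the rule applies to a middle cell \<open>Accept\<close>, so that
      colour cannot occur before the last row.\<close>
    have not_accept: "\<rho> (Suc (r + 2)) i \<noteq> Accept" if "i < W" for i
      using rule'[of "Suc (r + 2)" i] that Suc.prems by (auto simp: rule_def)
    have step: "\<rho> (Suc (r + 2)) (Suc i mod W) = Run (next_cell M (g (r + 2)) (cell_at w r i) (cell_at w r (Suc i mod W))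
          (cell_at w r (Suc (Suc i) mod W)))"
      and agree: "\<And>j. j < num_tapes M \<Longrightarrow> heads (cell_at w r (Suc i mod W)) ! j \<Longrightarrow>
          syms (cell_at w r (Suc i mod W)) ! j = g (r + 2) ! j" if "i < W" for i
      using rule[OF r that] not_accept[OF mod[of i]] unfolding IH[OF that] IH[OF mod[of i]] IH[OF mod[of "Suc i"]]
      by (auto simp: rule_def)
    have "g (r + 2) = map scan (snd (conf_at w r))"
    proof (rule nth_equalityI)
      have len: "length (snd (conf_at w r)) = num_tapes M" using okr by (simp add: config_ok_def)
      show "length (g (r + 2)) = length (map scan (snd (conf_at w r)))"
        using g[OF r] len by (simp add: scans_def)
      fix j assume "j < length (g (r + 2))"
      then have j: "j < num_tapes M" using g[OF r] by (simp add: scans_def)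
      let ?h = "snd (snd (conf_at w r) ! j)"
      \<comment> \<open>Every head lies in the window, and its column compares the symbol under it
        with the guessed one; hence the guess is correct on every tape.\<close>
      have h: "\<bar>?h\<bar> \<le> int r" using okr j by (simp add: config_ok_def)
      define i where "i = nat (?h + int off)"
      have i: "i < W" "int i - int off = ?h" using h Suc.prems by (auto simp: i_def)
      obtain i' where i': "i' < W" "Suc i' mod W = i" using surj[OF i(1)] by blast
      show "g (r + 2) ! j = map scan (snd (conf_at w r)) ! j"
        using agree[OF i'(1) j] i j len unfolding i'(2) by (simp add: view_def scan_def)
    qed
    then have "\<rho> (Suc (r + 2)) (Suc i mod W) = Run (cell_at w (Suc r) (Suc i mod W))" if "i < W" for i
      using step[OF that] next_cell_view[OF wf okr, of off W i] that Suc.prems by simp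
    then show ?case using surj by (metis add_Suc)
  qed
  have "off < W" by simp
  obtain y z where "rule M (g (T + 2)) y (\<rho> (T + 2) off) z (\<rho> (Suc (T + 2)) off)"
    using rule'[of "T + 2" off] by auto
  moreover have "\<rho> (Suc (T + 2)) off = Accept" using accept[OF \<open>off < W\<close>] by (simp add: numeral_3_eq_3)
  moreover have "\<rho> (T + 2) off = Run (cell_at w T off)" using run[of T] by simp
  ultimately have "rule M (g (T + 2)) y (Run (cell_at w T off)) z Accept" by simp
  moreover have "fst (snd (cell_at w T off))" by (simp add: view_def)
  ultimately have "syms (cell_at w T off) ! 2 = 2" unfolding rule_def by simp
  then have "fst (snd (conf_at w T) ! 2) 0 = 2" using tapes by (simp add: view_def numeral_2_eq_2)
  then have "R x w" using final(2)[OF w_len] by (simp add: bit_sym_def split: if_splits)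
  then show ?thesis using w_len by blast
qed

end

section \<open>Generating the packing instance\<close>

primrec hornerE :: "expr \<Rightarrow> expr list \<Rightarrow> expr" where
  "hornerE Q [] = Const 0"
| "hornerE Q (d # ds) = Add d (Mul Q (hornerE Q ds))"

lemma eval_hornerE [simp]: "eval x \<rho> (hornerE Q ds) = horner (eval x \<rho> Q) (map (eval x \<rho>) ds)"
  by (induction ds) auto

lemma vars_hornerE: "vars (hornerE Q ds) \<subseteq> vars Q \<union> (\<Union>d \<in> set ds. vars d)"
  by (induction ds) auto

definition polyE :: "nat poly \<Rightarrow> expr \<Rightarrow> expr" where
  "polyE p e = hornerE e (map Const (coeffs p))"

lemma eval_polyE [simp]: "eval x \<rho> (polyE p e) = poly p (eval x \<rho> e)"
proof -
  have "horner y cs = poly (Poly cs) y" for y cs by (induction cs) auto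
  then show ?thesis by (simp add: polyE_def comp_def)
qed

lemma vars_polyE [simp]: "vars e = {} \<Longrightarrow> vars (polyE p e) = {}"
  using vars_hornerE[of e "map Const (coeffs p)"] by (auto simp: polyE_def)

text \<open>Truncated subtraction from 1 is negation of a truth value, which turns comparisons into
  arithmetic.\<close>

definition ltE :: "expr \<Rightarrow> expr \<Rightarrow> expr" where
  "ltE e f = Sub (Const 1) (Sub (Const 1) (Sub f e))"

definition leE :: "expr \<Rightarrow> expr \<Rightarrow> expr" where
  "leE e f = Sub (Const 1) (Sub e f)"

definition eqE :: "expr \<Rightarrow> expr \<Rightarrow> expr" where
  "eqE e f = Mul (leE e f) (leE f e)"

lemma eval_ltE [simp]: "eval x \<rho> (ltE e f) = of_bool (eval x \<rho> e < eval x \<rho> f)"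
  by (auto simp: ltE_def)

lemma eval_leE [simp]: "eval x \<rho> (leE e f) = of_bool (eval x \<rho> e \<le> eval x \<rho> f)"
  by (auto simp: leE_def)

lemma eval_eqE [simp]: "eval x \<rho> (eqE e f) = of_bool (eval x \<rho> e = eval x \<rho> f)"
  by (auto simp: eqE_def)

lemma vars_ltE [simp]: "vars (ltE e f) = vars e \<union> vars f"
  by (auto simp: ltE_def)

lemma vars_eqE [simp]: "vars (eqE e f) = vars e \<union> vars f"
  by (auto simp: eqE_def leE_def)

lemma vars_leE [simp]: "vars (leE e f) = vars e \<union> vars f"
  by (auto simp: leE_def)

definition gen_concat :: "gen list \<Rightarrow> gen" where
  "gen_concat gs = foldr Append gs Empty"

lemma nums_gen_concat [simp]: "nums (gen_concat gs) x d \<rho> = concat (map (\<lambda>g. nums g x d \<rho>) gs)"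
  by (induction gs) (auto simp: gen_concat_def)

lemma scoped_gen_concat [simp]: "scoped d (gen_concat gs) \<longleftrightarrow> (\<forall>g \<in> set gs. scoped d g)"
  by (induction gs) (auto simp: gen_concat_def)

text \<open>The twelve item shapes of a triple, independent of the triple, so that the program can
  list them without a loop.\<close>

datatype part = PSlot axis bool | PLink axis | PToken axis

definition parts :: "part list" where
  "parts = concat (map (\<lambda>s. [PSlot s False, PSlot s True, PLink s, PToken s]) [Row, Col, Diag])"

fun part_item :: "(axis \<Rightarrow> 'j \<Rightarrow> nat) \<Rightarrow> (axis \<Rightarrow> 'j \<Rightarrow> bool) \<Rightarrow> 'j \<Rightarrow> part \<Rightarrow> 'j item" where
  "part_item el tok j (PSlot s a) = Slot s j a"
| "part_item el tok j (PLink s) = Link s j"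
| "part_item el tok j (PToken s) = Token s (el s j) (tok s j)"

lemma triple_items_parts: "triple_items el tok j = map (part_item el tok j) parts"
  by (simp add: triple_items_def parts_def)

fun digitsE :: "expr \<Rightarrow> expr \<Rightarrow> (axis \<Rightarrow> expr) \<Rightarrow> (axis \<Rightarrow> bool) \<Rightarrow> part \<Rightarrow> expr list" where
  "digitsE U j el tok (PSlot Row a) = [Const 2, Const 12, j, Const 0, U, Const (of_bool a)]"
| "digitsE U j el tok (PSlot Col a) = [Const 2, Const 6, Sub U j, j, U, Const (of_bool a)]"
| "digitsE U j el tok (PSlot Diag a) = [Const 2, Const 1, Const 0, Sub U j, Const 0, Const (2 - 2 * of_bool a)]"
| "digitsE U j el tok (PLink Row) = [Const 2, Const 5, Sub U j, U, Sub U (el Row), Const 1]"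
| "digitsE U j el tok (PLink Col) = [Const 2, Const 3, j, Sub U j, Sub U (el Col), Const 1]"
| "digitsE U j el tok (PLink Diag) = [Const 2, Const 0, U, j, Sub (Mul (Const 2) U) (el Diag), Const 0]"
| "digitsE U j el tok (PToken Row) = [Const 2, Const 2, Const 0, Const 0, el Row, Const (of_bool (tok Row))]"
| "digitsE U j el tok (PToken Col) = [Const 2, Const 10, Const 0, Const 0, el Col, Const (of_bool (tok Col))]"
| "digitsE U j el tok (PToken Diag) = [Const 2, Const 18, Const 0, Const 0, el Diag, Const (2 - 2 * of_bool (tok Diag))]"

lemma eval_digitsE:
  assumes "eval x \<rho> UE = U" "eval x \<rho> jE = idx j" "\<And>s. eval x \<rho> (elE s) = el s j" "\<And>s. tokE s = tok s j"
  shows "map (eval x \<rho>) (digitsE UE jE elE tokE pt) = digits U idx el (part_item el tok j pt)"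
  using assms by (cases "(UE, jE, elE, tokE, pt)" rule: digitsE.cases) auto

lemma vars_digitsE:
  "e \<in> set (digitsE U j el tok pt) \<Longrightarrow> vars e \<subseteq> vars U \<union> vars j \<union> (\<Union>s. vars (el s))"
  by (cases "(U, j, el, tok, pt)" rule: digitsE.cases) auto

text \<open>The tiles, the polynomials and the numbering of colours belong to the verifier and not
  to the input; they enter the program as constants.\<close>

locale generator =
  fixes k :: nat and ts :: "tile list" and p q :: "nat poly"
    and code :: "bool \<Rightarrow> bool \<Rightarrow> nat \<Rightarrow> nat" and tc :: nat
begin

definition wlen :: "bool list \<Rightarrow> nat" where "wlen x = poly p (length x)"
text \<open>The running time with a witness of maximal length; by monotonicity it bounds the time
  for every admissible witness.\<close>

definition time :: "bool list \<Rightarrow> nat" where "time x = poly q (length x + wlen x)"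
definition width :: "bool list \<Rightarrow> nat" where "width x = 2 * time x + 3"
definition height :: "bool list \<Rightarrow> nat" where "height x = time x + 3"
definition base :: "bool list \<Rightarrow> nat \<Rightarrow> nat" where
  "base x i = code (i = time x + 1) (time x + 1 \<le> i \<and> i < time x + 1 + wlen x)
     (fst (input_tape x) (int i - int (time x + 1)))"

definition wlenE :: expr where "wlenE = polyE p Len"
definition timeE :: expr where "timeE = polyE q (Add Len wlenE)"
definition widthE :: expr where "widthE = Add (Mul (Const 2) timeE) (Const 3)"
definition heightE :: expr where "heightE = Add timeE (Const 3)"
definition offE :: expr where "offE = Add timeE (Const 1)"
definition boundE :: expr where
  "boundE = Mul (Mul (Mul (Const 2) (Add heightE (Const 2))) widthE) (Const (length ts))"
definition radixE :: expr where
  "radixE = Add (Mul (Const k) (Add (Mul (Const 2) boundE) (Const 19))) (Const 1)"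
definition binE :: expr where
  "binE = hornerE radixE [Const (k + 3), Const 19, boundE, boundE, Mul (Const 2) boundE, Const 2]"
definition keysE :: expr where
  "keysE = Add (Mul (Const 2) (Mul (Mul heightE widthE) (Const (length ts)))) (Mul (Const 2) widthE)"
definition cellE :: "expr \<Rightarrow> expr \<Rightarrow> expr \<Rightarrow> expr" where
  "cellE t i c = Add (Mul (Add (Mul t widthE) i) (Const (length ts))) c"
text \<open>The factor vanishes in the last column and so performs the reduction modulo the
  width.\<close>

definition succE :: "expr \<Rightarrow> expr" where
  "succE i = Mul (Add i (Const 1)) (ltE (Add i (Const 1)) widthE)"
text \<open>A table lookup: Horner's scheme with radix 1 is a plain sum, of which exactly one term
  has nonzero indicators. The factor before \<open>In\<close> yields a blank to the left of the
  start column, where the truncated difference would wrongly point to input cell 0.\<close>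

definition baseE :: "expr \<Rightarrow> expr" where
  "baseE i = hornerE (Const 1) (map (\<lambda>(s, w, a). Mul (Const (code s w a))
     (Mul (eqE (eqE i offE) (Const (of_bool s)))
       (Mul (eqE (Mul (leE offE i) (ltE i (Add offE wlenE))) (Const (of_bool w)))
         (eqE (Mul (leE offE i) (In (Sub i offE))) (Const a)))))
     [(False, False, 0), (False, False, 1), (False, False, 2), (False, True, 0), (False, True, 1), (False, True, 2),
      (True, False, 0), (True, False, 1), (True, False, 2), (True, True, 0), (True, True, 1), (True, True, 2)])"

lemma eval_simps [simp]:
  "eval x \<rho> wlenE = wlen x" "eval x \<rho> timeE = time x" "eval x \<rho> widthE = width x" "eval x \<rho> heightE = height x"
  "eval x \<rho> offE = time x + 1" "eval x \<rho> boundE = 2 * (height x + 2) * width x * length ts"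
  "eval x \<rho> keysE = 2 * (height x * width x * length ts) + 2 * width x"
  by (simp_all add: wlenE_def timeE_def widthE_def heightE_def offE_def boundE_def keysE_def
      wlen_def time_def width_def height_def)

lemma vars_simps [simp]:
  "vars wlenE = {}" "vars timeE = {}" "vars widthE = {}" "vars heightE = {}"
  "vars offE = {}" "vars boundE = {}" "vars keysE = {}" "vars radixE = {}"
  by (simp_all add: wlenE_def timeE_def widthE_def heightE_def offE_def boundE_def keysE_def radixE_def)

lemma vars_binE [simp]: "vars binE = {}"
  using vars_hornerE[of radixE] by (auto simp: binE_def)

lemma vars_cellE [simp]: "vars (cellE t i c) = vars t \<union> vars i \<union> vars c"
  by (auto simp: cellE_def)

lemma vars_succE [simp]: "vars (succE i) = vars i"
  by (auto simp: succE_def)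

lemma vars_baseE [simp]: "vars (baseE i) \<subseteq> vars i"
  by (simp add: baseE_def)

lemma eval_radixE: "eval x \<rho> radixE = radix k (eval x \<rho> boundE)"
  by (simp add: radixE_def radix_def del: eval_simps)

lemma eval_binE: "eval x \<rho> binE = bin_size k (eval x \<rho> boundE)"
  by (simp add: binE_def bin_size_def target_def eval_radixE del: eval_simps)

lemma eval_succE: "eval x \<rho> i < width x \<Longrightarrow> eval x \<rho> (succE i) = Suc (eval x \<rho> i) mod width x"
  by (auto simp: succE_def mod_Suc)

lemma eval_baseE: "eval x \<rho> (baseE i) = base x (eval x \<rho> i)"
proof -
  define n where "n = eval x \<rho> i"
  define a0 where "a0 = fst (input_tape x) (int n - int (time x + 1))"
  define c0 where "c0 = (n = time x + 1, time x + 1 \<le> n \<and> n < time x + 1 + wlen x, a0)"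
  let ?f = "\<lambda>(s, w, a). code s w a"
  let ?term = "\<lambda>(s, w, a). Mul (Const (code s w a))
     (Mul (eqE (eqE i offE) (Const (of_bool s)))
       (Mul (eqE (Mul (leE offE i) (ltE i (Add offE wlenE))) (Const (of_bool w)))
         (eqE (Mul (leE offE i) (In (Sub i offE))) (Const a))))"
  have "a0 \<le> 2" unfolding a0_def by (rule input_tape_le_2)
  then have a0: "a0 = 0 \<or> a0 = 1 \<or> a0 = 2" by auto
  have In: "of_bool (time x + 1 \<le> n) * fst (input_tape x) (int (n - (time x + 1))) = a0"
    by (auto simp: a0_def input_tape_def)
  have "eval x \<rho> (?term c) = ?f c * of_bool (c = c0)" for c
  proof (cases c)
    case (fields s w a)
    have "eval x \<rho> (eqE (eqE i offE) (Const (of_bool s))) = of_bool (s = fst c0)"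
      by (auto simp: n_def[symmetric] c0_def)
    moreover have "eval x \<rho> (eqE (Mul (leE offE i) (ltE i (Add offE wlenE))) (Const (of_bool w)))
        = of_bool (w = fst (snd c0))"
      by (auto simp: n_def[symmetric] c0_def)
    moreover have "eval x \<rho> (eqE (Mul (leE offE i) (In (Sub i offE))) (Const a)) = of_bool (a = snd (snd c0))"
      unfolding eval_eqE eval.simps eval_leE eval_simps n_def[symmetric] In by (auto simp: c0_def)
    ultimately show ?thesis unfolding fields by (cases c0) (auto simp del: eval_eqE)
  qed
  moreover have "horner (Suc 0) (map (\<lambda>c. f c * of_bool (c = c0)) cs) = of_bool (c0 \<in> set cs) * f c0"
    if "distinct cs" for f and cs :: "(bool \<times> bool \<times> nat) list"
    using that by (induction cs) auto
  moreover have "?f c0 = base x n" by (simp add: c0_def base_def a0_def)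
  ultimately show ?thesis unfolding baseE_def eval_hornerE n_def[symmetric] map_map comp_def
    using a0 by (auto simp: c0_def)
qed

definition tripleG :: "expr \<Rightarrow> (axis \<Rightarrow> expr) \<Rightarrow> (axis \<Rightarrow> bool) \<Rightarrow> gen" where
  "tripleG j el tok = gen_concat (map (\<lambda>pt. Append (Num (hornerE radixE (digitsE boundE j el tok pt))) (Num binE)) parts)"

lemma nums_tripleG:
  assumes "eval x \<rho> boundE = U" "eval x \<rho> jE = idx j" "\<And>s. eval x \<rho> (elE s) = el s j" "\<And>s. tokE s = tok s j"
  shows "nums (tripleG jE elE tokE) x d \<rho>
    = concat (map (\<lambda>it. [item_size k U idx el it, bin_size k U]) (triple_items el tok j))"
proof -
  have "eval x \<rho> (hornerE radixE (digitsE boundE jE elE tokE pt)) = item_size k U idx el (part_item el tok j pt)" for pt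
    using eval_digitsE[of x \<rho> boundE U jE idx j elE el tokE tok pt] assms
    by (simp add: item_size_def eval_radixE del: eval_simps)
  then show ?thesis
    by (simp add: tripleG_def triple_items_parts comp_def eval_binE assms(1) del: eval_simps)
qed

lemma scoped_tripleG:
  assumes "vars j \<subseteq> {..<d}" "\<And>s. vars (el s) \<subseteq> {..<d}"
  shows "scoped d (tripleG j el tok)"
proof -
  have "vars (hornerE radixE (digitsE boundE j el tok pt)) \<subseteq> {..<d}" for pt
    using vars_hornerE[of radixE "digitsE boundE j el tok pt"] vars_digitsE[of _ boundE j el tok pt] assms by fastforce
  then show ?thesis by (auto simp: tripleG_def)
qed

text \<open>Each loop occupies two registers, so the row is in register 0 and the column in register
  2. The tile number is a constant, as the tiles are listed without a loop.\<close>

definition lowG :: "nat \<Rightarrow> gen" where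
  "lowG n = tripleG (Mul (Const 2) (cellE (Var 0) (Var 2) (Const n)))
     (case_axis (cellE (Var 0) (Var 2) (Const (lcol (ts ! n)))) (cellE (Var 0) (Var 2) (Const (bcol (ts ! n))))
       (cellE (Var 0) (Var 2) (Const n))) (\<lambda>s. False)"

definition upG :: "nat \<Rightarrow> gen" where
  "upG n = tripleG (Add (Mul (Const 2) (cellE (Var 0) (Var 2) (Const n))) (Const 1))
     (case_axis (cellE (Var 0) (succE (Var 2)) (Const (rcol (ts ! n))))
       (cellE (Add (Var 0) (Const 1)) (Var 2) (Const (tcol (ts ! n))))
       (cellE (Var 0) (Var 2) (Const n))) (\<lambda>s. True)"

definition botG :: gen where
  "botG = tripleG (Mul (Const 2) (cellE heightE (Var 0) (Const 0)))
     (case_axis (cellE heightE (Var 0) (Const 0)) (cellE (Const 0) (Var 0) (baseE (Var 0)))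
       (cellE heightE (Var 0) (Const 0))) (\<lambda>s. s = Col)"

definition topG :: gen where
  "topG = tripleG (Add (Mul (Const 2) (cellE heightE (Var 0) (Const 0))) (Const 1))
     (case_axis (cellE (Add heightE (Const 1)) (Var 0) (Const 0)) (cellE heightE (Var 0) (Const tc))
       (cellE (Add heightE (Const 1)) (Var 0) (Const 0))) (\<lambda>s. s \<noteq> Col)"

definition cellG :: gen where
  "cellG = gen_concat (map (\<lambda>n. Append (lowG n) (upG n)) [0..<length ts])"

definition borderG :: gen where
  "borderG = Append botG topG"

text \<open>The order is that of \<open>enc_pack\<close> on the instance: the number of bins, then
  numerators and denominators of the items. A dummy has numerator 1 because its only nonzero digit
  is the lowest.\<close>

definition instG :: gen where
  "instG = Append (Num (Mul (Const 4) keysE)) (Append (For heightE (For widthE cellG)) (Append (For widthE borderG)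
     (For (Mul (Const (k - 3)) (Mul (Const 4) keysE)) (Append (Num (Const 1)) (Num binE)))))"

lemma scoped_instG: "scoped 0 instG"
proof -
  have "scoped 4 cellG"
    unfolding cellG_def scoped_gen_concat lowG_def upG_def
    by (auto intro!: scoped_tripleG split: axis.splits)
  moreover have "vars (baseE (Var 0)) \<subseteq> {..<2}" using vars_baseE[of "Var 0"] by fastforce
  then have "scoped 2 borderG"
    by (auto simp: borderG_def botG_def topG_def intro!: scoped_tripleG split: axis.splits)
  ultimately show ?thesis by (simp add: instG_def numeral_eq_Suc)
qed

end

locale instance_of = generator + tile_cover ts "width x" "height x" "base x" tc for x :: "bool list"
begin

abbreviation "sz \<equiv> item_size k bound idx el"
abbreviation "bin \<equiv> bin_size k bound"
abbreviation "pair it \<equiv> [sz it, bin]"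
abbreviation "pairs j \<equiv> concat (map pair (triple_items el tok j))"

section \<open>The generated numbers are the encoding of the instance\<close>

lemma eval_boundE: "eval x \<rho> boundE = bound"
  by (simp add: bound_def)

lemma eval_cellE: "eval x \<rho> (cellE t i c) = cell (eval x \<rho> t) (eval x \<rho> i) (eval x \<rho> c)"
  by (simp add: cellE_def cell_def)

lemma nums_cellG:
  assumes "\<rho> 0 = t" "\<rho> 2 = i" "i < width x"
  shows "nums cellG x d \<rho> = concat (map (\<lambda>n. pairs (Low t i n)
    @ pairs (Up t i n)) [0..<length ts])"
proof -
  have low: "nums (lowG n) x d \<rho> = pairs (Low t i n)" for n
    unfolding lowG_def
    by (rule nums_tripleG[OF eval_boundE]) (use assms in \<open>auto simp: eval_cellE el_def split: axis.splits\<close>)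
  have up: "nums (upG n) x d \<rho> = pairs (Up t i n)" for n
    unfolding upG_def
    by (rule nums_tripleG[OF eval_boundE]) (use assms in \<open>auto simp: eval_cellE eval_succE el_def split: axis.splits\<close>)
  show ?thesis unfolding cellG_def nums_gen_concat map_map comp_def nums.simps(3) low up ..
qed

lemma nums_borderG:
  assumes "\<rho> 0 = i"
  shows "nums borderG x d \<rho> = pairs (Bot i)
    @ pairs (Top i)"
proof -
  have bot: "nums botG x d \<rho> = pairs (Bot i)"
    unfolding botG_def
    by (rule nums_tripleG[OF eval_boundE]) (use assms in \<open>auto simp: eval_cellE eval_baseE el_def split: axis.splits\<close>)
  have top: "nums topG x d \<rho> = pairs (Top i)"
    unfolding topG_def
    by (rule nums_tripleG[OF eval_boundE]) (use assms in \<open>auto simp: eval_cellE el_def split: axis.splits\<close>)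
  show ?thesis unfolding borderG_def nums.simps(3) bot top ..
qed

definition inst :: pack_inst where
  "inst = (map (\<lambda>it. (sz it, bin)) (cover_items k keys el tok), 4 * length keys)"

lemma nums_instG:
  "nums instG x 0 (\<lambda>_. 0) = 4 * length keys # concat (map pair (cover_items k keys el tok))"
proof -
  have cells: "nums (For heightE (For widthE cellG)) x 0 (\<lambda>_. 0)
      = concat (map (\<lambda>t. concat (map (\<lambda>i. concat (map (\<lambda>n. pairs (Low t i n) @ pairs (Up t i n)) [0..<length ts]))
          [0..<width x])) [0..<height x])"
    by (auto intro!: arg_cong[where f = concat] map_cong nums_cellG)
  have border: "nums (For widthE borderG) x 0 (\<lambda>_. 0) = concat (map (\<lambda>i. pairs (Bot i) @ pairs (Top i)) [0..<width x])"
    by (auto intro!: arg_cong[where f = concat] map_cong nums_borderG)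
  have dummies: "nums (For (Mul (Const (k - 3)) (Mul (Const 4) keysE)) (Append (Num (Const 1)) (Num binE))) x 0 (\<lambda>_. 0)
      = concat (map pair (replicate ((k - 3) * (4 * length keys)) Dummy))"
  proof -
    have "sz Dummy = 1" by (simp add: item_size_def)
    moreover have "concat (map (\<lambda>i. ys) [0..<n]) = concat (map (\<lambda>_. ys) (replicate n (Dummy :: key item)))" for n and ys :: "nat list"
      by (simp add: map_replicate_const)
    ultimately show ?thesis
      by (simp add: eval_binE eval_boundE length_keys del: eval_simps(6))
  qed
  have fl: "concat (map pair (concat (map (triple_items el tok) js))) = concat (map pairs js)" for js
    by (induction js) auto
  have bins: "nums (Num (Mul (Const 4) keysE)) x 0 (\<lambda>_. 0) = [4 * length keys]" by (simp add: length_keys)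
  have "concat (map pairs keys) = nums (For heightE (For widthE cellG)) x 0 (\<lambda>_. 0) @ nums (For widthE borderG) x 0 (\<lambda>_. 0)"
    unfolding cells border by (simp add: keys_def concat_map_concat comp_def)
  then show ?thesis
    unfolding instG_def nums.simps(3) bins dummies cover_items_def map_append concat_append fl by simp
qed

lemma enc_inst: "enc_pack inst = concat (map enc_nat (nums instG x 0 (\<lambda>_. 0)))"
proof -
  have "concat (map (\<lambda>(a, b). enc_nat a @ enc_nat b) (map (\<lambda>it. (sz it, bin)) its))
      = concat (map enc_nat (concat (map pair its)))" for its
    by (induction its) auto
  then show ?thesis unfolding nums_instG by (simp add: enc_pack_def inst_def)
qed

lemma inst_yes: "k \<ge> 3 \<Longrightarrow> inst \<in> pack_yes k \<longleftrightarrow> (\<exists>\<theta>. tiling (set ts) (width x) (height x) (base x) tc \<theta>)"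
  using packable_iff_tiling[of k]
  by (auto simp: pack_yes_def inst_def pack_instances_def item_size_pos bin_size_pos comp_def)

lemma inst_in: "inst \<in> pack_instances"
  by (auto simp: inst_def pack_instances_def item_size_pos bin_size_pos)

text \<open>Two additional rows at most triple the height, while the number of keys counts two
  triples for every cell and tile. This ties the digits to the size of the instance.\<close>

lemma bound_le: "bound \<le> 3 * length keys"
proof -
  have "2 * (height x + 2) \<le> 6 * height x" by (simp add: height_def)
  then have "2 * (height x + 2) * width x * length ts \<le> 6 * height x * width x * length ts"
    by (intro mult_le_mono1)
  also have "\<dots> = 3 * (2 * (height x * width x * length ts))" by simp
  also have "\<dots> \<le> 3 * (2 * (height x * width x * length ts) + 2 * width x)" by simp
  finally show ?thesis unfolding bound_def length_keys .
qed

text \<open>Every encoded number takes at least one bit, so the number of keys is at most the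
  encoding length L. Then U is at most 3 * L, the radix at most k * (6 * L + 19) + 1, and six digits
  give its sixth power as a bound.\<close>

lemma pack_max_inst:
  assumes "k \<ge> 1"
  shows "pack_max inst \<le> poly ([:k * 19 + 1, k * 6:] ^ 6) (length (enc_pack inst))"
proof -
  let ?Q = "radix k bound" and ?L = "length (enc_pack inst)"
  have "length xs \<le> length (concat (map enc_nat xs))" for xs
  proof (induction xs)
    case (Cons a xs)
    moreover have "1 \<le> length (enc_nat a)" by (simp add: enc_nat_def)
    ultimately show ?case by simp
  qed simp
  from this[of "nums instG x 0 (\<lambda>_. 0)"]
  have "1 + 2 * length (cover_items k keys el tok) \<le> ?L"
    unfolding enc_inst nums_instG by (simp add: length_concat comp_def sum_list_triv)
  moreover have "length keys \<le> length (cover_items k keys el tok)"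
    by (simp add: cover_items_def triple_items_def length_concat comp_def sum_list_triv)
  ultimately have N: "length keys \<le> ?L" by linarith
  have "k * (2 * bound + 19) + 1 \<le> k * (6 * ?L + 19) + 1"
    using bound_le N by (intro add_mono mult_le_mono2) auto
  then have Q: "?Q \<le> k * 19 + 1 + ?L * (k * 6)" by (simp add: radix_def algebra_simps)
  have size: "sz it \<le> ?Q ^ 6" if "it \<in> set (cover_items k keys el tok)" for it
  proof -
    have "\<forall>d \<in> set (digits bound idx el it). d < ?Q"
    proof
      fix d assume "d \<in> set (digits bound idx el it)"
      then obtain i where i: "i < 6" "d = digits bound idx el it ! i"
        by (metis in_set_conv_nth length_digits)
      have "d \<le> 2 * bound + 18"
        using digit_le[OF ids_ok_keys item_ok_cover_items[OF ids_ok_keys that] i(1)] i(2) by simp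
      also have "\<dots> < ?Q" using assms by (cases k) (auto simp: radix_def)
      finally show "d < ?Q" .
    qed
    from horner_less[OF this] show ?thesis by (simp add: item_size_def length_digits)
  qed
  have "\<forall>d \<in> set (target k bound). d < ?Q" using target_less_radix[OF assms] by blast
  moreover have "length (target k bound) = 6" by (simp add: target_def)
  ultimately have bin: "bin \<le> ?Q ^ 6" unfolding bin_size_def by (metis horner_less less_imp_le)
  let ?Z = "k * 19 + 1 + ?L * (k * 6)"
  have QZ: "?Q ^ 6 \<le> ?Z ^ 6" using Q by (intro power_mono) auto
  have "4 * length keys \<le> ?L * 6" using N by simp
  also have "\<dots> \<le> ?L * (k * 6)" using assms by simp
  also have "\<dots> \<le> ?Z" by simp
  also have "\<dots> \<le> ?Z ^ 6" by (rule self_le_power) auto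
  finally have m: "4 * length keys \<le> ?Z ^ 6" .
  define z where "z = ?Z ^ 6"
  have "pack_max inst \<le> z"
    unfolding pack_max_def inst_def prod.case
  proof (intro Max.boundedI)
    fix a assume "a \<in> insert (4 * length keys) (fst ` set (map (\<lambda>it. (sz it, bin)) (cover_items k keys el tok))
      \<union> snd ` set (map (\<lambda>it. (sz it, bin)) (cover_items k keys el tok)))"
    then show "a \<le> z" using m le_trans[OF size QZ] le_trans[OF bin QZ] unfolding z_def by auto
  qed auto
  then show ?thesis unfolding z_def by (simp add: poly_power)
qed

end

section \<open>Composition of the reduction for an arbitrary language in NP\<close>

lemma poly_nat_mono: "a \<le> b \<Longrightarrow> poly r a \<le> poly (r :: nat poly) b"
  by (induction r) (auto intro: add_mono mult_mono)

lemma computes_within_mono: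
  assumes "computes_within M xs y t" "t \<le> T"
  shows "computes_within M xs y T"
proof -
  obtain d where d: "T = d + t" using assms(2) by (metis le_add_diff_inverse2)
  have "fst ((tm_step M ^^ t) (tm_init M xs)) = 1"
    using assms(1) by (auto simp: computes_within_def split: prod.splits)
  then have "(tm_step M ^^ T) (tm_init M xs) = (tm_step M ^^ t) (tm_init M xs)"
    unfolding d funpow_add comp_apply by (rule halted_funpow)
  then show ?thesis using assms(1) by (simp add: computes_within_def)
qed

text \<open>The polynomial bounding the numbers mentions neither the language nor its verifier. This
  matters because strong hardness fixes one polynomial for all languages; the size of the tile set
  is absorbed by the encoding length.\<close>

lemma pack_hard_for_NP:
  assumes L: "L \<in> NP" and k: "k \<ge> 3"
  shows "\<exists>f. polytime 1 f \<and> (\<forall>x. \<exists>I \<in> pack_instances.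
    pack_max I \<le> poly ([:k * 19 + 1, k * 6:] ^ 6) (length (enc_pack I)) \<and> f [x] = enc_pack I \<and> (x \<in> L \<longleftrightarrow> I \<in> pack_yes k))"
proof -
  obtain p :: "nat poly" and R where pt: "polytime 2 (\<lambda>xs. [R (xs ! 0) (xs ! 1)])"
    and L: "\<And>x. x \<in> L \<longleftrightarrow> (\<exists>w. length w \<le> poly p (length x) \<and> R x w)"
    using L by (auto simp: NP_def)
  obtain M and q :: "nat poly" where wf: "wf_tm M" and tapes: "num_tapes M > 2"
    and comp: "\<And>xs. length xs = 2 \<Longrightarrow> computes_within M xs [R (xs ! 0) (xs ! 1)] (poly q (sum_list (map length xs)))"
    using pt by (auto simp: polytime_def)
  let ?V = "colours_of M" and ?G = "scans M"
  have fin: "finite ?V" "finite (?V \<times> ?V \<times> ?G)" using finite_colours_of finite_scans by blast+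
  obtain n :: "colour \<Rightarrow> nat" and nn where n: "n ` ?V = {i. i < nn}" "inj_on n ?V"
    using finite_imp_inj_to_nat_seg[OF fin(1)] by blast
  obtain h :: "colour \<times> colour \<times> nat list \<Rightarrow> nat" and hn where h: "h ` (?V \<times> ?V \<times> ?G) = {i. i < hn}" "inj_on h (?V \<times> ?V \<times> ?G)"
    using finite_imp_inj_to_nat_seg[OF fin(2)] by blast
  let ?X = "rule_tiles (rule M) ?G ?V h n"
  obtain ts0 where ts0: "set ts0 = ?X" using finite_list[OF finite_rule_tiles[OF fin(1) finite_scans]] by blast
  have "?X \<noteq> {}"
  proof -
    have c: "config_ok M 0 (tm_init M [[], []])" by (rule config_ok_init[OF wf tapes])
    let ?c = "view M 1 (tm_init M [[], []]) 0"
    \<comment> \<open>Some tile is needed for padding. Column 0 is not the start column 1, so its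
      flag is off and acceptance holds vacuously.\<close>
    have "rule M (map scan (snd (tm_init M [[], []]))) Accept (Run ?c) Accept Accept"
      by (simp add: rule_def view_def)
    moreover have "Run ?c \<in> ?V" "Accept \<in> ?V" using view_in[OF c] by (auto simp: colours_of_def)
    ultimately show ?thesis using scan_list_in[OF c] unfolding rule_tiles_def by blast
  qed
  then obtain x0 where x0: "x0 \<in> ?X" by blast
  \<comment> \<open>Repeating a tile leaves the tile set unchanged but makes the list longer than
    every colour number, all of which are below nn or hn.\<close>
  define ts where "ts = ts0 @ replicate (Suc (nn + hn)) x0"
  have "set ts = insert x0 (set ts0)" by (simp add: ts_def set_replicate_conv_if)
  then have set_ts: "set ts = ?X" using ts0 x0 by (simp only: insert_absorb)
  have small: "n v < length ts" if "v \<in> ?V" for v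
  proof -
    have "n v \<in> {i. i < nn}" using n(1) that by blast
    then show ?thesis by (simp add: ts_def)
  qed
  have small_h: "h v < length ts" if "v \<in> ?V \<times> ?V \<times> ?G" for v
  proof -
    have "h v \<in> {i. i < hn}" using h(1) that by blast
    then show ?thesis by (simp add: ts_def)
  qed
  have start_in: "start_colour off P x i \<in> ?V" for off P x i
    using input_tape_le_2 by (auto simp: start_colour_def colours_of_def)
  have Accept_in: "Accept \<in> ?V" by (simp add: colours_of_def)
  define code where "code s w a = n (Class s w a)" for s w a
  interpret generator k ts p q code "n Accept" .
  have base: "base x i = n (start_colour (time x + 1) (wlen x) x i)" for x i
    by (simp add: base_def code_def start_colour_def)
  let ?f = "\<lambda>xs. concat (map enc_nat (nums instG (xs ! 0) 0 (\<lambda>_. 0)))"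
  have "\<exists>I \<in> pack_instances. pack_max I \<le> poly ([:k * 19 + 1, k * 6:] ^ 6) (length (enc_pack I)) \<and> ?f [x] = enc_pack I
      \<and> (x \<in> L \<longleftrightarrow> I \<in> pack_yes k)" for x
  proof -
    interpret instance_of k ts p q code "n Accept" x
    proof unfold_locales
      show "0 < width x" "0 < height x" by (simp_all add: width_def height_def)
      show "lcol y < length ts \<and> bcol y < length ts \<and> rcol y < length ts \<and> tcol y < length ts" if "y \<in> set ts" for y
        using that unfolding set_ts rule_tiles_def by (auto intro!: small small_h)
      show "base x i < length ts" for i unfolding base by (rule small[OF start_in])
      show "n Accept < length ts" by (rule small[OF Accept_in])
    qed
    interpret verification M x "time x" "wlen x" R
    proof unfold_locales
      fix w :: "bool list" assume "length w \<le> wlen x"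
      then have "poly q (length x + length w) \<le> time x" by (simp add: time_def poly_nat_mono)
      moreover have "computes_within M [x, w] [R x w] (poly q (length x + length w))"
        using comp[of "[x, w]"] by simp
      ultimately show "computes_within M [x, w] [R x w] (time x)" by (rule computes_within_mono[rotated])
    qed (use wf tapes in auto)
    have "(\<exists>\<theta>. tiling (set ts) (width x) (height x) (base x) (n Accept) \<theta>) \<longleftrightarrow> (\<exists>w. length w \<le> wlen x \<and> R x w)"
    proof
      assume "\<exists>\<theta>. tiling (set ts) (width x) (height x) (base x) (n Accept) \<theta>"
      then obtain \<theta> where "tiling ?X (width x) (height x) (\<lambda>i. n (start_colour (time x + 1) (wlen x) x i)) (n Accept) \<theta>"
        unfolding set_ts by (auto simp: base[abs_def])
      from evolution_of_tiling[OF this h(2) n(2) _ _ start_in Accept_in]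
      obtain \<rho> where "evolution (rule M) ?G ?V (width x) (height x) \<rho>"
        "\<And>i. i < width x \<Longrightarrow> \<rho> 0 i = start_colour (time x + 1) (wlen x) x i" "\<And>i. i < width x \<Longrightarrow> \<rho> (height x) i = Accept"
        by (metis W H)
      then show "\<exists>w. length w \<le> wlen x \<and> R x w"
        using witness_of_evolution[of \<rho>] by (simp add: width_def height_def)
    next
      assume "\<exists>w. length w \<le> wlen x \<and> R x w"
      then obtain \<rho> where "evolution (rule M) ?G ?V (width x) (height x) \<rho>"
        "\<And>i. i < width x \<Longrightarrow> \<rho> 0 i = start_colour (time x + 1) (wlen x) x i" "\<And>i. i < width x \<Longrightarrow> \<rho> (height x) i = Accept"
        using evolution_of_witness unfolding width_def height_def by metis
      from tiling_of_evolution[OF this(1) W H this(2,3)]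
      show "\<exists>\<theta>. tiling (set ts) (width x) (height x) (base x) (n Accept) \<theta>"
        unfolding set_ts by (simp add: base[abs_def])
    qed
    then have "x \<in> L \<longleftrightarrow> inst \<in> pack_yes k"
      unfolding inst_yes[OF k] L wlen_def by simp
    then show ?thesis using inst_in pack_max_inst k enc_inst by (intro bexI[of _ inst]) auto
  qed
  then show ?thesis using polytime_gen[OF scoped_instG] by blast
qed

theorem theorem1:
  fixes k :: nat
  assumes "k \<ge> 3"
  shows "strongly_np_hard enc_pack pack_max pack_instances (pack_yes k)"
  unfolding strongly_np_hard_def np_hard_def
proof (rule exI, rule ballI)
  fix L assume "L \<in> NP"
  from pack_hard_for_NP[OF this assms]
  show "\<exists>f. polytime 1 f \<and> (\<forall>x. \<exists>I \<in> {I \<in> pack_instances.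
      pack_max I \<le> poly ([:k * 19 + 1, k * 6:] ^ 6) (length (enc_pack I))}. f [x] = enc_pack I \<and> (x \<in> L \<longleftrightarrow> I \<in> pack_yes k))"
    by fastforce
qed

end
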